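(* Let $P\in\mathbb{R}[x_1,y_1,x_2,y_2]$ be an irreducible polynomial of degree at most $D$. Then there exists a variety $Y\subset\mathbb{C}^4$ of dimension at most two and degree bounded by a constant depending only on $D$, such that for every point $p\in \mathbf{Z}_{\mathbb{R}}(P)\setminus Y(\mathbb{R})$ there is at most one irreducible complex algebraic curve $\gamma\subset\mathbb{C}^2$ with $p\in\iota(\gamma)_{\mathrm{reg}}$ and $\iota(\gamma)\subset \mathbf{Z}_{\mathbb{R}}(P)$.
   Context: $\iota:\mathbb{C}^2\to\mathbb{R}^4$ is the identification $\iota(x_1+iy_1,x_2+iy_2)=(x_1,y_1,x_2,y_2)$ with $x_1,y_1,x_2,y_2\in\mathbb{R}$. $\mathbf{Z}_{\mathbb{R}}(P)\subset\mathbb{R}^4$ is the real zero set of $P$. For a complex variety $Y\subset\mathbb{C}^4$, $Y(\mathbb{R})=Y\cap\mathbb{R}^4$ is its set of real points. Varieties are (possibly reducible) Zariski closed sets; the degree of a reducible variety is the sum of the degrees of its irreducible components. For a complex curve $\gamma$, $\iota(\gamma)_{\mathrm{reg}}$ denotes the set of regular (nonsingular) points of the real variety $\iota(\gamma)$, which equals $\iota(\gamma_{\mathrm{reg}})$, the image of the nonsingular points of $\gamma$. *)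

theory Defs
  imports Complex_Main "HOL-Library.Poly_Mapping" "HOL-Library.Extended_Nat"
    "HOL-Computational_Algebra.Factorial_Ring"
begin

text \<open>Multivariate polynomials over a ring 'a in variables indexed by nat:
  monomials are finitely supported exponent vectors nat =>0 nat.
  The ring structure (and hence irreducible) comes from HOL-Library.Poly_Mapping.\<close>

type_synonym 'a mpoly = "(nat \<Rightarrow>\<^sub>0 nat) \<Rightarrow>\<^sub>0 'a"

definition vars :: "'a::zero mpoly \<Rightarrow> nat set" where
  "vars p = {i. \<exists>m\<in>Poly_Mapping.keys p. i \<in> Poly_Mapping.keys m}"

definition tdeg :: "'a::zero mpoly \<Rightarrow> nat" where
  "tdeg p = Max (insert 0 ((\<lambda>m. sum (Poly_Mapping.lookup m) (Poly_Mapping.keys m)) ` Poly_Mapping.keys p))"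

definition aff :: "nat \<Rightarrow> (nat \<Rightarrow> 'a::zero) set" where
  "aff n = {x. \<forall>i\<ge>n. x i = 0}"

definition peval :: "'a::comm_semiring_1 mpoly \<Rightarrow> (nat \<Rightarrow> 'a) \<Rightarrow> 'a" where
  "peval p x = (\<Sum>m\<in>Poly_Mapping.keys p. Poly_Mapping.lookup p m * (\<Prod>j\<in>Poly_Mapping.keys m. x j ^ Poly_Mapping.lookup m j))"

definition peval_pdiff :: "nat \<Rightarrow> 'a::comm_semiring_1 mpoly \<Rightarrow> (nat \<Rightarrow> 'a) \<Rightarrow> 'a" where
  "peval_pdiff i p x = (\<Sum>m\<in>Poly_Mapping.keys p. Poly_Mapping.lookup p m * of_nat (Poly_Mapping.lookup m i) *
      (\<Prod>j\<in>Poly_Mapping.keys m. x j ^ (if j = i then Poly_Mapping.lookup m j - 1 else Poly_Mapping.lookup m j)))"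

definition zeros :: "nat \<Rightarrow> 'a::comm_semiring_1 mpoly set \<Rightarrow> (nat \<Rightarrow> 'a) set" where
  "zeros n F = {x \<in> aff n. \<forall>f\<in>F. peval f x = 0}"

definition zclosed :: "nat \<Rightarrow> (nat \<Rightarrow> 'a::comm_semiring_1) set \<Rightarrow> bool" where
  "zclosed n V \<longleftrightarrow> (\<exists>F. (\<forall>f\<in>F. vars f \<subseteq> {..<n}) \<and> V = zeros n F)"

definition zirred :: "nat \<Rightarrow> (nat \<Rightarrow> 'a::comm_semiring_1) set \<Rightarrow> bool" where
  "zirred n V \<longleftrightarrow> zclosed n V \<and> V \<noteq> {} \<and>
     (\<forall>A B. zclosed n A \<and> zclosed n B \<and> V = A \<union> B \<longrightarrow> V = A \<or> V = B)"

definition zdim :: "nat \<Rightarrow> (nat \<Rightarrow> 'a::comm_semiring_1) set \<Rightarrow> enat" where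
  "zdim n V = Sup {enat k | k. \<exists>c :: nat \<Rightarrow> (nat \<Rightarrow> 'a) set.
      (\<forall>i\<le>k. zirred n (c i) \<and> c i \<subseteq> V) \<and> (\<forall>i<k. c i \<subset> c (Suc i))}"

definition zcomponents :: "nat \<Rightarrow> (nat \<Rightarrow> 'a::comm_semiring_1) set \<Rightarrow> (nat \<Rightarrow> 'a) set set" where
  "zcomponents n V = {W. zirred n W \<and> W \<subseteq> V \<and>
      (\<forall>W'. zirred n W' \<and> W \<subseteq> W' \<and> W' \<subseteq> V \<longrightarrow> W' = W)}"

definition zdeg_irr :: "nat \<Rightarrow> (nat \<Rightarrow> 'a::comm_semiring_1) set \<Rightarrow> nat" where
  "zdeg_irr n W = Sup {card (W \<inter> L) | L. \<exists>(a :: nat \<Rightarrow> nat \<Rightarrow> 'a) (b :: nat \<Rightarrow> 'a).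
      L = {x \<in> aff n. \<forall>j < the_enat (zdim n W). (\<Sum>i<n. a j i * x i) = b j} \<and>
      finite (W \<inter> L)}"

definition zdeg :: "nat \<Rightarrow> (nat \<Rightarrow> 'a::comm_semiring_1) set \<Rightarrow> nat" where
  "zdeg n V = (\<Sum>W\<in>zcomponents n V. zdeg_irr n W)"

definition realZ :: "real mpoly \<Rightarrow> (nat \<Rightarrow> real) set" where
  "realZ P = zeros 4 {P}"

definition real_points :: "(nat \<Rightarrow> complex) set \<Rightarrow> (nat \<Rightarrow> real) set" where
  "real_points Y = {x \<in> aff 4. (\<lambda>i. complex_of_real (x i)) \<in> Y}"

definition iota :: "(nat \<Rightarrow> complex) \<Rightarrow> (nat \<Rightarrow> real)" where
  "iota z = (\<lambda>i. if i = 0 then Re (z 0) else if i = 1 then Im (z 0)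
       else if i = 2 then Re (z 1) else if i = 3 then Im (z 1) else 0)"

definition plane_curve :: "(nat \<Rightarrow> complex) set \<Rightarrow> bool" where
  "plane_curve \<gamma> \<longleftrightarrow> zirred 2 \<gamma> \<and> zdim 2 \<gamma> = 1"

definition curve_reg :: "(nat \<Rightarrow> complex) set \<Rightarrow> (nat \<Rightarrow> complex) set" where
  "curve_reg \<gamma> = {q \<in> \<gamma>. \<exists>f :: complex mpoly. vars f \<subseteq> {..<2} \<and> irreducible f \<and>
      zeros 2 {f} = \<gamma> \<and> (peval_pdiff 0 f q \<noteq> 0 \<or> peval_pdiff 1 f q \<noteq> 0)}"

end

theory Submission
  imports Defs "Subresultants.Subresultant_Gcd" "HOL-Computational_Algebra.Field_as_Ring"
    "HOL-Computational_Algebra.Fundamental_Theorem_Algebra" "HOL-Analysis.Analysis"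
begin

text \<open>
  At a point where the gradient of \<open>P\<close> does not vanish, the tangent space of the real hypersurface
  is three-dimensional and contains exactly one complex line.  A complex curve inside the
  hypersurface is therefore an integral curve of a fixed Lipschitz field of complex directions, and
  two such curves through the point agree near it, hence coincide by irreducibility.  So it suffices
  to enclose the singular zeros of \<open>P\<close> in a complex surface of bounded degree.

  After a real shear \<open>P\<close> is monic in one variable.  As \<open>P\<close> is irreducible, its discriminant with respect
  to this variable is nonzero, and after a second shear it is monic too.  These two polynomials define
  a surface \<open>Y\<close> that is finite over \<open>\<complex>\<^sup>2\<close> with fibres of bounded cardinality.  Polynomials that eliminate
  the fibre coordinates replace the commutative algebra of norms: they bound the number of components
  of \<open>Y\<close>, show that every component dominates \<open>\<complex>\<^sup>2\<close>, and give the bound on the dimension.  For the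
  degree of a component \<open>W\<close> and a linear form \<open>l\<close>, the image of \<open>W\<close> under \<open>(z\<^sub>0, z\<^sub>1, l)\<close> is a closed
  hypersurface given by a factor of a polynomial of bounded degree, so a finite section of \<open>W\<close> by two
  linear equations projects to a finite planar set cut out by polynomials of bounded degree.
\<close>

section \<open>Polynomial functions\<close>

inductive polyfun :: "nat set \<Rightarrow> nat \<Rightarrow> ((nat \<Rightarrow> 'a::comm_ring_1) \<Rightarrow> 'a) \<Rightarrow> bool" for I where
  const: "polyfun I n (\<lambda>_. c)"
| var: "i \<in> I \<Longrightarrow> polyfun I (Suc n) (\<lambda>x. x i)"
| add: "polyfun I n f \<Longrightarrow> polyfun I n g \<Longrightarrow> polyfun I n (\<lambda>x. f x + g x)"
| mult: "polyfun I n f \<Longrightarrow> polyfun I m g \<Longrightarrow> polyfun I (n + m) (\<lambda>x. f x * g x)"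

lemma polyfun_mono:
  assumes "polyfun I n f" "I \<subseteq> J" "n \<le> m"
  shows "polyfun J m f"
  using assms
proof (induction arbitrary: m rule: polyfun.induct)
  case (const n c)
  then show ?case by (simp add: polyfun.const)
next
  case (var i n)
  then obtain k where "m = Suc k" by (cases m) auto
  then show ?case using var by (auto intro: polyfun.var)
next
  case (add n f g)
  then show ?case by (simp add: polyfun.add)
next
  case (mult n f k g)
  have "polyfun J n f" "polyfun J (m - n) g" using mult by auto
  then have "polyfun J (n + (m - n)) (\<lambda>x. f x * g x)" by (rule polyfun.mult)
  then show ?case using mult by simp
qed

lemma polyfun_cong:
  assumes "polyfun I n f" "\<And>i. i \<in> I \<Longrightarrow> x i = y i"
  shows "f x = f y"
  using assms by (induction rule: polyfun.induct) auto

lemma polyfun_subst: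
  assumes "polyfun I n f" "\<And>i. i \<in> I \<Longrightarrow> polyfun J e (\<lambda>x. \<sigma> x i)"
  shows "polyfun J (n * e) (\<lambda>x. f (\<sigma> x))"
  using assms
proof (induction rule: polyfun.induct)
  case (const n c)
  then show ?case by (simp add: polyfun.const)
next
  case (var i n)
  then show ?case by (auto intro: polyfun_mono[of J e])
next
  case (add n f g)
  then show ?case by (simp add: polyfun.add)
next
  case (mult n f k g)
  then show ?case using polyfun.mult[of J "n * e" "\<lambda>x. f (\<sigma> x)" "k * e" "\<lambda>x. g (\<sigma> x)"]
    by (simp add: algebra_simps)
qed

lemma polyfun_subst_linear:
  assumes "polyfun I n f" "\<And>i. i \<in> I \<Longrightarrow> polyfun J 1 (\<lambda>x. \<sigma> x i)"
  shows "polyfun J n (\<lambda>x. f (\<sigma> x))"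
  using polyfun_subst[of I n f J 1 \<sigma>] assms by simp

lemma polyfun_var: "i \<in> I \<Longrightarrow> 1 \<le> n \<Longrightarrow> polyfun I n (\<lambda>x. x i)"
  using polyfun.var[of i I "n - 1"] by simp

lemma polyfun_cmult: "polyfun I n f \<Longrightarrow> polyfun I n (\<lambda>x. c * f x)"
  using polyfun.mult[of I 0 "\<lambda>_. c" n f] by (simp add: polyfun.const)

lemma polyfun_diff:
  assumes "polyfun I n f" "polyfun I n g"
  shows "polyfun I n (\<lambda>x. f x - g x)"
  using polyfun.add[OF assms(1) polyfun_cmult[OF assms(2), of "-1"]] by simp

lemma polyfun_mult_le:
  "polyfun I n f \<Longrightarrow> polyfun I m g \<Longrightarrow> n + m \<le> k \<Longrightarrow> polyfun I k (\<lambda>x. f x * g x)"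
  by (rule polyfun_mono[OF polyfun.mult]) auto

lemma polyfun_sum:
  "(\<And>k. k \<in> S \<Longrightarrow> polyfun I n (f k)) \<Longrightarrow> polyfun I n (\<lambda>x. \<Sum>k\<in>S. f k x)"
  by (induction S rule: infinite_finite_induct) (auto intro: polyfun.const polyfun.add)

lemma polyfun_prod:
  "(\<And>k. k \<in> S \<Longrightarrow> polyfun I n (f k)) \<Longrightarrow> polyfun I (card S * n) (\<lambda>x. \<Prod>k\<in>S. f k x)"
proof (induction S rule: infinite_finite_induct)
  case (insert a S)
  then show ?case using polyfun.mult[of I n "f a" "card S * n" "\<lambda>x. \<Prod>k\<in>S. f k x"] by auto
qed (auto intro: polyfun.const)

lemma polyfun_power: "polyfun I n f \<Longrightarrow> polyfun I (k * n) (\<lambda>x. f x ^ k)"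
  using polyfun_prod[of "{..<k}" I n "\<lambda>_. f"] by simp

lemma polyfun_coeff_mult:
  fixes p q :: "(nat \<Rightarrow> 'a::comm_ring_1) \<Rightarrow> 'a poly"
  assumes p: "\<And>k. polyfun I (n - k) (\<lambda>x. coeff (p x) k)" "\<And>x. degree (p x) \<le> n"
    and q: "\<And>k. polyfun I (m - k) (\<lambda>x. coeff (q x) k)" "\<And>x. degree (q x) \<le> m"
  shows "polyfun I (n + m - r) (\<lambda>x. coeff (p x * q x) r)"
  unfolding coeff_mult
proof (rule polyfun_sum)
  fix k assume k: "k \<in> {..r}"
  show "polyfun I (n + m - r) (\<lambda>x. coeff (p x) k * coeff (q x) (r - k))"
  proof (cases "k \<le> n \<and> r - k \<le> m")
    case True
    then show ?thesis using k by (intro polyfun_mult_le[OF p(1) q(1)]) auto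
  next
    case False
    then have "coeff (p x) k = 0 \<or> coeff (q x) (r - k) = 0" for x
      using p(2) q(2) by (meson coeff_eq_0 not_le order.strict_trans1)
    then have "coeff (p x) k * coeff (q x) (r - k) = 0" for x
      by (metis mult_zero_left mult_zero_right)
    then show ?thesis by (simp add: polyfun.const)
  qed
qed

lemma polyfun_coord_expansion:
  fixes f :: "(nat \<Rightarrow> 'a::comm_ring_1) \<Rightarrow> 'a"
  assumes "polyfun I n f"
  shows "\<exists>q. (\<forall>k. polyfun (I - {i}) (n - k) (\<lambda>x. coeff (q x) k)) \<and>
    (\<forall>x. degree (q x) \<le> n) \<and> (\<forall>x t. f (x(i := t)) = poly (q x) t)"
  using assms
proof (induction rule: polyfun.induct)
  case (const n c)
  then show ?case by (intro exI[of _ "\<lambda>_. [:c:]"]) (auto intro: polyfun.const)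
next
  case (var j n)
  show ?case
  proof (cases "j = i")
    case True
    then show ?thesis by (intro exI[of _ "\<lambda>_. [:0, 1:]"]) (auto intro: polyfun.const)
  next
    case False
    have "polyfun (I - {i}) (Suc n - k) (\<lambda>x. coeff [:x j:] k)" for k
      using False var by (cases k) (auto intro: polyfun.const polyfun.var)
    then show ?thesis using False by (intro exI[of _ "\<lambda>x. [:x j:]"]) auto
  qed
next
  case (add n f g)
  then obtain p q where
    "\<forall>k. polyfun (I - {i}) (n - k) (\<lambda>x. coeff (p x) k)" "\<forall>x. degree (p x) \<le> n"
    "\<forall>x t. f (x(i := t)) = poly (p x) t"
    "\<forall>k. polyfun (I - {i}) (n - k) (\<lambda>x. coeff (q x) k)" "\<forall>x. degree (q x) \<le> n"
    "\<forall>x t. g (x(i := t)) = poly (q x) t"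
    by blast
  then show ?case
    by (intro exI[of _ "\<lambda>x. p x + q x"]) (auto intro: polyfun.add degree_add_le simp del: fun_upd_apply)
next
  case (mult n f m g)
  then obtain p q where
    p: "\<forall>k. polyfun (I - {i}) (n - k) (\<lambda>x. coeff (p x) k)" "\<forall>x. degree (p x) \<le> n"
      "\<forall>x t. f (x(i := t)) = poly (p x) t" and
    q: "\<forall>k. polyfun (I - {i}) (m - k) (\<lambda>x. coeff (q x) k)" "\<forall>x. degree (q x) \<le> m"
      "\<forall>x t. g (x(i := t)) = poly (q x) t"
    by blast
  have "polyfun (I - {i}) (n + m - r) (\<lambda>x. coeff (p x * q x) r)" for r
    using p(1,2) q(1,2) by (intro polyfun_coeff_mult) auto
  moreover have "degree (p x * q x) \<le> n + m" for x
    using p(2) q(2) by (meson add_mono degree_mult_le order.trans)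
  ultimately show ?case
    using p(3) q(3) by (intro exI[of _ "\<lambda>x. p x * q x"]) (simp del: fun_upd_apply)
qed

lemma polyfun_radial_expansion:
  fixes f :: "(nat \<Rightarrow> 'a::comm_ring_1) \<Rightarrow> 'a"
  assumes "polyfun I n f"
  shows "\<exists>q. (\<forall>k. polyfun I k (\<lambda>x. coeff (q x) k)) \<and> (\<forall>x. degree (q x) \<le> n) \<and>
    (\<forall>x s. f (\<lambda>i. s * x i) = poly (q x) s)"
  using assms
proof (induction rule: polyfun.induct)
  case (const n c)
  have "polyfun I k (\<lambda>_. coeff [:c:] k)" for k by (rule polyfun.const)
  then show ?case by (intro exI[of _ "\<lambda>_. [:c:]"]) auto
next
  case (var j n)
  have coeff_linear: "coeff [:0, x j:] k = (if k = 1 then x j else 0)" for k and x :: "nat \<Rightarrow> 'a"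
    by (auto simp: coeff_pCons split: nat.split)
  have "polyfun I k (\<lambda>x :: nat \<Rightarrow> 'a. coeff [:0, x j:] k)" for k
    unfolding coeff_linear using var
    by (cases "k = 1") (auto intro: polyfun.const polyfun_var)
  then show ?case by (intro exI[of _ "\<lambda>x. [:0, x j:]"]) auto
next
  case (add n f g)
  then obtain p q where
    "\<forall>k. polyfun I k (\<lambda>x. coeff (p x) k)" "\<forall>x. degree (p x) \<le> n"
    "\<forall>x s. f (\<lambda>i. s * x i) = poly (p x) s"
    "\<forall>k. polyfun I k (\<lambda>x. coeff (q x) k)" "\<forall>x. degree (q x) \<le> n"
    "\<forall>x s. g (\<lambda>i. s * x i) = poly (q x) s"
    by blast
  then show ?case
    by (intro exI[of _ "\<lambda>x. p x + q x"]) (auto intro: polyfun.add degree_add_le)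
next
  case (mult n f m g)
  then obtain p q where
    p: "\<forall>k. polyfun I k (\<lambda>x. coeff (p x) k)" "\<forall>x. degree (p x) \<le> n"
      "\<forall>x s. f (\<lambda>i. s * x i) = poly (p x) s" and
    q: "\<forall>k. polyfun I k (\<lambda>x. coeff (q x) k)" "\<forall>x. degree (q x) \<le> m"
      "\<forall>x s. g (\<lambda>i. s * x i) = poly (q x) s"
    by blast
  have "polyfun I r (\<lambda>x. coeff (p x * q x) r)" for r
    unfolding coeff_mult
    using p(1) q(1) by (intro polyfun_sum polyfun_mult_le) auto
  moreover have "degree (p x * q x) \<le> n + m" for x
    using p(2) q(2) by (meson add_mono degree_mult_le order.trans)
  ultimately show ?case
    using p(3) q(3) by (intro exI[of _ "\<lambda>x. p x * q x"]) (simp del: fun_upd_apply)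
qed

lemma polyfun_degree_0_const:
  assumes "polyfun I 0 f" shows "f x = f y"
proof -
  obtain q where q: "\<forall>x. degree (q x) \<le> 0" "\<forall>x s. f (\<lambda>i. s * x i) = poly (q x) s"
    using polyfun_radial_expansion[OF assms] by blast
  have "f x = f (\<lambda>_. 0)" for x
  proof -
    obtain c where "q x = [:c:]" using q(1) by (meson degree_eq_zeroE le_zero_eq)
    then show ?thesis using q(2)[rule_format, of 1 x] q(2)[rule_format, of 0 x] by simp
  qed
  then show ?thesis by metis
qed

lemma polyfun_line:
  assumes "polyfun I n f"
  shows "\<exists>p. degree p \<le> n \<and> (\<forall>s. poly p s = f (\<lambda>i. a i + s * b i))"
proof -
  have "polyfun {0} n (\<lambda>x. f (\<lambda>i. a i + b i * x 0))"
    by (intro polyfun_subst_linear[OF assms] polyfun.add polyfun.const polyfun_cmult polyfun_var) auto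
  from polyfun_coord_expansion[OF this, of 0]
  obtain q where "\<forall>x. degree (q x) \<le> n" "\<forall>(x :: nat \<Rightarrow> 'a) t. f (\<lambda>i. a i + b i * t) = poly (q x) t"
    by auto
  then show ?thesis by (intro exI[of _ "q (\<lambda>_. 0)"]) (auto simp: mult.commute)
qed

lemma polyfun_roots:
  fixes f :: "(nat \<Rightarrow> 'a::idom) \<Rightarrow> 'a"
  assumes "polyfun I n f" "f (x(i := t\<^sub>0)) \<noteq> 0"
  shows "finite {t. f (x(i := t)) = 0}" "card {t. f (x(i := t)) = 0} \<le> n"
proof -
  obtain q where q: "degree (q x) \<le> n" "\<forall>t. f (x(i := t)) = poly (q x) t"
    using polyfun_coord_expansion[OF assms(1)] by metis
  then have "q x \<noteq> 0" using assms(2) by auto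
  then show "finite {t. f (x(i := t)) = 0}" "card {t. f (x(i := t)) = 0} \<le> n"
    using q poly_roots_finite[of "q x"] card_poly_roots_bound[of "q x"] by auto
qed

lemma polyfun_mult_nonzero:
  fixes f g :: "(nat \<Rightarrow> 'a::field_char_0) \<Rightarrow> 'a"
  assumes "polyfun I n f" "polyfun J m g" "f x \<noteq> 0" "g y \<noteq> 0"
  shows "\<exists>z. f z \<noteq> 0 \<and> g z \<noteq> 0"
proof -
  obtain p where p: "\<forall>s. poly p s = f (\<lambda>i. x i + s * (y i - x i))"
    using polyfun_line[OF assms(1)] by metis
  obtain q where q: "\<forall>s. poly q s = g (\<lambda>i. x i + s * (y i - x i))"
    using polyfun_line[OF assms(2)] by metis
  have "poly p 0 \<noteq> 0" "poly q 1 \<noteq> 0" using p q assms by auto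
  then have "p * q \<noteq> 0" by auto
  then obtain s where "poly (p * q) s \<noteq> 0" using poly_all_0_iff_0 by blast
  then show ?thesis using p q by (metis mult_eq_0_iff poly_mult)
qed

lemma polyfun_leading_form:
  fixes f :: "(nat \<Rightarrow> 'a::idom) \<Rightarrow> 'a"
  assumes "polyfun I n f" "f x \<noteq> 0"
  obtains m q where "m \<le> n" "polyfun I m f" "polyfun I m (\<lambda>v. coeff (q v) m)"
    "\<exists>v. coeff (q v) m \<noteq> 0" "\<And>v. degree (q v) \<le> m" "\<And>v s. f (\<lambda>i. s * v i) = poly (q v) s"
proof -
  define m where "m = (LEAST m. polyfun I m f)"
  have m: "polyfun I m f" unfolding m_def using assms(1) by (rule LeastI)
  have least: "m \<le> k" if "polyfun I k f" for k unfolding m_def using that by (rule Least_le)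
  obtain q where q: "\<forall>k. polyfun I k (\<lambda>v. coeff (q v) k)" "\<forall>v. degree (q v) \<le> m"
    "\<forall>v s. f (\<lambda>i. s * v i) = poly (q v) s"
    using polyfun_radial_expansion[OF m] by blast
  have f: "f v = (\<Sum>k\<le>m. coeff (q v) k)" for v
  proof -
    have "f v = poly (\<Sum>k\<le>m. monom (coeff (q v) k) k) 1"
      using q(2,3) poly_as_sum_of_monoms'[of "q v" m] by (metis (no_types, lifting) ext mult_1)
    then show ?thesis by (simp add: poly_sum poly_monom)
  qed
  have "\<exists>v. coeff (q v) m \<noteq> 0"
  proof (rule ccontr)
    assume "\<not> ?thesis"
    then have vanish: "coeff (q v) m = 0" for v by blast
    show False
    proof (cases m)
      case 0
      then show False using f vanish assms(2) by simp
    next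
      case (Suc k)
      then have "f = (\<lambda>v. \<Sum>j\<le>k. coeff (q v) j)" using f vanish by auto
      moreover have "polyfun I k (\<lambda>v. \<Sum>j\<le>k. coeff (q v) j)"
        using q(1) by (intro polyfun_sum) (auto intro: polyfun_mono)
      ultimately show False using least[of k] Suc by simp
    qed
  qed
  then show ?thesis using that m least[OF assms(1)] q by blast
qed

lemma polyfun_factor_degree:
  fixes f g :: "(nat \<Rightarrow> 'a::field_char_0) \<Rightarrow> 'a"
  assumes fg: "polyfun I n (\<lambda>x. f x * g x)" and f: "polyfun I m f" and g: "polyfun I k g" "g y \<noteq> 0"
  shows "polyfun I n f"
proof (cases "\<exists>x. f x \<noteq> 0")
  case False
  then have "f = (\<lambda>_. 0)" by auto
  then show ?thesis by (simp add: polyfun.const)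
next
  case True
  then obtain x where "f x \<noteq> 0" by blast
  then obtain df p where p: "df \<le> m" "polyfun I df f" "polyfun I df (\<lambda>v. coeff (p v) df)"
    "\<exists>v. coeff (p v) df \<noteq> 0" "\<And>v. degree (p v) \<le> df" "\<And>v s. f (\<lambda>i. s * v i) = poly (p v) s"
    by (rule polyfun_leading_form[OF f]) (rule that)
  obtain dg q where q: "dg \<le> k" "polyfun I dg g" "polyfun I dg (\<lambda>v. coeff (q v) dg)"
    "\<exists>v. coeff (q v) dg \<noteq> 0" "\<And>v. degree (q v) \<le> dg" "\<And>v s. g (\<lambda>i. s * v i) = poly (q v) s"
    by (rule polyfun_leading_form[OF g]) (rule that)
  obtain v where v: "coeff (p v) df \<noteq> 0" "coeff (q v) dg \<noteq> 0"
    using polyfun_mult_nonzero[OF p(3) q(3)] p(4) q(4) by blast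
  obtain r where r: "degree r \<le> n" "\<forall>s. poly r s = f (\<lambda>i. 0 + s * v i) * g (\<lambda>i. 0 + s * v i)"
    using polyfun_line[OF fg, of "\<lambda>_. 0" v] by auto
  have "poly (p v * q v) s = poly r s" for s using p(6) q(6) r(2) by simp
  then have "p v * q v = r" by (simp add: poly_eq_poly_eq_iff[symmetric] fun_eq_iff)
  moreover have "degree (p v * q v) = degree (p v) + degree (q v)"
    using v by (intro degree_mult_eq) auto
  ultimately have "df \<le> n" using le_degree[OF v(1)] r(1) by simp
  then show ?thesis using p(2) by (auto intro: polyfun_mono)
qed

lemma exists_nonvanishing_on_finite:
  fixes V :: "('b \<Rightarrow> 'a::field_char_0) set"
  assumes V: "\<And>f g c. f \<in> V \<Longrightarrow> g \<in> V \<Longrightarrow> (\<lambda>x. f x + c * g x) \<in> V" "V \<noteq> {}"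
    and S: "finite S" "\<And>y. y \<in> S \<Longrightarrow> \<exists>g\<in>V. g y \<noteq> 0"
  shows "\<exists>g\<in>V. \<forall>y\<in>S. g y \<noteq> 0"
  using S
proof (induction S rule: finite_induct)
  case empty
  then show ?case using V by auto
next
  case (insert y S)
  obtain g where g: "g \<in> V" "\<forall>y\<in>S. g y \<noteq> 0" using insert by auto
  obtain h where h: "h \<in> V" "h y \<noteq> 0" using insert.prems[of y] by auto
  show ?case
  proof (cases "g y = 0")
    case True
    have "infinite (UNIV :: 'a set)" by (rule infinite_UNIV_char_0)
    then obtain c where c: "c \<notin> (\<lambda>s. - h s / g s) ` S"
      using insert(1) by (metis finite_imageI ex_new_if_finite)
    have "h s + c * g s \<noteq> 0" if "s \<in> S" for s
    proof
      assume "h s + c * g s = 0"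
      then have "c = - h s / g s" using g(2) that by (simp add: field_simps eq_neg_iff_add_eq_0 add.commute)
      then show False using c that by blast
    qed
    then show ?thesis
      using V(1)[OF h(1) g(1), of c] h(2) True by (intro bexI[of _ "\<lambda>x. h x + c * g x"]) auto
  qed (use g in auto)
qed

subsection \<open>The ring of polynomial functions\<close>

definition polyfuns :: "nat set \<Rightarrow> ((nat \<Rightarrow> 'a::comm_ring_1) \<Rightarrow> 'a) set" where
  "polyfuns I = {f. \<exists>n. polyfun I n f}"

lemma polyfunsI: "polyfun I n f \<Longrightarrow> f \<in> polyfuns I"
  by (auto simp: polyfuns_def)

lemma polyfunsE:
  assumes "f \<in> polyfuns I"
  obtains n where "polyfun I n f"
  using assms by (auto simp: polyfuns_def)

lemma polyfuns_mono: "I \<subseteq> J \<Longrightarrow> polyfuns I \<subseteq> polyfuns J"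
  by (auto simp: polyfuns_def intro: polyfun_mono)

lemma polyfuns_cong: "f \<in> polyfuns I \<Longrightarrow> (\<And>i. i \<in> I \<Longrightarrow> x i = y i) \<Longrightarrow> f x = f y"
  by (elim polyfunsE) (rule polyfun_cong)

lemma polyfuns_const: "(\<lambda>_. c) \<in> polyfuns I"
  by (rule polyfunsI[OF polyfun.const])

lemma polyfuns_mult: "f \<in> polyfuns I \<Longrightarrow> g \<in> polyfuns I \<Longrightarrow> (\<lambda>x. f x * g x) \<in> polyfuns I"
  by (auto simp: polyfuns_def intro: polyfun.mult)

lemma polyfuns_add:
  assumes "f \<in> polyfuns I" "g \<in> polyfuns I"
  shows "(\<lambda>x. f x + g x) \<in> polyfuns I"
proof -
  obtain n m where "polyfun I n f" "polyfun I m g" using assms by (auto simp: polyfuns_def)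
  then have "polyfun I (max n m) f" "polyfun I (max n m) g" by (auto intro: polyfun_mono)
  then show ?thesis by (intro polyfunsI polyfun.add)
qed

lemma polyfuns_sum: "(\<And>k. k \<in> S \<Longrightarrow> f k \<in> polyfuns I) \<Longrightarrow> (\<lambda>x. \<Sum>k\<in>S. f k x) \<in> polyfuns I"
  by (induction S rule: infinite_finite_induct) (auto intro: polyfuns_const polyfuns_add)

lemma polyfuns_prod: "(\<And>k. k \<in> S \<Longrightarrow> f k \<in> polyfuns I) \<Longrightarrow> (\<lambda>x. \<Prod>k\<in>S. f k x) \<in> polyfuns I"
  by (induction S rule: infinite_finite_induct) (auto intro: polyfuns_const polyfuns_mult)

lemma polyfuns_power: "f \<in> polyfuns I \<Longrightarrow> (\<lambda>x. f x ^ k) \<in> polyfuns I"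
  by (induction k) (auto intro: polyfuns_const polyfuns_mult)

lemma polyfuns_subst:
  assumes "f \<in> polyfuns I" "\<And>i. i \<in> I \<Longrightarrow> polyfun J e (\<lambda>x. \<sigma> x i)"
  shows "(\<lambda>x. f (\<sigma> x)) \<in> polyfuns J"
  using assms by (elim polyfunsE) (blast intro: polyfunsI polyfun_subst)

lemma polyfuns_poly:
  fixes f :: "(nat \<Rightarrow> 'a::comm_ring_1) \<Rightarrow> 'a"
  assumes "\<And>k. (\<lambda>x. coeff (q x) k) \<in> polyfuns I" "\<And>x. degree (q x) \<le> K" "f \<in> polyfuns I"
  shows "(\<lambda>x. poly (q x) (f x)) \<in> polyfuns I"
proof -
  have "poly (q x) (f x) = (\<Sum>k\<le>K. coeff (q x) k * f x ^ k)" for x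
    by (subst poly_as_sum_of_monoms'[OF assms(2), symmetric]) (simp add: poly_sum poly_monom)
  then show ?thesis by (simp add: polyfuns_sum polyfuns_mult polyfuns_power assms)
qed

lemma polyfuns_family_nonzero:
  fixes F :: "((nat \<Rightarrow> 'a::field_char_0) \<Rightarrow> 'a) set"
  assumes "finite F" "F \<subseteq> polyfuns I" "\<And>f. f \<in> F \<Longrightarrow> \<exists>x. f x \<noteq> 0"
  shows "\<exists>z. \<forall>f\<in>F. f z \<noteq> 0"
proof -
  have "\<exists>z. (\<Prod>f\<in>F. f z) \<noteq> 0"
    using assms
  proof (induction F rule: finite_induct)
    case (insert f F)
    then obtain x z where "f x \<noteq> 0" "(\<Prod>g\<in>F. g z) \<noteq> 0" by fastforce
    moreover obtain n where "polyfun I n f" using insert.prems by (auto elim: polyfunsE)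
    moreover obtain m where "polyfun I m (\<lambda>x. \<Prod>g\<in>F. g x)"
      using insert.prems polyfuns_prod[of F "\<lambda>g. g" I] by (auto elim: polyfunsE)
    ultimately obtain y where "f y \<noteq> 0 \<and> (\<Prod>g\<in>F. g y) \<noteq> 0"
      using polyfun_mult_nonzero[of I n f I m "\<lambda>x. \<Prod>g\<in>F. g x" x z] by blast
    then show ?case using insert.hyps by auto
  qed simp
  then show ?thesis using \<open>finite F\<close> by (metis prod_zero)
qed

subsection \<open>Shears and monic polynomial functions\<close>

definition shear :: "nat \<Rightarrow> (nat \<Rightarrow> 'a::comm_ring_1) \<Rightarrow> (nat \<Rightarrow> 'a) \<Rightarrow> nat \<Rightarrow> 'a" where
  "shear i a x = (\<lambda>j. x j + a j * x i)"

lemma shear_inverse: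
  assumes "a i = 0"
  shows "shear i (\<lambda>j. - a j) (shear i a x) = x" "shear i a (shear i (\<lambda>j. - a j) x) = x"
  using assms by (auto simp: shear_def)

lemma shear_in_aff: "x \<in> aff n \<Longrightarrow> (\<And>j. j \<ge> n \<Longrightarrow> a j = 0) \<Longrightarrow> shear i a x \<in> aff n"
  by (auto simp: aff_def shear_def)

lemma polyfun_shear:
  assumes "polyfun I n f" "i \<in> I"
  shows "polyfun I n (\<lambda>x. f (shear i a x))"
  unfolding shear_def
  by (intro polyfun_subst_linear[OF assms(1)] polyfun.add polyfun_cmult polyfun_var) (use assms(2) in auto)

lemma polyfuns_shear: "f \<in> polyfuns I \<Longrightarrow> i \<in> I \<Longrightarrow> (\<lambda>x. f (shear i a x)) \<in> polyfuns I"
  by (elim polyfunsE) (rule polyfunsI[OF polyfun_shear])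

definition monic_in :: "nat set \<Rightarrow> nat \<Rightarrow> nat \<Rightarrow> ((nat \<Rightarrow> 'a::comm_ring_1) \<Rightarrow> 'a) \<Rightarrow> bool" where
  "monic_in I i e f \<longleftrightarrow> (\<exists>q d. d \<le> e \<and> (\<forall>k. polyfun (I - {i}) e (\<lambda>x. coeff (q x) k)) \<and>
     (\<forall>x. degree (q x) = d \<and> lead_coeff (q x) = 1) \<and> (\<forall>x t. f (x(i := t)) = poly (q x) t))"

lemma monic_inE:
  assumes "monic_in I i e f"
  obtains q d where "d \<le> e" "\<And>k. polyfun (I - {i}) e (\<lambda>x. coeff (q x) k)"
    "\<And>x. degree (q x) = d" "\<And>x. lead_coeff (q x) = 1" "\<And>x t. f (x(i := t)) = poly (q x) t"
  using assms unfolding monic_in_def by blast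

lemma monic_in_mono:
  assumes "monic_in I i e f" "I \<subseteq> J" "e \<le> e'"
  shows "monic_in J i e' f"
proof -
  obtain q d where q: "d \<le> e" "\<And>k. polyfun (I - {i}) e (\<lambda>x. coeff (q x) k)"
    "\<And>x. degree (q x) = d" "\<And>x. lead_coeff (q x) = 1" "\<And>x t. f (x(i := t)) = poly (q x) t"
    by (rule monic_inE[OF assms(1)]) (rule that)
  have "polyfun (J - {i}) e' (\<lambda>x. coeff (q x) k)" for k
    using assms by (intro polyfun_mono[OF q(2)]) auto
  moreover have "d \<le> e'" using q(1) assms by simp
  ultimately show ?thesis using q unfolding monic_in_def by blast
qed

lemma monic_in_polyfuns:
  assumes "monic_in I i e f" "i \<in> I"
  shows "f \<in> polyfuns I"
proof -
  obtain q d where q: "d \<le> e" "\<And>k. polyfun (I - {i}) e (\<lambda>x. coeff (q x) k)"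
    "\<And>x. degree (q x) = d" "\<And>x. lead_coeff (q x) = 1" "\<And>x t. f (x(i := t)) = poly (q x) t"
    by (rule monic_inE[OF assms(1)]) (rule that)
  have "f = (\<lambda>x. poly (q x) (x i))" using q(5) by (metis fun_upd_triv)
  moreover have "(\<lambda>x. poly (q x) (x i)) \<in> polyfuns I"
  proof (rule polyfuns_poly)
    show "(\<lambda>x. coeff (q x) k) \<in> polyfuns I" for k
      using q(2) by (intro polyfunsI[of I e]) (auto intro: polyfun_mono)
    show "(\<lambda>x. x i) \<in> polyfuns I" by (rule polyfunsI[OF polyfun.var]) (rule assms(2))
    show "degree (q x) \<le> d" for x by (simp add: q(3))
  qed
  ultimately show ?thesis by simp
qed

lemma monic_in_roots:
  fixes f :: "(nat \<Rightarrow> 'a::idom) \<Rightarrow> 'a"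
  assumes "monic_in I i e f"
  shows "finite {t. f (x(i := t)) = 0}" "card {t. f (x(i := t)) = 0} \<le> e"
proof -
  obtain q d where q: "d \<le> e" "\<And>k. polyfun (I - {i}) e (\<lambda>x. coeff (q x) k)"
    "\<And>x. degree (q x) = d" "\<And>x. lead_coeff (q x) = 1" "\<And>x t. f (x(i := t)) = poly (q x) t"
    by (rule monic_inE[OF assms]) (rule that)
  have "q x \<noteq> 0" using q(4)[of x] by auto
  then show "finite {t. f (x(i := t)) = 0}" "card {t. f (x(i := t)) = 0} \<le> e"
    using q(1,3) poly_roots_finite[of "q x"] card_poly_roots_bound[of "q x"]
    unfolding q(5) by (auto intro: order.trans)
qed

lemma monic_in_subst:
  assumes "monic_in I i e f" "\<And>j. j \<in> I - {i} \<Longrightarrow> polyfun (I - {i}) 1 (\<lambda>x. \<sigma> x j)"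
    and \<sigma>: "\<And>x t. \<sigma> (x(i := t)) = (\<sigma> x)(i := t)"
  shows "monic_in I i e (\<lambda>x. f (\<sigma> x))"
proof -
  obtain q d where q: "d \<le> e" "\<And>k. polyfun (I - {i}) e (\<lambda>x. coeff (q x) k)"
    "\<And>x. degree (q x) = d" "\<And>x. lead_coeff (q x) = 1" "\<And>x t. f (x(i := t)) = poly (q x) t"
    by (rule monic_inE[OF assms(1)]) (rule that)
  have "polyfun (I - {i}) e (\<lambda>x. coeff (q (\<sigma> x)) k)" for k
    by (rule polyfun_subst_linear[OF q(2) assms(2)])
  moreover have "f (\<sigma> (x(i := t))) = poly (q (\<sigma> x)) t" for x t
    using q(5)[of "\<sigma> x" t] by (simp add: \<sigma>)
  ultimately show ?thesis
    unfolding monic_in_def using q by (intro exI[of _ "\<lambda>x. q (\<sigma> x)"] exI[of _ d]) auto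
qed

lemma monic_in_normalize:
  fixes f :: "(nat \<Rightarrow> 'a::field) \<Rightarrow> 'a"
  assumes r: "\<And>k. polyfun (I - {i}) n (\<lambda>x. coeff (r x) k)" "\<And>x. degree (r x) \<le> m"
    "\<And>x t. f (x(i := t)) = poly (r x) t"
    and lead: "\<And>x. coeff (r x) m = c" and c: "c \<noteq> 0" and m: "m \<le> n"
  shows "monic_in I i n (\<lambda>x. inverse c * f x)"
  unfolding monic_in_def
proof (intro exI[of _ "\<lambda>x. smult (inverse c) (r x)"] exI[of _ m] conjI allI m)
  fix x t k
  have "degree (r x) = m" using r(2) lead[of x] c by (simp add: le_degree le_antisym)
  then show "degree (smult (inverse c) (r x)) = m" "lead_coeff (smult (inverse c) (r x)) = 1"
    using c lead by auto
  show "polyfun (I - {i}) n (\<lambda>x. coeff (smult (inverse c) (r x)) k)"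
    unfolding coeff_smult by (intro polyfun_cmult r(1))
  show "inverse c * f (x(i := t)) = poly (smult (inverse c) (r x)) t" using r(3) by simp
qed

lemma radial_coeff_homogeneous:
  fixes f :: "(nat \<Rightarrow> 'a::field_char_0) \<Rightarrow> 'a"
  assumes "\<And>v s. f (\<lambda>i. s * v i) = poly (q v) s"
  shows "coeff (q (\<lambda>i. s * v i)) m = s ^ m * coeff (q v) m"
proof -
  have "poly (q (\<lambda>i. s * v i)) t = poly (pcompose (q v) [:0, s:]) t" for t
    using assms[of t "\<lambda>i. s * v i"] assms[of "t * s" v] by (simp add: poly_pcompose mult.assoc)
  then have "q (\<lambda>i. s * v i) = pcompose (q v) [:0, s:]"
    by (simp add: poly_eq_poly_eq_iff[symmetric] fun_eq_iff)
  then show ?thesis by (simp add: coeff_pcompose_linear)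
qed

text \<open>Along the direction \<open>w\<close> of the sheared axis, the leading coefficient in \<open>x\<^sub>i\<close> is the value at \<open>w\<close> of
  the leading form of \<open>f\<close>.\<close>

lemma polyfun_shear_monic:
  fixes f :: "(nat \<Rightarrow> 'a::field_char_0) \<Rightarrow> 'a"
  assumes "polyfun I n f" "f x\<^sub>0 \<noteq> 0" "i \<in> I"
  obtains a c g where "a i = 0" "\<And>j. j \<notin> I \<Longrightarrow> a j = 0" "c \<noteq> 0" "monic_in I i n g"
    "\<And>x. f (shear i a x) = c * g x"
proof -
  obtain m q where m: "m \<le> n" "polyfun I m f" and
    q: "polyfun I m (\<lambda>v. coeff (q v) m)" "\<exists>v. coeff (q v) m \<noteq> 0"
    "\<And>v. degree (q v) \<le> m" "\<And>v s. f (\<lambda>i. s * v i) = poly (q v) s"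
    by (rule polyfun_leading_form[OF assms(1,2)]) (rule that)
  have "polyfun I 1 (\<lambda>x::nat \<Rightarrow> 'a. x i)" using assms by (auto intro: polyfun_var)
  then obtain v where v: "coeff (q v) m \<noteq> 0" "v i \<noteq> 0"
    using polyfun_mult_nonzero[OF q(1), of I 1 "\<lambda>x. x i" _ "\<lambda>_. 1"] q(2) by auto
  define a where "a j = (if j \<in> I - {i} then inverse (v i) * v j else 0)" for j
  define w where "w = a(i := 1)"
  define c where "c = coeff (q w) m"
  have "c = coeff (q (\<lambda>j. inverse (v i) * v j)) m"
    unfolding c_def by (rule polyfun_cong[OF q(1)]) (use v in \<open>auto simp: w_def a_def\<close>)
  then have c: "c \<noteq> 0" using v by (simp add: radial_coeff_homogeneous[where f = f and q = q, OF q(4)])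
  have "polyfun I m (\<lambda>x. f (shear i a x))" using m(2) assms(3) by (rule polyfun_shear)
  then obtain r where r: "\<forall>k. polyfun (I - {i}) (m - k) (\<lambda>x. coeff (r x) k)" "\<forall>x. degree (r x) \<le> m"
    "\<forall>x t. f (shear i a (x(i := t))) = poly (r x) t"
    using polyfun_coord_expansion by blast
  have "poly (q w) s = poly (r (\<lambda>_. 0)) s" for s
  proof -
    have "shear i a ((\<lambda>_. 0)(i := s)) = (\<lambda>j. s * w j)" by (auto simp: shear_def w_def a_def)
    then show ?thesis using q(4)[of s w] r(3)[rule_format, of "\<lambda>_. 0" s] by simp
  qed
  then have "q w = r (\<lambda>_. 0)" by (simp add: poly_eq_poly_eq_iff[symmetric] fun_eq_iff)
  then have lead: "coeff (r x) m = c" for x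
    using polyfun_degree_0_const[of "I - {i}" "\<lambda>x. coeff (r x) m" x "\<lambda>_. 0"] r(1)[rule_format, of m]
    by (simp add: c_def)
  have "monic_in I i n (\<lambda>x. inverse c * f (shear i a x))"
    using r(2,3) lead c m(1) polyfun_mono[OF r(1)[rule_format] subset_refl]
    by (intro monic_in_normalize[where r = r and m = m]) auto
  then show ?thesis using c by (intro that[of a c]) (auto simp: a_def)
qed

section \<open>Multivariate polynomials and their polynomial functions\<close>

definition mono_eval :: "(nat \<Rightarrow>\<^sub>0 nat) \<Rightarrow> (nat \<Rightarrow> 'a::comm_semiring_1) \<Rightarrow> 'a" where
  "mono_eval m x = (\<Prod>j\<in>Poly_Mapping.keys m. x j ^ Poly_Mapping.lookup m j)"

lemma mono_eval_superset:
  assumes "finite S" "Poly_Mapping.keys m \<subseteq> S"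
  shows "mono_eval m x = (\<Prod>j\<in>S. x j ^ Poly_Mapping.lookup m j)"
  unfolding mono_eval_def
  by (rule prod.mono_neutral_left) (use assms in \<open>auto simp: in_keys_iff\<close>)

lemma mono_eval_add: "mono_eval (m + n) x = mono_eval m x * mono_eval n x"
proof -
  let ?S = "Poly_Mapping.keys m \<union> Poly_Mapping.keys n"
  have "mono_eval (m + n) x = (\<Prod>j\<in>?S. x j ^ Poly_Mapping.lookup (m + n) j)"
    by (rule mono_eval_superset) (auto simp: Poly_Mapping.keys_add)
  also have "\<dots> = mono_eval m x * mono_eval n x"
    by (simp add: lookup_add power_add prod.distrib mono_eval_superset[of ?S])
  finally show ?thesis .
qed

lemma mono_eval_mult: "mono_eval m (\<lambda>i. x i * y i) = mono_eval m x * mono_eval m y"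
  by (simp add: mono_eval_def power_mult_distrib prod.distrib)

lemma mono_eval_one_upd: "mono_eval m ((\<lambda>_. 1)(i := t)) = t ^ Poly_Mapping.lookup m i"
proof -
  have "mono_eval m ((\<lambda>_. 1)(i := t)) =
      (\<Prod>j\<in>insert i (Poly_Mapping.keys m). ((\<lambda>_. 1)(i := t)) j ^ Poly_Mapping.lookup m j)"
    by (rule mono_eval_superset) auto
  also have "\<dots> = t ^ Poly_Mapping.lookup m i"
    by (subst prod.insert_remove) (auto intro!: prod.neutral)
  finally show ?thesis .
qed

text \<open>Dedekind's argument: distinct monomials are distinct characters of a multiplicative monoid.\<close>

lemma mono_eval_independent:
  fixes c :: "(nat \<Rightarrow>\<^sub>0 nat) \<Rightarrow> 'a::field_char_0"
  assumes "finite S" "\<And>x. (\<Sum>m\<in>S. c m * mono_eval m x) = 0" "m \<in> S"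
  shows "c m = 0"
  using assms
proof (induction S arbitrary: c m rule: finite_induct)
  case (insert m\<^sub>0 S)
  have S: "c m = 0" if m: "m \<in> S" for m
  proof -
    have "m \<noteq> m\<^sub>0" using m insert.hyps by blast
    then obtain i where i: "Poly_Mapping.lookup m i \<noteq> Poly_Mapping.lookup m\<^sub>0 i"
      by (auto simp: poly_mapping_eq_iff fun_eq_iff)
    define y where "y = (\<lambda>_. 1)(i := (2 :: 'a))"
    have "c m * (mono_eval m y - mono_eval m\<^sub>0 y) = 0"
    proof (rule insert.IH[OF _ m])
      fix x
      have "(\<Sum>k\<in>S. c k * (mono_eval k y - mono_eval m\<^sub>0 y) * mono_eval k x) =
        (\<Sum>k\<in>insert m\<^sub>0 S. c k * (mono_eval k y - mono_eval m\<^sub>0 y) * mono_eval k x)"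
        using insert.hyps by simp
      also have "\<dots> = (\<Sum>k\<in>insert m\<^sub>0 S. c k * mono_eval k (\<lambda>i. y i * x i)) -
        mono_eval m\<^sub>0 y * (\<Sum>k\<in>insert m\<^sub>0 S. c k * mono_eval k x)"
        unfolding sum_distrib_left sum_subtractf[symmetric]
        by (intro sum.cong) (auto simp: mono_eval_mult algebra_simps)
      also have "\<dots> = 0" by (simp only: insert.prems(1) mult_zero_right diff_self)
      finally show "(\<Sum>k\<in>S. c k * (mono_eval k y - mono_eval m\<^sub>0 y) * mono_eval k x) = 0" .
    qed
    moreover have "mono_eval m y \<noteq> mono_eval m\<^sub>0 y"
      using i of_nat_eq_iff[where ?'a='a, of "2 ^ Poly_Mapping.lookup m i" "2 ^ Poly_Mapping.lookup m\<^sub>0 i"]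
      by (simp add: y_def mono_eval_one_upd)
    ultimately show ?thesis by simp
  qed
  moreover have "c m\<^sub>0 = 0"
    using insert.prems(1)[of "\<lambda>_. 1"] insert.hyps S by (simp add: mono_eval_def)
  ultimately show ?case using insert.prems(2) by blast
qed simp

lemma peval_superset:
  assumes "finite S" "Poly_Mapping.keys p \<subseteq> S"
  shows "peval p x = (\<Sum>m\<in>S. Poly_Mapping.lookup p m * mono_eval m x)"
  unfolding peval_def mono_eval_def[symmetric]
  by (rule sum.mono_neutral_left) (use assms in \<open>auto simp: in_keys_iff\<close>)

lemma peval_add: "peval (p + q) x = peval p x + peval q x"
proof -
  let ?S = "Poly_Mapping.keys p \<union> Poly_Mapping.keys q"
  have "peval (p + q) x = (\<Sum>m\<in>?S. Poly_Mapping.lookup (p + q) m * mono_eval m x)"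
    by (rule peval_superset) (auto simp: Poly_Mapping.keys_add)
  also have "\<dots> = peval p x + peval q x"
    by (simp add: lookup_add distrib_right sum.distrib peval_superset[of ?S])
  finally show ?thesis .
qed

lemma peval_single: "peval (Poly_Mapping.single m c) x = c * mono_eval m x"
  by (subst peval_superset[of "{m}"]) (auto simp: lookup_single)

lemma peval_const: "peval (Poly_Mapping.single 0 c) x = c"
  by (simp add: peval_single mono_eval_def)

lemma peval_sum: "peval (\<Sum>k\<in>S. f k) x = (\<Sum>k\<in>S. peval (f k) x)"
  by (induction S rule: infinite_finite_induct) (auto simp: peval_add peval_def[of 0])

lemma mpoly_sum_monomials: "(\<Sum>m\<in>Poly_Mapping.keys p. Poly_Mapping.single m (Poly_Mapping.lookup p m)) = p"
  by (rule poly_mapping_eqI) (auto simp: lookup_sum lookup_single when_def in_keys_iff)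

lemma peval_mult:
  fixes p q :: "'a::comm_ring_1 mpoly"
  shows "peval (p * q) x = peval p x * peval q x"
proof -
  have "p * q = (\<Sum>m\<in>Poly_Mapping.keys p. Poly_Mapping.single m (Poly_Mapping.lookup p m)) *
      (\<Sum>n\<in>Poly_Mapping.keys q. Poly_Mapping.single n (Poly_Mapping.lookup q n))"
    by (simp only: mpoly_sum_monomials)
  also have "\<dots> = (\<Sum>m\<in>Poly_Mapping.keys p. \<Sum>n\<in>Poly_Mapping.keys q.
      Poly_Mapping.single (m + n) (Poly_Mapping.lookup p m * Poly_Mapping.lookup q n))"
    by (simp add: sum_product mult_single)
  finally have "peval (p * q) x = (\<Sum>m\<in>Poly_Mapping.keys p. \<Sum>n\<in>Poly_Mapping.keys q.
      (Poly_Mapping.lookup p m * mono_eval m x) * (Poly_Mapping.lookup q n * mono_eval n x))"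
    by (simp add: peval_sum peval_single mono_eval_add mult_ac)
  then show ?thesis by (simp add: peval_def mono_eval_def[symmetric] sum_product)
qed

lemma peval_inject:
  fixes p q :: "'a::field_char_0 mpoly"
  assumes "peval p = peval q"
  shows "p = q"
proof (rule poly_mapping_eqI)
  fix m
  let ?S = "insert m (Poly_Mapping.keys p \<union> Poly_Mapping.keys q)"
  have "Poly_Mapping.lookup p m - Poly_Mapping.lookup q m = 0"
  proof (rule mono_eval_independent[of ?S])
    fix x
    have "peval p x = (\<Sum>k\<in>?S. Poly_Mapping.lookup p k * mono_eval k x)"
      "peval q x = (\<Sum>k\<in>?S. Poly_Mapping.lookup q k * mono_eval k x)"
      by (rule peval_superset; auto)+
    then show "(\<Sum>k\<in>?S. (Poly_Mapping.lookup p k - Poly_Mapping.lookup q k) * mono_eval k x) = 0"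
      using assms unfolding left_diff_distrib sum_subtractf by simp
  qed auto
  then show "Poly_Mapping.lookup p m = Poly_Mapping.lookup q m" by simp
qed

lemma polyfun_mono_eval:
  assumes "Poly_Mapping.keys m \<subseteq> I"
  shows "polyfun I (sum (Poly_Mapping.lookup m) (Poly_Mapping.keys m)) (mono_eval m)"
proof -
  have "polyfun I (sum (Poly_Mapping.lookup m) S) (\<lambda>x. \<Prod>j\<in>S. x j ^ Poly_Mapping.lookup m j)"
    if "S \<subseteq> Poly_Mapping.keys m" for S
    using finite_subset[OF that finite_keys] that
  proof (induction S rule: finite_induct)
    case (insert j S)
    then have "polyfun I (Poly_Mapping.lookup m j * 1) (\<lambda>x. x j ^ Poly_Mapping.lookup m j)"
      using assms by (intro polyfun_power polyfun_var) auto
    then show ?case using insert polyfun.mult[of I "Poly_Mapping.lookup m j"] by simp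
  qed (auto intro: polyfun.const)
  then show ?thesis unfolding mono_eval_def[abs_def] by blast
qed

lemma polyfun_peval:
  assumes "tdeg p \<le> n" "vars p \<subseteq> I"
  shows "polyfun I n (peval p)"
proof -
  have "polyfun I n (\<lambda>x. Poly_Mapping.lookup p m * mono_eval m x)" if m: "m \<in> Poly_Mapping.keys p" for m
  proof (rule polyfun_cmult)
    have "sum (Poly_Mapping.lookup m) (Poly_Mapping.keys m) \<le> n"
      using assms(1) m by (auto simp: tdeg_def)
    moreover have "Poly_Mapping.keys m \<subseteq> I" using assms(2) m by (auto simp: vars_def)
    ultimately show "polyfun I n (mono_eval m)"
      by (intro polyfun_mono[OF polyfun_mono_eval[of m I]]) auto
  qed
  then show ?thesis unfolding peval_def mono_eval_def[symmetric] by (intro polyfun_sum) auto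
qed

lemma vars_add: "vars (p + q) \<subseteq> vars p \<union> vars q"
  using Poly_Mapping.keys_add[of p q] unfolding vars_def by blast

lemma vars_mult: "vars (p * q) \<subseteq> vars p \<union> vars (q :: 'a::comm_ring_1 mpoly)"
proof
  fix i assume "i \<in> vars (p * q)"
  then obtain m where m: "m \<in> Poly_Mapping.keys (p * q)" "i \<in> Poly_Mapping.keys m"
    by (auto simp: vars_def)
  obtain a b where ab: "m = a + b" "a \<in> Poly_Mapping.keys p" "b \<in> Poly_Mapping.keys q"
    using keys_mult[of p q] m(1) by blast
  have "i \<in> Poly_Mapping.keys a \<or> i \<in> Poly_Mapping.keys b"
    using m(2) Poly_Mapping.keys_add[of a b] ab(1) by blast
  then show "i \<in> vars p \<union> vars q" using ab by (auto simp: vars_def)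
qed

lemma polyfun_imp_peval:
  fixes f :: "(nat \<Rightarrow> 'a::comm_ring_1) \<Rightarrow> 'a"
  assumes "polyfun I n f"
  shows "\<exists>p. vars p \<subseteq> I \<and> peval p = f"
  using assms
proof (induction rule: polyfun.induct)
  case (const n c)
  have "vars (Poly_Mapping.single 0 c) \<subseteq> I" "peval (Poly_Mapping.single 0 c) = (\<lambda>_. c)"
    by (auto simp: vars_def peval_const)
  then show ?case by blast
next
  case (var i n)
  let ?X = "Poly_Mapping.single (Poly_Mapping.single i 1) 1 :: 'a mpoly"
  have "vars ?X \<subseteq> I" "peval ?X = (\<lambda>x. x i)"
    using var by (auto simp: vars_def peval_single mono_eval_def split: if_splits)
  then show ?case by blast
next
  case (add n f g)
  then obtain p q where pq: "vars p \<subseteq> I" "peval p = f" "vars q \<subseteq> I" "peval q = g" by blast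
  then have "vars (p + q) \<subseteq> I" "peval (p + q) = (\<lambda>x. f x + g x)"
    using vars_add[of p q] by (auto simp: peval_add)
  then show ?case by blast
next
  case (mult n f m g)
  then obtain p q where pq: "vars p \<subseteq> I" "peval p = f" "vars q \<subseteq> I" "peval q = g" by blast
  then have "vars (p * q) \<subseteq> I" "peval (p * q) = (\<lambda>x. f x * g x)"
    using vars_mult[of p q] by (auto simp: peval_mult)
  then show ?case by blast
qed

lemma polyfuns_eq_peval: "polyfuns I = peval ` {p :: 'a::comm_ring_1 mpoly. vars p \<subseteq> I}"
proof (intro equalityI subsetI)
  fix f :: "(nat \<Rightarrow> 'a) \<Rightarrow> 'a"
  assume "f \<in> polyfuns I"
  then show "f \<in> peval ` {p. vars p \<subseteq> I}" by (elim polyfunsE) (use polyfun_imp_peval in blast)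
qed (auto intro: polyfunsI polyfun_peval)

subsection \<open>Irreducible polynomial functions\<close>

definition irreducible_polyfun :: "nat set \<Rightarrow> ((nat \<Rightarrow> 'a::comm_ring_1) \<Rightarrow> 'a) \<Rightarrow> bool" where
  "irreducible_polyfun I f \<longleftrightarrow> f \<in> polyfuns I \<and> \<not> f constant_on UNIV \<and>
     (\<forall>g\<in>polyfuns I. \<forall>h\<in>polyfuns I. f = (\<lambda>x. g x * h x) \<longrightarrow> g constant_on UNIV \<or> h constant_on UNIV)"

lemma irreducible_polyfunD:
  assumes "irreducible_polyfun I f" "f = (\<lambda>x. g x * h x)" "g \<in> polyfuns I" "h \<in> polyfuns I"
  shows "g constant_on UNIV \<or> h constant_on UNIV"
proof -
  have "\<forall>g\<in>polyfuns I. \<forall>h\<in>polyfuns I. f = (\<lambda>x. g x * h x) \<longrightarrow> g constant_on UNIV \<or> h constant_on UNIV"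
    using assms(1) by (simp add: irreducible_polyfun_def)
  from this[rule_format, OF assms(3,4,2)] show ?thesis .
qed

lemma constant_on_UNIV_iff: "f constant_on UNIV \<longleftrightarrow> (\<exists>c. f = (\<lambda>_. c))"
  by (auto simp: constant_on_def)

lemma polyfuns_unit_constant:
  fixes f g :: "(nat \<Rightarrow> 'a::field_char_0) \<Rightarrow> 'a"
  assumes "f \<in> polyfuns I" "g \<in> polyfuns I" "\<And>x. f x * g x = 1"
  shows "f constant_on UNIV"
proof -
  obtain n m where "polyfun I n f" "polyfun I m g" using assms by (meson polyfunsE)
  moreover have "polyfun I 0 (\<lambda>x. f x * g x)" unfolding assms(3) by (rule polyfun.const)
  moreover have "g (\<lambda>_. 0) \<noteq> 0" using assms(3)[of "\<lambda>_. 0"] by auto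
  ultimately have "polyfun I 0 f" using polyfun_factor_degree by blast
  then show ?thesis using polyfun_degree_0_const unfolding constant_on_def by blast
qed

lemma irreducible_polyfun_peval:
  fixes P :: "'a::field_char_0 mpoly"
  assumes "irreducible P" "vars P \<subseteq> I"
  shows "irreducible_polyfun I (peval P)"
  unfolding irreducible_polyfun_def
proof (intro conjI ballI impI)
  show "peval P \<in> polyfuns I" using assms(2) by (auto simp: polyfuns_eq_peval)
  show "\<not> peval P constant_on UNIV"
  proof
    assume "peval P constant_on UNIV"
    then obtain c where "peval P = (\<lambda>_. c)" by (auto simp: constant_on_UNIV_iff)
    then have P: "P = Poly_Mapping.single 0 c" by (intro peval_inject) (auto simp: peval_const)
    then have "c \<noteq> 0" using assms(1) by auto
    then have "P * Poly_Mapping.single 0 (inverse c) = 1" by (simp add: P mult_single)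
    then show False using assms(1) by (metis dvdI irreducible_not_unit)
  qed
  fix g h assume "g \<in> polyfuns I" "h \<in> polyfuns I" and gh: "peval P = (\<lambda>x. g x * h x)"
  then obtain G H where GH: "peval G = g" "peval H = h" by (auto simp: polyfuns_eq_peval)
  have unit: "peval A constant_on UNIV" if A: "A dvd 1" for A :: "'a mpoly"
  proof -
    obtain U where "1 = A * U" using A by (rule dvdE)
    then have "peval A x * peval U x = 1" for x
      using peval_mult[of A U x] peval_const[of 1 x] by simp
    moreover have "peval A \<in> polyfuns UNIV" "peval U \<in> polyfuns UNIV"
      by (auto simp: polyfuns_eq_peval)
    ultimately show ?thesis by (intro polyfuns_unit_constant)
  qed
  have "P = G * H" by (rule peval_inject) (auto simp: gh GH peval_mult)
  then have "G dvd 1 \<or> H dvd 1" using assms(1) by (rule irreducibleD[rotated])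
  then show "g constant_on UNIV \<or> h constant_on UNIV" using unit GH by blast
qed

lemma irreducible_polyfun_shear:
  fixes f g :: "(nat \<Rightarrow> 'a::field) \<Rightarrow> 'a"
  assumes f: "irreducible_polyfun I f" and i: "i \<in> I" "a i = 0" and c: "c \<noteq> 0"
    and eq: "\<And>x. f (shear i a x) = c * g x"
  shows "irreducible_polyfun I g"
proof -
  define \<tau> where "\<tau> = shear i (\<lambda>j. - a j)"
  have \<tau>: "shear i a (\<tau> x) = x" "\<tau> (shear i a x) = x" for x
    unfolding \<tau>_def using shear_inverse[of a i] i(2) by auto
  have fg: "f x = c * g (\<tau> x)" for x using eq[of "\<tau> x"] by (simp add: \<tau>)
  have g: "g = (\<lambda>x. inverse c * f (shear i a x))" using eq c by auto
  show ?thesis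
    unfolding irreducible_polyfun_def
  proof (intro conjI ballI impI)
    show "g \<in> polyfuns I"
      unfolding g using f
      by (intro polyfuns_mult polyfuns_const polyfuns_shear i(1)) (simp add: irreducible_polyfun_def)
    show "\<not> g constant_on UNIV"
    proof
      assume "g constant_on UNIV"
      then have "f constant_on UNIV" by (auto simp: constant_on_def fg)
      then show False using f by (simp add: irreducible_polyfun_def)
    qed
    fix u v assume uv: "u \<in> polyfuns I" "v \<in> polyfuns I" "g = (\<lambda>x. u x * v x)"
    have "f = (\<lambda>x. (c * u (\<tau> x)) * v (\<tau> x))" by (auto simp: fg uv(3))
    moreover have "(\<lambda>x. c * u (\<tau> x)) \<in> polyfuns I" "(\<lambda>x. v (\<tau> x)) \<in> polyfuns I"
      unfolding \<tau>_def using uv by (auto intro!: polyfuns_mult polyfuns_const polyfuns_shear i(1))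
    ultimately have "(\<lambda>x. c * u (\<tau> x)) constant_on UNIV \<or> (\<lambda>x. v (\<tau> x)) constant_on UNIV"
      using irreducible_polyfunD[OF f] by simp
    then show "u constant_on UNIV \<or> v constant_on UNIV"
      using c unfolding constant_on_def by (metis UNIV_I \<tau>(2) mult_left_cancel)
  qed
qed

section \<open>Elimination of a variable by resultants\<close>

lemma polyfun_resultant:
  fixes p q :: "(nat \<Rightarrow> 'a::idom) \<Rightarrow> 'a poly"
  assumes "\<And>k. polyfun J e (\<lambda>x. coeff (p x) k)" "\<And>k. polyfun J e (\<lambda>x. coeff (q x) k)"
    and "\<And>x. degree (p x) = m" "\<And>x. degree (q x) = n"
  shows "polyfun J ((m + n) * e) (\<lambda>x. resultant (p x) (q x))"
proof -
  have dim: "dim_row (sylvester_mat (p x) (q x)) = m + n" "dim_col (sylvester_mat (p x) (q x)) = m + n" for x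
    using assms(3,4) by simp_all
  have entry: "polyfun J e (\<lambda>x. sylvester_mat (p x) (q x) $$ (i, j))" if "i < m + n" "j < m + n" for i j
  proof -
    have eq: "sylvester_mat (p x) (q x) $$ (i, j) =
      (if i < n then if i \<le> j \<and> j - i \<le> m then coeff (p x) (m + i - j) else 0
       else if i - n \<le> j \<and> j \<le> i then coeff (q x) (i - j) else 0)" for x
      using sylvester_index_mat[of i "p x" "q x" j] that assms(3,4) by simp
    show ?thesis unfolding eq
      by (cases "i < n"; cases "i \<le> j \<and> j - i \<le> m"; cases "i - n \<le> j \<and> j \<le> i")
        (use assms(1,2) in \<open>auto intro: polyfun.const\<close>)
  qed
  have "polyfun J ((m + n) * e) (\<lambda>x. signof \<pi> * (\<Prod>i = 0..<m + n. sylvester_mat (p x) (q x) $$ (i, \<pi> i)))"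
    if "\<pi> permutes {0..<m + n}" for \<pi>
  proof (rule polyfun_cmult)
    have "polyfun J (card {0..<m + n} * e) (\<lambda>x. \<Prod>i = 0..<m + n. sylvester_mat (p x) (q x) $$ (i, \<pi> i))"
      by (rule polyfun_prod, rule entry) (use permutes_in_image[OF that] in auto)
    then show "polyfun J ((m + n) * e) (\<lambda>x. \<Prod>i = 0..<m + n. sylvester_mat (p x) (q x) $$ (i, \<pi> i))"
      by simp
  qed
  then show ?thesis
    unfolding resultant_def Determinant.det_def dim by (auto intro: polyfun_sum)
qed

lemma resultant_irreducible_nonzero:
  fixes p q :: "'r::{factorial_ring_gcd,semiring_gcd_mult_normalize} poly"
  assumes "irreducible p" "\<not> p dvd q"
  shows "resultant p q \<noteq> 0"
proof -
  have "gcd p q dvd 1"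
    using irreducibleD'[OF assms(1), of "gcd p q"] assms(2) by (meson dvd_trans gcd_dvd1 gcd_dvd2)
  then have "degree (gcd p q) = 0" by (auto simp: is_unit_poly_iff)
  then show ?thesis unfolding resultant_0_gcd by simp
qed

lemma resultant_common_root:
  fixes p q :: "'a::field_gcd poly"
  assumes "p \<noteq> 0" "poly p t = 0" "poly q t = 0"
  shows "resultant p q = 0"
proof -
  have "[:-t, 1:] dvd gcd p q" using assms by (simp add: poly_eq_0_iff_dvd)
  moreover have "gcd p q \<noteq> 0" using assms by simp
  ultimately have "degree [:-t, 1:] \<le> degree (gcd p q)" by (rule dvd_imp_degree_le)
  then show ?thesis unfolding resultant_0_gcd by simp
qed

lemma resultant_eq_0_iff_common_root:
  fixes p q :: "'a::{alg_closed_field,field_gcd} poly"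
  assumes "p \<noteq> 0"
  shows "resultant p q = 0 \<longleftrightarrow> (\<exists>t. poly p t = 0 \<and> poly q t = 0)"
proof
  assume "resultant p q = 0"
  then have "degree (gcd p q) \<noteq> 0" by (simp add: resultant_0_gcd)
  then obtain t where "poly (gcd p q) t = 0" using alg_closed_imp_poly_has_root[of "gcd p q"] by auto
  then have "poly p t = 0 \<and> poly q t = 0" by (simp add: poly_eq_0_iff_dvd)
  then show "\<exists>t. poly p t = 0 \<and> poly q t = 0" ..
qed (use resultant_common_root[OF assms] in blast)

definition eliminates ::
    "nat \<Rightarrow> ((nat \<Rightarrow> 'a::zero) \<Rightarrow> 'a) \<Rightarrow> ((nat \<Rightarrow> 'a) \<Rightarrow> 'a) \<Rightarrow> ((nat \<Rightarrow> 'a) \<Rightarrow> 'a) \<Rightarrow> bool" where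
  "eliminates i f g N \<longleftrightarrow> (\<forall>x. N x = 0 \<longleftrightarrow> (\<exists>t. f (x(i := t)) = 0 \<and> g (x(i := t)) = 0))"

definition elim_degree :: "nat \<Rightarrow> nat" where
  "elim_degree e = (3 * e + 1) * e"

lemma elim_degree_ge: "e \<le> elim_degree e"
  by (simp add: elim_degree_def)

text \<open>Adding \<open>X\<^bsup>e + 1\<^esup>\<close> times the monic polynomial to \<open>g\<close> keeps the common roots and makes the degree of
  the second argument of the resultant, hence the size of the Sylvester matrix, independent of \<open>x\<close>.\<close>

lemma monic_elimination:
  fixes f g :: "(nat \<Rightarrow> 'a::{alg_closed_field,field_gcd}) \<Rightarrow> 'a"
  assumes f: "monic_in I i e f" and g: "polyfun I e g"
  shows "\<exists>N. polyfun (I - {i}) (elim_degree e) N \<and> eliminates i f g N"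
proof -
  obtain q d where q: "d \<le> e" "\<And>k. polyfun (I - {i}) e (\<lambda>x. coeff (q x) k)"
    "\<And>x. degree (q x) = d" "\<And>x. lead_coeff (q x) = 1" "\<And>x t. f (x(i := t)) = poly (q x) t"
    by (rule monic_inE[OF f]) (rule that)
  obtain p where p: "\<forall>k. polyfun (I - {i}) (e - k) (\<lambda>x. coeff (p x) k)" "\<forall>x. degree (p x) \<le> e"
    "\<forall>x t. g (x(i := t)) = poly (p x) t"
    using polyfun_coord_expansion[OF g] by blast
  define r where "r x = p x + monom 1 (Suc e) * q x" for x
  have coeff_r: "coeff (r x) k = (if k < Suc e then coeff (p x) k else coeff (q x) (k - Suc e))" for x k
    using coeff_eq_0[of "p x" k] p(2)[rule_format, of x] by (auto simp: r_def coeff_monom_mult)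
  have degree_r: "degree (r x) = Suc e + d" for x
    using q(3,4)[of x] by (intro antisym degree_le le_degree) (auto simp: coeff_r intro!: coeff_eq_0)
  have polyfun_r: "polyfun (I - {i}) e (\<lambda>x. coeff (r x) k)" for k
    unfolding coeff_r using q(2) by (cases "k < Suc e") (auto intro: polyfun_mono[OF p(1)[rule_format]])
  define N where "N x = resultant (q x) (r x)" for x
  have "polyfun (I - {i}) ((d + (Suc e + d)) * e) N"
    unfolding N_def by (rule polyfun_resultant[OF q(2) polyfun_r q(3) degree_r])
  then have "polyfun (I - {i}) (elim_degree e) N"
    by (rule polyfun_mono) (use q(1) in \<open>auto simp: elim_degree_def intro!: mult_right_mono\<close>)
  moreover have "eliminates i f g N"
  proof -
    have "q x \<noteq> 0" for x using q(4)[of x] by auto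
    then show ?thesis
      unfolding eliminates_def N_def resultant_eq_0_iff_common_root[OF \<open>\<And>x. q x \<noteq> 0\<close>]
      using p(3) q(5) by (auto simp: r_def simp del: fun_upd_apply)
  qed
  ultimately show ?thesis by blast
qed

section \<open>Factorial models of rings of polynomial functions\<close>

text \<open>Iterating \<open>adjoin\<close> realises the polynomial functions in finitely many variables by a type of nested
  univariate polynomials, which the type class system knows to be a unique factorisation domain.\<close>

locale polyfun_model =
  fixes I :: "nat set" and e :: "'r::comm_ring_1 \<Rightarrow> (nat \<Rightarrow> 'a::comm_ring_1) \<Rightarrow> 'a"
  assumes hom: "comm_ring_hom (\<lambda>p. e p x)" and inj: "inj e" and range: "range e = polyfuns I"
begin

sublocale eval: comm_ring_hom "\<lambda>p. e p x" for x
  by (rule hom)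

lemma in_polyfuns: "e p \<in> polyfuns I"
  using range by blast

lemma obtain_preimage:
  assumes "f \<in> polyfuns I"
  obtains p where "e p = f"
  using assms unfolding range[symmetric] by auto

lemma cong: "(\<And>i. i \<in> I \<Longrightarrow> x i = y i) \<Longrightarrow> e p x = e p y"
  by (rule polyfuns_cong[OF in_polyfuns])

lemma eq_0I: "(\<And>x. e p x = 0) \<Longrightarrow> p = 0"
  by (intro injD[OF inj]) (simp add: fun_eq_iff)

end

lemma polyfun_model_irreducible:
  fixes e :: "'r::comm_ring_1 \<Rightarrow> (nat \<Rightarrow> 'a::field_char_0) \<Rightarrow> 'a"
  assumes e: "polyfun_model I e" and p: "irreducible_polyfun I (e p)"
  shows "irreducible p"
proof -
  interpret polyfun_model I e by (rule e)
  have nonconstant: "\<not> e p constant_on UNIV" using p by (simp add: irreducible_polyfun_def)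
  have unit: "u dvd 1" if u: "e u constant_on UNIV" "u \<noteq> 0" for u
  proof -
    obtain c where c: "e u = (\<lambda>_. c)" using u(1) by (auto simp: constant_on_UNIV_iff)
    then have "c \<noteq> 0" using eq_0I[of u] u(2) by auto
    obtain v where "e v = (\<lambda>_. inverse c)" using polyfuns_const by (rule obtain_preimage)
    then have "e (u * v) = e 1" using c \<open>c \<noteq> 0\<close> by (auto simp: eval.hom_mult)
    then show ?thesis using injD[OF inj] by (metis dvd_triv_left)
  qed
  show ?thesis
  proof (rule irreducibleI)
    show "p \<noteq> 0"
    proof
      assume "p = 0"
      then have "e p x = 0" for x by simp
      then show False using nonconstant by (simp add: constant_on_def)
    qed
    show "\<not> p dvd 1"
    proof
      assume "p dvd 1"
      then obtain v where "1 = p * v" by (rule dvdE)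
      then have "e p x * e v x = 1" for x using eval.hom_mult[of p v x] by simp
      then show False
        using nonconstant polyfuns_unit_constant[OF in_polyfuns in_polyfuns] by blast
    qed
    fix u v assume uv: "p = u * v"
    then have "e p = (\<lambda>x. e u x * e v x)" by (auto simp: eval.hom_mult)
    then have "e u constant_on UNIV \<or> e v constant_on UNIV"
      using irreducible_polyfunD[OF p] in_polyfuns by blast
    moreover have "u \<noteq> 0" "v \<noteq> 0" using uv \<open>p \<noteq> 0\<close> by auto
    ultimately show "u dvd 1 \<or> v dvd 1" using unit by blast
  qed
qed

definition adjoin :: "nat \<Rightarrow> ('r::zero \<Rightarrow> (nat \<Rightarrow> 'a) \<Rightarrow> 'a) \<Rightarrow> 'r poly \<Rightarrow> (nat \<Rightarrow> 'a::comm_ring_1) \<Rightarrow> 'a" where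
  "adjoin i e p x = poly (map_poly (\<lambda>c. e c x) p) (x i)"

lemma polyfun_model_const: "polyfun_model {} (\<lambda>c (_ :: nat \<Rightarrow> 'a::comm_ring_1). c)"
proof
  have "\<exists>c. f = (\<lambda>_. c)" if "polyfun {} n f" for n and f :: "(nat \<Rightarrow> 'a) \<Rightarrow> 'a"
    using that by (induction rule: polyfun.induct) auto
  then show "range (\<lambda>c (_ :: nat \<Rightarrow> 'a). c) = polyfuns {}"
    by (force simp: polyfuns_def intro: polyfun.const)
qed (auto simp: inj_def fun_eq_iff)

context
  fixes I :: "nat set" and i :: nat and e :: "'r::comm_ring_1 \<Rightarrow> (nat \<Rightarrow> 'a::field_char_0) \<Rightarrow> 'a"
  assumes e: "polyfun_model I e" and i: "i \<notin> I"
begin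

interpretation polyfun_model I e
  by (rule e)

lemma adjoin_upd: "adjoin i e p (x(i := t)) = poly (map_poly (\<lambda>c. e c x) p) t"
proof -
  have "e c (x(i := t)) = e c x" for c by (rule cong) (use i in auto)
  then show ?thesis by (simp add: adjoin_def)
qed

lemma adjoin_hom: "comm_ring_hom (\<lambda>p. adjoin i e p x)"
proof -
  interpret map_poly_comm_ring_hom "\<lambda>c. e c x" by unfold_locales
  show ?thesis by unfold_locales (auto simp: adjoin_def hom_distribs)
qed

lemma inj_adjoin: "inj (adjoin i e)"
proof (rule injI)
  fix p q assume eq: "adjoin i e p = adjoin i e q"
  have "coeff p k = coeff q k" for k
  proof (rule injD[OF inj], rule ext)
    fix x
    have "poly (map_poly (\<lambda>c. e c x) p) t = poly (map_poly (\<lambda>c. e c x) q) t" for t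
      using fun_cong[OF eq, of "x(i := t)"] by (simp only: adjoin_upd)
    then have "map_poly (\<lambda>c. e c x) p = map_poly (\<lambda>c. e c x) q"
      by (simp add: poly_eq_poly_eq_iff[symmetric] fun_eq_iff)
    from arg_cong[OF this, of "\<lambda>r. coeff r k"] show "e (coeff p k) x = e (coeff q k) x"
      by (simp add: coeff_map_poly)
  qed
  then show "p = q" by (rule poly_eqI)
qed

lemma range_adjoin: "range (adjoin i e) = polyfuns (insert i I)"
proof (intro equalityI subsetI)
  fix f assume "f \<in> range (adjoin i e)"
  then obtain p where "f = adjoin i e p" by blast
  then have p: "f = (\<lambda>x. poly (map_poly (\<lambda>c. e c x) p) (x i))" by (auto simp: adjoin_def)
  have "(\<lambda>x. coeff (map_poly (\<lambda>c. e c x) p) k) \<in> polyfuns (insert i I)" for k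
    using in_polyfuns polyfuns_mono[of I "insert i I"] by (auto simp: coeff_map_poly)
  moreover have "(\<lambda>x. x i) \<in> polyfuns (insert i I)" by (rule polyfunsI[OF polyfun.var]) simp
  ultimately show "f \<in> polyfuns (insert i I)"
    unfolding p by (rule polyfuns_poly[OF _ degree_map_poly_le])
next
  fix f :: "(nat \<Rightarrow> 'a) \<Rightarrow> 'a" assume "f \<in> polyfuns (insert i I)"
  then obtain n where "polyfun (insert i I) n f" by (rule polyfunsE)
  then obtain q where q: "\<forall>k. polyfun (insert i I - {i}) (n - k) (\<lambda>x. coeff (q x) k)"
    "\<forall>x. degree (q x) \<le> n" "\<forall>x t. f (x(i := t)) = poly (q x) t"
    using polyfun_coord_expansion by blast
  have "\<exists>p. e p = (\<lambda>x. coeff (q x) k)" for k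
    using q(1) i by (metis Diff_insert_absorb obtain_preimage polyfunsI)
  then obtain p where p: "\<And>k. e (p k) = (\<lambda>x. coeff (q x) k)" by metis
  have "map_poly (\<lambda>c. e c x) (\<Sum>k\<le>n. monom (p k) k) = q x" for x
    using q(2)[rule_format, of x] by (intro poly_eqI) (auto simp: coeff_map_poly coeff_sum p coeff_eq_0)
  then have "adjoin i e (\<Sum>k\<le>n. monom (p k) k) x = f x" for x
    using q(3)[rule_format, of x "x i"] by (simp add: adjoin_def)
  then show "f \<in> range (adjoin i e)" by (intro range_eqI[of _ _ "\<Sum>k\<le>n. monom (p k) k"]) auto
qed

lemma polyfun_model_adjoin: "polyfun_model (insert i I) (adjoin i e)"
  by (intro polyfun_model.intro adjoin_hom inj_adjoin range_adjoin)

end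

lemma coprime_elimination:
  fixes e :: "'r::{factorial_ring_gcd,semiring_gcd_mult_normalize} \<Rightarrow> (nat \<Rightarrow> 'a::{field_char_0,field_gcd}) \<Rightarrow> 'a"
  assumes e: "polyfun_model I e" and p: "irreducible p" "\<not> p dvd q"
  shows "\<exists>r\<in>polyfuns I. (\<exists>x. r x \<noteq> 0) \<and> (\<forall>x. adjoin i e p x = 0 \<longrightarrow> adjoin i e q x = 0 \<longrightarrow> r x = 0)"
proof -
  interpret polyfun_model I e by (rule e)
  define c where "c = resultant p q * lead_coeff p * lead_coeff q"
  have "p \<noteq> 0" "q \<noteq> 0" using p by auto
  then have "c \<noteq> 0" using resultant_irreducible_nonzero[OF p] by (simp add: c_def)
  then have "\<exists>x. e c x \<noteq> 0" using eq_0I[of c] by auto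
  moreover have "e c x = 0" if zero: "adjoin i e p x = 0" "adjoin i e q x = 0" for x
  proof (rule ccontr)
    assume "e c x \<noteq> 0"
    then have nz: "e (resultant p q) x \<noteq> 0" "e (lead_coeff p) x \<noteq> 0" "e (lead_coeff q) x \<noteq> 0"
      by (auto simp: c_def eval.hom_mult)
    have degree: "degree (map_poly (\<lambda>c. e c x) r) = degree r" if "e (lead_coeff r) x \<noteq> 0" for r
      by (rule map_poly_degree_eq) (use that in simp)
    have "map_poly (\<lambda>c. e c x) p \<noteq> 0" using nz(2) by (metis coeff_0 coeff_map_poly eval.hom_zero)
    then have "resultant (map_poly (\<lambda>c. e c x) p) (map_poly (\<lambda>c. e c x) q) = 0"
      using zero unfolding adjoin_def by (rule resultant_common_root)
    then show False using eval.resultant_map_poly[OF degree degree, of p q] nz by simp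
  qed
  ultimately show ?thesis using in_polyfuns[of c] by blast
qed

lemma monic_in_preimage:
  fixes e :: "'r::comm_ring_1 \<Rightarrow> (nat \<Rightarrow> 'a::field_char_0) \<Rightarrow> 'a" and f :: "(nat \<Rightarrow> 'a) \<Rightarrow> 'a"
  assumes e: "polyfun_model I e" and i: "i \<notin> I" and f: "monic_in (insert i I) i D f"
  obtains p q d where "adjoin i e p = f" "\<And>x. map_poly (\<lambda>c. e c x) p = q x" "degree p = d" "d \<le> D"
    "\<And>k. polyfun I D (\<lambda>x. coeff (q x) k)" "\<And>x. degree (q x) = d" "\<And>x. lead_coeff (q x) = 1"
    "\<And>x t. f (x(i := t)) = poly (q x) t"
proof -
  interpret polyfun_model I e by (rule e)
  interpret E: polyfun_model "insert i I" "adjoin i e" by (rule polyfun_model_adjoin[OF e i])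
  obtain q d where q: "d \<le> D" "\<And>k. polyfun (insert i I - {i}) D (\<lambda>x. coeff (q x) k)"
    "\<And>x. degree (q x) = d" "\<And>x. lead_coeff (q x) = 1" "\<And>x t. f (x(i := t)) = poly (q x) t"
    by (rule monic_inE[OF f]) (rule that)
  obtain p where p: "adjoin i e p = f"
    using monic_in_polyfuns[OF f] by (auto intro: E.obtain_preimage)
  have map_p: "map_poly (\<lambda>c. e c x) p = q x" for x
  proof -
    have "poly (map_poly (\<lambda>c. e c x) p) t = poly (q x) t" for t
      using adjoin_upd[OF e i, of p x t] q(5)[of x t] by (simp add: p)
    then show ?thesis by (simp add: poly_eq_poly_eq_iff[symmetric] fun_eq_iff)
  qed
  then have coeff_p: "e (coeff p k) x = coeff (q x) k" for k x
    by (metis coeff_map_poly eval.hom_zero)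
  have "degree p = d"
  proof (rule antisym)
    show "degree p \<le> d"
      using q(3) by (intro degree_le allI impI eq_0I) (simp add: coeff_p coeff_eq_0)
    have "e (coeff p d) (\<lambda>_. 0) = 1" using q(3,4)[of "\<lambda>_. 0"] by (simp add: coeff_p)
    then show "d \<le> degree p" by (intro le_degree) auto
  qed
  then show ?thesis using that p map_p q i by simp
qed

lemma polyfun_model_coeff_pderiv_nonzero:
  fixes e :: "'r::idom \<Rightarrow> (nat \<Rightarrow> 'a::field_char_0) \<Rightarrow> 'a" and p :: "'r poly"
  assumes "polyfun_model I e" "degree p > 0"
  shows "coeff (pderiv p) (degree p - 1) \<noteq> 0"
proof -
  interpret polyfun_model I e by (rule assms)
  have "lead_coeff p \<noteq> 0" using assms(2) by auto
  then obtain x where "e (lead_coeff p) x \<noteq> 0" using eq_0I by blast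
  then have "e (coeff (pderiv p) (degree p - 1)) x \<noteq> 0"
    using assms(2) by (simp add: coeff_pderiv eval.hom_mult eval.hom_add eval.hom_of_nat)
  then show ?thesis by auto
qed

lemma polyfun_model_degree_pderiv:
  fixes e :: "'r::idom \<Rightarrow> (nat \<Rightarrow> 'a::field_char_0) \<Rightarrow> 'a" and p :: "'r poly"
  assumes "polyfun_model I e"
  shows "degree (pderiv p) = degree p - 1"
proof (cases "degree p = 0")
  case True
  then show ?thesis using degree_pderiv_le[of p] by simp
next
  case False
  then show ?thesis
    using polyfun_model_coeff_pderiv_nonzero[OF assms, of p] by (intro antisym degree_pderiv_le le_degree) simp
qed

lemma polyfun_model_not_dvd_pderiv:
  fixes e :: "'r::idom \<Rightarrow> (nat \<Rightarrow> 'a::field_char_0) \<Rightarrow> 'a" and p :: "'r poly"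
  assumes "polyfun_model I e" "degree p > 0"
  shows "\<not> p dvd pderiv p"
proof
  assume "p dvd pderiv p"
  moreover have "pderiv p \<noteq> 0" using polyfun_model_coeff_pderiv_nonzero[OF assms] by auto
  ultimately have "degree p \<le> degree (pderiv p)" by (rule dvd_imp_degree_le)
  then show False using assms(2) by (simp add: polyfun_model_degree_pderiv[OF assms(1)])
qed

lemma polyfun_resultant_pderiv:
  fixes q :: "(nat \<Rightarrow> 'a) \<Rightarrow> 'a::field_char_0 poly"
  assumes q: "\<And>k. polyfun I D (\<lambda>x. coeff (q x) k)" "\<And>x. degree (q x) = d"
  shows "polyfun I ((d + (d - 1)) * D) (\<lambda>x. resultant (q x) (pderiv (q x)))"
proof (rule polyfun_resultant)
  show "polyfun I D (\<lambda>x. coeff (pderiv (q x)) k)" for k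
    unfolding coeff_pderiv by (intro polyfun_cmult q)
qed (simp_all add: q degree_pderiv)

lemma monic_discriminant:
  fixes f :: "(nat \<Rightarrow> 'a::{real_normed_field,field_gcd}) \<Rightarrow> 'a"
    and e :: "'r::{factorial_ring_gcd,semiring_gcd_mult_normalize} \<Rightarrow> (nat \<Rightarrow> 'a) \<Rightarrow> 'a"
  assumes e: "polyfun_model I e" and i: "i \<notin> I"
    and f: "irreducible_polyfun (insert i I) f" "monic_in (insert i I) i D f"
  obtains R where "polyfun I (2 * D * D) R" "\<exists>x. R x \<noteq> 0"
    "\<And>x. f x = 0 \<Longrightarrow> ((\<lambda>t. f (x(i := t))) has_field_derivative 0) (at (x i)) \<Longrightarrow> R x = 0"
proof -
  interpret polyfun_model I e by (rule e)
  obtain p q d where p: "adjoin i e p = f" "\<And>x. map_poly (\<lambda>c. e c x) p = q x" "degree p = d" "d \<le> D"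
    and q: "\<And>k. polyfun I D (\<lambda>x. coeff (q x) k)" "\<And>x. degree (q x) = d" "\<And>x. lead_coeff (q x) = 1"
    and fq: "\<And>x t. f (x(i := t)) = poly (q x) t"
    by (rule monic_in_preimage[OF e i f(2)]) (rule that)
  have irreducible: "irreducible p"
    using polyfun_model_irreducible[OF polyfun_model_adjoin[OF e i]] f(1) p(1) by blast
  have f_eq: "f x = poly (q x) (x i)" for x using fq[of x "x i"] by simp
  have "d > 0"
  proof (rule ccontr)
    assume "\<not> d > 0"
    then have "q x = [:1:]" for x using q(2,3)[of x] by (auto elim: degree_eq_zeroE)
    then show False using f(1) by (simp add: irreducible_polyfun_def constant_on_def f_eq)
  qed
  have map_pderiv: "map_poly (\<lambda>c. e c x) (pderiv p) = pderiv (q x)" for x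
    using idom_hom.map_poly_pderiv[OF idom_hom.intro[OF hom]] p(2) by simp
  have "\<not> p dvd pderiv p" using polyfun_model_not_dvd_pderiv[OF e] p(3) \<open>d > 0\<close> by simp
  then have "resultant p (pderiv p) \<noteq> 0" by (rule resultant_irreducible_nonzero[OF irreducible])
  then obtain x\<^sub>1 where "e (resultant p (pderiv p)) x\<^sub>1 \<noteq> 0" using eq_0I by blast
  define R where "R x = resultant (q x) (pderiv (q x))" for x
  have "R x = e (resultant p (pderiv p)) x" for x
    using eval.resultant_map_poly[of x p "pderiv p"]
    by (simp add: R_def map_pderiv degree_pderiv polyfun_model_degree_pderiv[OF e] p(2,3) q(2))
  then have "R x\<^sub>1 \<noteq> 0" using \<open>e (resultant p (pderiv p)) x\<^sub>1 \<noteq> 0\<close> by simp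
  moreover have "polyfun I (2 * D * D) R"
    unfolding R_def by (rule polyfun_mono[OF polyfun_resultant_pderiv[OF q(1,2)]]) (use p(4) in auto)
  moreover have "R x = 0"
    if "f x = 0" "((\<lambda>t. f (x(i := t))) has_field_derivative 0) (at (x i))" for x
  proof -
    have "poly (pderiv (q x)) (x i) = 0" using that(2) unfolding fq by (metis DERIV_unique poly_DERIV)
    moreover have "q x \<noteq> 0" using q(2)[of x] \<open>d > 0\<close> by auto
    ultimately show ?thesis using that(1) unfolding R_def f_eq by (intro resultant_common_root)
  qed
  ultimately show ?thesis using that by blast
qed

section \<open>Zariski closed sets\<close>

text \<open>Variables are indexed by literals; rewriting \<open>1\<close> to \<open>Suc 0\<close> would hide them from rewrite rules.\<close>

declare One_nat_def [simp del]

lemma zclosed_iff: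
  fixes V :: "(nat \<Rightarrow> 'a::comm_ring_1) set"
  shows "zclosed n V \<longleftrightarrow>
    V \<subseteq> aff n \<and> (\<forall>x\<in>aff n - V. \<exists>g\<in>polyfuns {..<n}. (\<forall>v\<in>V. g v = 0) \<and> g x \<noteq> 0)"
proof
  assume "zclosed n V"
  then obtain F where F: "\<forall>f\<in>F. vars f \<subseteq> {..<n}" "V = zeros n F" by (auto simp: zclosed_def)
  have "\<exists>g\<in>polyfuns {..<n}. (\<forall>v\<in>V. g v = 0) \<and> g x \<noteq> 0" if "x \<in> aff n - V" for x
  proof -
    obtain f where "f \<in> F" "peval f x \<noteq> 0" using F \<open>x \<in> aff n - V\<close> by (auto simp: zeros_def)
    then show ?thesis using F by (intro bexI[of _ "peval f"]) (auto simp: zeros_def polyfuns_eq_peval)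
  qed
  then show "V \<subseteq> aff n \<and> (\<forall>x\<in>aff n - V. \<exists>g\<in>polyfuns {..<n}. (\<forall>v\<in>V. g v = 0) \<and> g x \<noteq> 0)"
    using F(2) by (auto simp: zeros_def)
next
  assume V: "V \<subseteq> aff n \<and> (\<forall>x\<in>aff n - V. \<exists>g\<in>polyfuns {..<n}. (\<forall>v\<in>V. g v = 0) \<and> g x \<noteq> 0)"
  define F where "F = {f. vars f \<subseteq> {..<n} \<and> (\<forall>v\<in>V. peval f v = 0)}"
  have "x \<in> V" if x: "x \<in> zeros n F" for x
  proof (rule ccontr)
    assume "x \<notin> V"
    then have "x \<in> aff n - V" using x by (simp add: zeros_def)
    then obtain g where "g \<in> polyfuns {..<n}" "\<forall>v\<in>V. g v = 0" "g x \<noteq> 0" using V by blast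
    then show False using x by (auto simp: polyfuns_eq_peval zeros_def F_def)
  qed
  moreover have "V \<subseteq> zeros n F" using V by (auto simp: zeros_def F_def)
  ultimately show "zclosed n V" unfolding zclosed_def by (intro exI[of _ F]) (auto simp: F_def)
qed

lemma zclosed_subset_aff:
  fixes V :: "(nat \<Rightarrow> 'a::comm_ring_1) set"
  shows "zclosed n V \<Longrightarrow> V \<subseteq> aff n"
  by (simp add: zclosed_iff)

lemma zclosed_separation:
  fixes V :: "(nat \<Rightarrow> 'a::comm_ring_1) set"
  assumes "zclosed n V" "x \<in> aff n" "x \<notin> V"
  obtains g where "g \<in> polyfuns {..<n}" "\<And>v. v \<in> V \<Longrightarrow> g v = 0" "g x \<noteq> 0"
proof -
  have "\<exists>g\<in>polyfuns {..<n}. (\<forall>v\<in>V. g v = 0) \<and> g x \<noteq> 0" using assms by (simp add: zclosed_iff)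
  then show ?thesis using that by blast
qed

lemma zclosed_separation_finite:
  fixes V :: "(nat \<Rightarrow> 'a::field_char_0) set"
  assumes V: "zclosed n V" and A: "finite A" "A \<subseteq> aff n" "A \<inter> V = {}"
  shows "\<exists>f\<in>polyfuns {..<n}. (\<forall>v\<in>V. f v = 0) \<and> (\<forall>a\<in>A. f a \<noteq> 0)"
proof -
  let ?I = "{f \<in> polyfuns {..<n}. \<forall>v\<in>V. f v = 0}"
  have "\<exists>f\<in>?I. \<forall>a\<in>A. f a \<noteq> 0"
  proof (rule exists_nonvanishing_on_finite)
    show "\<exists>f\<in>?I. f a \<noteq> 0" if "a \<in> A" for a
      using V A(2,3) that unfolding zclosed_iff by blast
    have "(\<lambda>_. 0) \<in> ?I" by (simp add: polyfuns_const)
    then show "?I \<noteq> {}" by blast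
    show "(\<lambda>x. f x + k * g x) \<in> ?I" if "f \<in> ?I" "g \<in> ?I" for f g k
      using that by (auto intro!: polyfuns_add polyfuns_mult polyfuns_const)
  qed (rule A(1))
  then show ?thesis by blast
qed

lemma zclosed_Int_zeros:
  fixes V :: "(nat \<Rightarrow> 'a::comm_ring_1) set"
  assumes V: "zclosed n V" and f: "f \<in> polyfuns {..<n}"
  shows "zclosed n {x \<in> V. f x = 0}"
  unfolding zclosed_iff
proof (intro conjI ballI)
  show "{x \<in> V. f x = 0} \<subseteq> aff n" using zclosed_subset_aff[OF V] by blast
  fix x assume x: "x \<in> aff n - {x \<in> V. f x = 0}"
  show "\<exists>g\<in>polyfuns {..<n}. (\<forall>v\<in>{x \<in> V. f x = 0}. g v = 0) \<and> g x \<noteq> 0"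
  proof (cases "x \<in> V")
    case True
    then show ?thesis using x f by blast
  next
    case False
    then show ?thesis using x V unfolding zclosed_iff by blast
  qed
qed

definition zclosure :: "nat \<Rightarrow> (nat \<Rightarrow> 'a::comm_ring_1) set \<Rightarrow> (nat \<Rightarrow> 'a) set" where
  "zclosure n S = {x \<in> aff n. \<forall>g\<in>polyfuns {..<n}. (\<forall>s\<in>S. g s = 0) \<longrightarrow> g x = 0}"

lemma zclosure_superset: "S \<subseteq> aff n \<Longrightarrow> S \<subseteq> zclosure n S"
  by (auto simp: zclosure_def)

lemma zclosure_vanishing:
  "g \<in> polyfuns {..<n} \<Longrightarrow> (\<And>s. s \<in> S \<Longrightarrow> g s = 0) \<Longrightarrow> x \<in> zclosure n S \<Longrightarrow> g x = 0"
  by (auto simp: zclosure_def)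

lemma zclosed_zclosure: "zclosed n (zclosure n S)"
  unfolding zclosed_iff by (auto simp: zclosure_def)

lemma zclosure_minimal:
  assumes "zclosed n V" "S \<subseteq> V"
  shows "zclosure n S \<subseteq> V"
proof
  fix x assume x: "x \<in> zclosure n S"
  show "x \<in> V"
  proof (rule ccontr)
    assume "x \<notin> V"
    then obtain g where "g \<in> polyfuns {..<n}" "\<And>v. v \<in> V \<Longrightarrow> g v = 0" "g x \<noteq> 0"
      using zclosed_separation[OF assms(1)] x by (auto simp: zclosure_def)
    then show False using zclosure_vanishing[OF _ _ x, of g] assms(2) by blast
  qed
qed

definition zprime :: "nat \<Rightarrow> (nat \<Rightarrow> 'a::comm_ring_1) set \<Rightarrow> bool" where
  "zprime n S \<longleftrightarrow> S \<noteq> {} \<and> (\<forall>g\<in>polyfuns {..<n}. \<forall>h\<in>polyfuns {..<n}.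
     (\<forall>x\<in>S. g x * h x = 0) \<longrightarrow> (\<forall>x\<in>S. g x = 0) \<or> (\<forall>x\<in>S. h x = 0))"

lemma zprimeD:
  assumes "zprime n S" "g \<in> polyfuns {..<n}" "h \<in> polyfuns {..<n}" "\<And>x. x \<in> S \<Longrightarrow> g x * h x = 0"
  shows "(\<forall>x\<in>S. g x = 0) \<or> (\<forall>x\<in>S. h x = 0)"
  using assms unfolding zprime_def by meson

lemma zprime_prod:
  fixes f :: "'b \<Rightarrow> (nat \<Rightarrow> 'a::idom) \<Rightarrow> 'a"
  assumes "zprime n S" "finite A" "\<And>a. a \<in> A \<Longrightarrow> f a \<in> polyfuns {..<n}"
    and "\<And>x. x \<in> S \<Longrightarrow> (\<Prod>a\<in>A. f a x) = 0"
  shows "\<exists>a\<in>A. \<forall>x\<in>S. f a x = 0"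
  using assms(2-4)
proof (induction A rule: finite_induct)
  case empty
  then show ?case using assms(1) by (auto simp: zprime_def)
next
  case (insert a A)
  have "(\<forall>x\<in>S. f a x = 0) \<or> (\<forall>x\<in>S. (\<Prod>a\<in>A. f a x) = 0)"
    by (rule zprimeD[OF assms(1)]) (use insert in \<open>auto intro: polyfuns_prod\<close>)
  then show ?case using insert by blast
qed

lemma zprime_zclosure:
  assumes "zprime n S" "S \<subseteq> aff n"
  shows "zprime n (zclosure n S)"
  unfolding zprime_def
proof (intro conjI ballI impI)
  show "zclosure n S \<noteq> {}" using assms zclosure_superset[OF assms(2)] by (auto simp: zprime_def)
  fix g h assume gh: "g \<in> polyfuns {..<n}" "h \<in> polyfuns {..<n}" "\<forall>x\<in>zclosure n S. g x * h x = 0"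
  have "(\<forall>x\<in>S. g x = 0) \<or> (\<forall>x\<in>S. h x = 0)"
    by (rule zprimeD[OF assms(1) gh(1,2)]) (use gh(3) zclosure_superset[OF assms(2)] in blast)
  then show "(\<forall>x\<in>zclosure n S. g x = 0) \<or> (\<forall>x\<in>zclosure n S. h x = 0)"
    using zclosure_vanishing gh(1,2) by blast
qed

lemma zirred_iff_zprime:
  fixes V :: "(nat \<Rightarrow> 'a::idom) set"
  shows "zirred n V \<longleftrightarrow> zclosed n V \<and> zprime n V"
proof
  assume V: "zirred n V"
  have "zprime n V" unfolding zprime_def
  proof (intro conjI ballI impI)
    show "V \<noteq> {}" using V by (simp add: zirred_def)
    fix g h assume gh: "g \<in> polyfuns {..<n}" "h \<in> polyfuns {..<n}" "\<forall>v\<in>V. g v * h v = 0"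
    have "zclosed n {x \<in> V. g x = 0}" "zclosed n {x \<in> V. h x = 0}"
      using V gh(1,2) by (auto simp: zirred_def intro: zclosed_Int_zeros)
    moreover have "V = {x \<in> V. g x = 0} \<union> {x \<in> V. h x = 0}" using gh(3) by auto
    ultimately have "V = {x \<in> V. g x = 0} \<or> V = {x \<in> V. h x = 0}"
      using V unfolding zirred_def by blast
    then show "(\<forall>v\<in>V. g v = 0) \<or> (\<forall>v\<in>V. h v = 0)" by blast
  qed
  then show "zclosed n V \<and> zprime n V" using V by (simp add: zirred_def)
next
  assume V: "zclosed n V \<and> zprime n V"
  have "V = A \<or> V = B" if AB: "zclosed n A" "zclosed n B" "V = A \<union> B" for A B
  proof (rule ccontr)
    assume "\<not> ?thesis"
    then obtain x y where xy: "x \<in> V" "x \<notin> A" "y \<in> V" "y \<notin> B" using AB by blast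
    then have "x \<in> aff n" "y \<in> aff n" using V zclosed_subset_aff by blast+
    then obtain g h where "g \<in> polyfuns {..<n}" "\<And>v. v \<in> A \<Longrightarrow> g v = 0" "g x \<noteq> 0"
      and "h \<in> polyfuns {..<n}" "\<And>v. v \<in> B \<Longrightarrow> h v = 0" "h y \<noteq> 0"
      using zclosed_separation[OF AB(1)] zclosed_separation[OF AB(2)] xy by metis
    then show False using zprimeD[of n V g h] V AB(3) xy by auto
  qed
  then show "zirred n V" using V by (auto simp: zirred_def zprime_def)
qed

lemma zirred_subset_Union:
  fixes V :: "(nat \<Rightarrow> 'a::idom) set"
  assumes V: "zirred n V" "V \<subseteq> \<Union>\<W>" and \<W>: "finite \<W>" "\<And>W. W \<in> \<W> \<Longrightarrow> zclosed n W"
  shows "\<exists>W\<in>\<W>. V \<subseteq> W"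
proof (rule ccontr)
  assume no: "\<not> ?thesis"
  have "\<forall>W\<in>\<W>. \<exists>g. g \<in> polyfuns {..<n} \<and> (\<forall>x\<in>W. g x = 0) \<and> (\<exists>x\<in>V. g x \<noteq> 0)"
  proof
    fix W assume W: "W \<in> \<W>"
    obtain x where "x \<in> V" "x \<notin> W" using no W by blast
    moreover have "x \<in> aff n" using V(1) \<open>x \<in> V\<close> zclosed_subset_aff by (auto simp: zirred_def)
    ultimately show "\<exists>g. g \<in> polyfuns {..<n} \<and> (\<forall>x\<in>W. g x = 0) \<and> (\<exists>x\<in>V. g x \<noteq> 0)"
      using \<W>(2)[OF W] unfolding zclosed_iff by blast
  qed
  from bchoice[OF this] obtain g
    where g: "\<forall>W\<in>\<W>. g W \<in> polyfuns {..<n} \<and> (\<forall>x\<in>W. g W x = 0) \<and> (\<exists>x\<in>V. g W x \<noteq> 0)"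
    by blast
  have "(\<Prod>W\<in>\<W>. g W x) = 0" if "x \<in> V" for x
  proof -
    obtain W where "W \<in> \<W>" "x \<in> W" using V(2) \<open>x \<in> V\<close> by blast
    then show ?thesis using g by (intro prod_zero \<W>(1)) blast
  qed
  then obtain W where "W \<in> \<W>" "\<forall>x\<in>V. g W x = 0"
    using zprime_prod[of n V \<W> g] V(1) \<W>(1) g by (auto simp: zirred_iff_zprime)
  then show False using g by blast
qed

lemma zprime_root_constant:
  fixes z :: "(nat \<Rightarrow> 'a::idom) \<Rightarrow> 'a"
  assumes "zprime n V" "z \<in> polyfuns {..<n}" "q \<noteq> 0" "\<And>v. v \<in> V \<Longrightarrow> poly q (z v) = 0"
  shows "z constant_on V"
proof -
  let ?R = "{t. poly q t = 0}"
  have "finite ?R" using assms(3) by (rule poly_roots_finite)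
  have "\<exists>t\<in>?R. \<forall>v\<in>V. z v + (- t) = 0"
  proof (rule zprime_prod[OF assms(1) \<open>finite ?R\<close>])
    show "(\<lambda>v. z v + - t) \<in> polyfuns {..<n}" for t by (intro polyfuns_add polyfuns_const assms(2))
    show "(\<Prod>t\<in>?R. z v + - t) = 0" if "v \<in> V" for v
      using \<open>finite ?R\<close> assms(4)[OF that] by (intro prod_zero) (auto intro!: bexI[of _ "z v"])
  qed
  then show ?thesis by (auto simp: constant_on_def)
qed

lemma zdim_le:
  assumes "\<And>c :: nat \<Rightarrow> (nat \<Rightarrow> 'a::comm_semiring_1) set.
    (\<And>i. i \<le> Suc k \<Longrightarrow> zirred n (c i) \<and> c i \<subseteq> V) \<Longrightarrow> (\<And>i. i \<le> k \<Longrightarrow> c i \<subset> c (Suc i)) \<Longrightarrow> False"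
  shows "zdim n V \<le> enat k"
  unfolding zdim_def
proof (rule Sup_least, clarify)
  fix m and c :: "nat \<Rightarrow> (nat \<Rightarrow> 'a) set"
  assume c: "\<forall>i\<le>m. zirred n (c i) \<and> c i \<subseteq> V" "\<forall>i<m. c i \<subset> c (Suc i)"
  have "m \<le> k"
  proof (rule ccontr)
    assume "\<not> m \<le> k"
    then show False using assms[of c] c by auto
  qed
  then show "enat m \<le> enat k" by simp
qed

lemma zdim_mono: "V \<subseteq> W \<Longrightarrow> zdim n V \<le> zdim n W"
  unfolding zdim_def by (rule Sup_subset_mono) (blast intro: order.trans)

subsection \<open>Algebraic functions\<close>

definition algebraic_on ::
    "((nat \<Rightarrow> 'a::comm_ring_1) \<Rightarrow> 'a) set \<Rightarrow> (nat \<Rightarrow> 'a) set \<Rightarrow> ((nat \<Rightarrow> 'a) \<Rightarrow> 'a) \<Rightarrow> bool" where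
  "algebraic_on B V h \<longleftrightarrow> (\<exists>q K. (\<forall>k. (\<lambda>x. coeff (q x) k) \<in> B) \<and> (\<forall>x. degree (q x) \<le> K) \<and>
     (\<forall>x\<in>V. q x \<noteq> 0 \<and> poly (q x) (h x) = 0))"

lemma algebraic_on_pullback:
  assumes "algebraic_on B V h" "\<sigma> ` U \<subseteq> V"
  shows "algebraic_on ((\<lambda>b x. b (\<sigma> x)) ` B) U (\<lambda>x. h (\<sigma> x))"
proof -
  obtain q K where q: "\<And>k. (\<lambda>x. coeff (q x) k) \<in> B" "\<And>x. degree (q x) \<le> K"
    "\<And>x. x \<in> V \<Longrightarrow> q x \<noteq> 0" "\<And>x. x \<in> V \<Longrightarrow> poly (q x) (h x) = 0"
    using assms(1) unfolding algebraic_on_def by blast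
  have "(\<lambda>x. coeff (q (\<sigma> x)) k) \<in> (\<lambda>b x. b (\<sigma> x)) ` B" for k
    by (rule image_eqI[OF _ q(1)]) simp
  then show ?thesis
    unfolding algebraic_on_def using q(2-4) assms(2)
    by (intro exI[of _ "\<lambda>x. q (\<sigma> x)"] exI[of _ K]) auto
qed

lemma algebraic_on_subset: "algebraic_on B V h \<Longrightarrow> U \<subseteq> V \<Longrightarrow> algebraic_on B U h"
  unfolding algebraic_on_def by blast

text \<open>The lowest coefficient of the equation of \<open>h\<close> that does not vanish identically on \<open>V\<close> is a multiple
  of \<open>h\<close> on \<open>V\<close>.\<close>

lemma algebraic_separation:
  fixes V :: "(nat \<Rightarrow> 'a::idom) set"
  assumes V: "zprime n V" and U: "U \<subseteq> V" and B: "B \<subseteq> polyfuns {..<n}"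
    and h: "h \<in> polyfuns {..<n}" "algebraic_on B V h" "\<And>u. u \<in> U \<Longrightarrow> h u = 0" "w \<in> V" "h w \<noteq> 0"
  shows "\<exists>a\<in>B. (\<forall>u\<in>U. a u = 0) \<and> (\<exists>v\<in>V. a v \<noteq> 0)"
proof -
  obtain q K where q: "\<And>k. (\<lambda>x. coeff (q x) k) \<in> B" "\<And>x. degree (q x) \<le> K"
    "\<And>x. x \<in> V \<Longrightarrow> q x \<noteq> 0" "\<And>x. x \<in> V \<Longrightarrow> poly (q x) (h x) = 0"
    using h(2) unfolding algebraic_on_def by blast
  define k where "k = (LEAST k. \<exists>v\<in>V. coeff (q v) k \<noteq> 0)"
  have "\<exists>v\<in>V. coeff (q v) (degree (q w)) \<noteq> 0" using q(3)[OF h(4)] h(4) by (intro bexI[of _ w]) auto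
  then have nonzero: "\<exists>v\<in>V. coeff (q v) k \<noteq> 0" unfolding k_def by (rule LeastI)
  have low: "coeff (q v) j = 0" if "j < k" "v \<in> V" for j v
    using not_less_Least[of j "\<lambda>k. \<exists>v\<in>V. coeff (q v) k \<noteq> 0"] that unfolding k_def by blast
  define r where "r v = poly (poly_shift k (q v)) (h v)" for v
  have "degree (poly_shift k (q v)) \<le> K" for v
    using q(2)[of v] by (intro degree_le) (auto simp: coeff_poly_shift intro!: coeff_eq_0)
  then have "r \<in> polyfuns {..<n}"
    unfolding r_def using q(1) B h(1) by (intro polyfuns_poly) (auto simp: coeff_poly_shift)
  moreover have "h v ^ k * r v = 0" if "v \<in> V" for v
  proof -
    have "q v = monom 1 k * poly_shift k (q v)"
      using low[OF _ that] by (intro poly_eqI) (auto simp: coeff_monom_mult coeff_poly_shift)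
    then have "poly (q v) (h v) = h v ^ k * r v" by (metis mult_1 poly_monom poly_mult r_def)
    then show ?thesis using q(4)[OF that] by simp
  qed
  ultimately have r_vanishes: "\<forall>v\<in>V. r v = 0"
    using zprimeD[OF V polyfuns_power[OF h(1)], of r k] h(4,5) by fastforce
  have "coeff (q u) k = 0" if u: "u \<in> U" for u
  proof -
    have "r u = coeff (q u) k" by (simp add: r_def h(3)[OF u] poly_0_coeff_0 coeff_poly_shift)
    then show ?thesis using r_vanishes U u by auto
  qed
  then show ?thesis using nonzero q(1) by (intro bexI[of _ "\<lambda>x. coeff (q x) k"]) auto
qed

lemma nonzero_root_iff_two_coeffs:
  fixes p :: "'a::alg_closed_field poly"
  assumes "p \<noteq> 0"
  shows "(\<exists>t. t \<noteq> 0 \<and> poly p t = 0) \<longleftrightarrow> (\<exists>k l. k \<noteq> l \<and> coeff p k \<noteq> 0 \<and> coeff p l \<noteq> 0)"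
proof
  assume "\<exists>t. t \<noteq> 0 \<and> poly p t = 0"
  then obtain t where t: "t \<noteq> 0" "poly p t = 0" by blast
  show "\<exists>k l. k \<noteq> l \<and> coeff p k \<noteq> 0 \<and> coeff p l \<noteq> 0"
  proof (rule ccontr)
    assume no: "\<not> ?thesis"
    have "p = monom (lead_coeff p) (degree p)"
      using no assms by (intro poly_eqI) (metis coeff_monom leading_coeff_0_iff)
    then have "poly p t = lead_coeff p * t ^ degree p" by (metis poly_monom)
    then show False using t assms by simp
  qed
next
  assume "\<exists>k l. k \<noteq> l \<and> coeff p k \<noteq> 0 \<and> coeff p l \<noteq> 0"
  then obtain k l where kl: "k \<noteq> l" "coeff p k \<noteq> 0" "coeff p l \<noteq> 0" by blast
  obtain r where r: "p = [:-0, 1:] ^ order 0 p * r" "\<not> [:-0, 1:] dvd r"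
    using order_decomp[OF assms] by blast
  have "degree r \<noteq> 0"
  proof
    assume "degree r = 0"
    then obtain c where "r = [:c:]" by (rule degree_eq_zeroE)
    then have "p = monom c (order 0 p)" using r(1) by (simp add: monom_altdef)
    then show False using kl by (metis coeff_monom)
  qed
  then obtain t where "poly r t = 0" using alg_closed_imp_poly_has_root[of r] by auto
  moreover have "poly r 0 \<noteq> 0" using r(2) by (simp add: poly_eq_0_iff_dvd)
  ultimately show "\<exists>t. t \<noteq> 0 \<and> poly p t = 0" using r(1) by (metis mult_zero_right poly_mult)
qed

lemma polyfun_single_var:
  assumes "polyfun {i} n f"
  shows "\<exists>p. \<forall>x. f x = poly p (x i)"
proof -
  obtain p where p: "\<forall>s. poly p s = f (\<lambda>j. 0 + s * 1)"
    using polyfun_line[OF assms, of "\<lambda>_. 0" "\<lambda>_. 1"] by blast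
  have "f x = poly p (x i)" for x
    unfolding p[rule_format] by (rule polyfun_cong[OF assms]) auto
  then show ?thesis by blast
qed

lemma finite_values_expansion:
  fixes N :: "(nat \<Rightarrow> 'a::field_char_0) \<Rightarrow> 'a"
  assumes N: "polyfun I m N" and roots: "\<And>x. finite (S x)" "\<And>x t. N (x(i := t)) = 0 \<longleftrightarrow> t \<in> S x"
  obtains q where "\<And>k. polyfun (I - {i}) m (\<lambda>x. coeff (q x) k)" "\<And>x. degree (q x) \<le> m"
    "\<And>x. q x \<noteq> 0" "\<And>x t. poly (q x) t = 0 \<longleftrightarrow> t \<in> S x"
proof -
  obtain q where q: "\<forall>k. polyfun (I - {i}) (m - k) (\<lambda>x. coeff (q x) k)" "\<forall>x. degree (q x) \<le> m"
    "\<forall>x t. N (x(i := t)) = poly (q x) t"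
    using polyfun_coord_expansion[OF N] by blast
  then have poly_roots: "poly (q x) t = 0 \<longleftrightarrow> t \<in> S x" for x t using roots(2) by metis
  have "q x \<noteq> 0" for x
  proof
    assume "q x = 0"
    then have "S x = UNIV" using poly_roots[of x] by auto
    then show False using roots(1)[of x] infinite_UNIV_char_0[where 'a='a] by simp
  qed
  moreover have "polyfun (I - {i}) m (\<lambda>x. coeff (q x) k)" for k
    by (rule polyfun_mono[OF q(1)[rule_format]]) auto
  ultimately show ?thesis using that q(2) poly_roots by blast
qed

lemma monic_plane_curve_algebraic:
  fixes g :: "(nat \<Rightarrow> 'a::{alg_closed_field,field_gcd,field_char_0}) \<Rightarrow> 'a"
  assumes g: "monic_in {..<2} 1 n g" and f: "f \<in> polyfuns {..<2}"
  shows "algebraic_on (range (\<lambda>p x. poly p (x 0))) {x. g x = 0} f"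
proof -
  obtain m where m: "polyfun {..<2} m f" using f by (rule polyfunsE)
  define e where "e = n + m + 1"
  have "polyfun {..<3} e (\<lambda>x. x 2 - f x)"
    unfolding e_def by (intro polyfun_diff polyfun_var polyfun_mono[OF m]) auto
  moreover have "monic_in {..<3} 1 e g" by (rule monic_in_mono[OF g]) (auto simp: e_def)
  ultimately obtain N where N: "polyfun ({..<3} - {1}) (elim_degree e) N" "eliminates 1 g (\<lambda>x. x 2 - f x) N"
    using monic_elimination by blast
  define S where "S x = (\<lambda>t. f (x(1 := t))) ` {t. g (x(1 := t)) = 0}" for x
  have roots: "N (x(2 := s)) = 0 \<longleftrightarrow> s \<in> S x" for x s
  proof -
    have "g (x(2 := s, 1 := t)) = g (x(1 := t))" for t
      by (rule polyfuns_cong[OF monic_in_polyfuns[OF g]]) auto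
    moreover have "f (x(2 := s, 1 := t)) = f (x(1 := t))" for t
      by (rule polyfun_cong[OF m]) auto
    ultimately show ?thesis using N(2) by (auto simp: eliminates_def S_def)
  qed
  have "finite (S x)" for x
    unfolding S_def by (intro finite_imageI monic_in_roots[OF g])
  then obtain q where q: "\<And>k. polyfun ({..<3} - {1} - {2}) (elim_degree e) (\<lambda>x. coeff (q x) k)"
    "\<And>x. degree (q x) \<le> elim_degree e" "\<And>x. q x \<noteq> 0" "\<And>x t. poly (q x) t = 0 \<longleftrightarrow> t \<in> S x"
    using roots by (rule finite_values_expansion[OF N(1)]) (rule that)
  have "(\<lambda>x. coeff (q x) k) \<in> range (\<lambda>p x. poly p (x 0))" for k
  proof -
    have "polyfun {0} (elim_degree e) (\<lambda>x. coeff (q x) k)" by (rule polyfun_mono[OF q(1)]) auto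
    then obtain p where "\<forall>x. coeff (q x) k = poly p (x 0)" using polyfun_single_var by blast
    then show ?thesis by blast
  qed
  moreover have "poly (q x) (f x) = 0" if "g x = 0" for x
    unfolding q(4) S_def using that by (intro image_eqI[of _ _ "x 1"]) auto
  ultimately show ?thesis unfolding algebraic_on_def using q(2,3) by blast
qed

lemma plane_curve_algebraic:
  fixes a :: "(nat \<Rightarrow> 'a::{alg_closed_field,field_gcd,field_char_0}) \<Rightarrow> 'a"
  assumes a: "a \<in> polyfuns {..<2}" "a x\<^sub>0 \<noteq> 0"
  shows "\<exists>v. \<forall>f\<in>polyfuns {..<2}. algebraic_on (range (\<lambda>p x. poly p (x 0 - v * x 1))) {x. a x = 0} f"
proof -
  obtain n where n: "polyfun {..<2} n a" using a(1) by (rule polyfunsE)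
  obtain w c g where w: "w 1 = 0" "\<And>j. j \<notin> {..<2} \<Longrightarrow> w j = 0" and c: "c \<noteq> 0"
    and g: "monic_in {..<2} 1 n g" and eq: "\<And>x. a (shear 1 w x) = c * g x"
    by (rule polyfun_shear_monic[OF n a(2), of 1]) auto
  define \<tau> where "\<tau> = shear 1 (\<lambda>j. - w j)"
  have \<tau>: "shear 1 w (\<tau> x) = x" "\<tau> x 0 = x 0 - w 0 * x 1" for x
    unfolding \<tau>_def using shear_inverse(2)[of w 1] w(1) by (auto simp: shear_def)
  have "algebraic_on (range (\<lambda>p x. poly p (x 0 - w 0 * x 1))) {x. a x = 0} f"
    if f: "f \<in> polyfuns {..<2}" for f
  proof -
    have "(\<lambda>x. f (shear 1 w x)) \<in> polyfuns {..<2}" using f by (rule polyfuns_shear) simp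
    from monic_plane_curve_algebraic[OF g this]
    have "algebraic_on ((\<lambda>b x. b (\<tau> x)) ` range (\<lambda>p x. poly p (x 0))) {x. a x = 0}
        (\<lambda>x. f (shear 1 w (\<tau> x)))"
    proof (rule algebraic_on_pullback)
      have "g (\<tau> x) = 0" if "a x = 0" for x using eq[of "\<tau> x"] c that by (simp add: \<tau>)
      then show "\<tau> ` {x. a x = 0} \<subseteq> {x. g x = 0}" by blast
    qed
    then show ?thesis by (simp add: \<tau> image_image)
  qed
  then show ?thesis by blast
qed

section \<open>Surfaces finite over the plane\<close>

definition plane_fibre ::
    "((nat \<Rightarrow> 'a) \<Rightarrow> nat \<Rightarrow> 'a) \<Rightarrow> (nat \<Rightarrow> 'a) set \<Rightarrow> (nat \<Rightarrow> 'a) \<Rightarrow> (nat \<Rightarrow> 'a) set" where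
  "plane_fibre \<pi> Y x = {y \<in> Y. \<forall>i<2. \<pi> y i = x i}"

text \<open>The polynomial \<open>N\<close> in the last axiom replaces the characteristic polynomial of \<open>h\<close> over the ring of
  polynomial functions on the plane; \<open>\<nu>\<close> bounds its degree.\<close>

locale finite_over_plane =
  fixes n :: nat and Y :: "(nat \<Rightarrow> 'a::{alg_closed_field,field_gcd,field_char_0}) set"
    and \<pi> :: "(nat \<Rightarrow> 'a) \<Rightarrow> nat \<Rightarrow> 'a" and c :: nat and \<nu> :: "nat \<Rightarrow> nat"
  assumes zclosed_Y: "zclosed n Y"
    and linear_projection: "i < 2 \<Longrightarrow> polyfun {..<n} 1 (\<lambda>y. \<pi> y i)"
    and finite_fibre: "finite (plane_fibre \<pi> Y x)"
    and card_fibre_le: "card (plane_fibre \<pi> Y x) \<le> c"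
    and fibre_values:
      "polyfun {..<n} e h \<Longrightarrow> \<exists>N. polyfun {..<3} (\<nu> e) N \<and> (\<forall>x. N x = 0 \<longleftrightarrow> x 2 \<in> h ` plane_fibre \<pi> Y x)"
begin

abbreviation fibre :: "(nat \<Rightarrow> 'a) \<Rightarrow> (nat \<Rightarrow> 'a) set" where
  "fibre \<equiv> plane_fibre \<pi> Y"

lemma fibre_subset: "fibre x \<subseteq> Y"
  by (auto simp: plane_fibre_def)

lemma in_own_fibre: "y \<in> Y \<Longrightarrow> y \<in> fibre (\<pi> y)"
  by (simp add: plane_fibre_def)

lemma fibre_upd: "fibre (x(2 := t)) = fibre x"
  by (simp add: plane_fibre_def)

lemma polyfuns_projection: "a \<in> polyfuns {..<2} \<Longrightarrow> (\<lambda>y. a (\<pi> y)) \<in> polyfuns {..<n}"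
  by (rule polyfuns_subst[OF _ linear_projection]) auto

lemma projection_eq_on_fibre: "a \<in> polyfuns {..<2} \<Longrightarrow> y \<in> fibre x \<Longrightarrow> a (\<pi> y) = a x"
  by (rule polyfuns_cong) (auto simp: plane_fibre_def)

lemma fibre_polynomial:
  assumes "h \<in> polyfuns {..<n}"
  obtains q K where "\<And>k. (\<lambda>x. coeff (q x) k) \<in> polyfuns {..<2}" "\<And>x. degree (q x) \<le> K"
    "\<And>x. q x \<noteq> 0" "\<And>x t. poly (q x) t = 0 \<longleftrightarrow> t \<in> h ` fibre x"
proof -
  obtain e where "polyfun {..<n} e h" using assms by (rule polyfunsE)
  then obtain N where N: "polyfun {..<3} (\<nu> e) N" "\<forall>x. N x = 0 \<longleftrightarrow> x 2 \<in> h ` fibre x"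
    using fibre_values by blast
  have roots: "N (x(2 := t)) = 0 \<longleftrightarrow> t \<in> h ` fibre x" for x t
    using N(2) by (simp add: fibre_upd)
  have "finite (h ` fibre x)" for x using finite_fibre by (rule finite_imageI)
  then obtain q where q: "\<And>k. polyfun ({..<3} - {2}) (\<nu> e) (\<lambda>x. coeff (q x) k)"
    "\<And>x. degree (q x) \<le> \<nu> e" "\<And>x. q x \<noteq> 0" "\<And>x t. poly (q x) t = 0 \<longleftrightarrow> t \<in> h ` fibre x"
    using roots by (rule finite_values_expansion[OF N(1)]) (rule that)
  have "(\<lambda>x. coeff (q x) k) \<in> polyfuns {..<2}" for k
    by (rule polyfunsI[OF polyfun_mono[OF q(1) _ order.refl]]) auto
  then show ?thesis using that q(2-4) by blast
qed

lemma algebraic_over_base: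
  assumes "h \<in> polyfuns {..<n}"
  shows "algebraic_on ((\<lambda>a y. a (\<pi> y)) ` polyfuns {..<2}) Y h"
proof -
  obtain q K where q: "\<And>k. (\<lambda>x. coeff (q x) k) \<in> polyfuns {..<2}" "\<And>x. degree (q x) \<le> K"
    "\<And>x. q x \<noteq> 0" "\<And>x t. poly (q x) t = 0 \<longleftrightarrow> t \<in> h ` fibre x"
    using fibre_polynomial[OF assms] by metis
  have "(\<lambda>y. coeff (q (\<pi> y)) k) \<in> (\<lambda>a y. a (\<pi> y)) ` polyfuns {..<2}" for k
    by (rule image_eqI[OF _ q(1)]) simp
  then show ?thesis
    unfolding algebraic_on_def using q(2,3,4) in_own_fibre
    by (intro exI[of _ "\<lambda>y. q (\<pi> y)"] exI[of _ K]) auto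
qed

subsection \<open>Decomposition into dominant components\<close>

lemma generic_nonvanishing:
  assumes h: "h \<in> polyfuns {..<n}" and y\<^sub>0: "y\<^sub>0 \<in> Y" "h y\<^sub>0 \<noteq> 0"
  shows "\<exists>a\<in>polyfuns {..<2}. (\<exists>x. a x \<noteq> 0) \<and> (\<forall>x. a x \<noteq> 0 \<longrightarrow> (\<exists>y\<in>fibre x. h y \<noteq> 0))"
proof -
  obtain q K where q: "\<And>k. (\<lambda>x. coeff (q x) k) \<in> polyfuns {..<2}" "\<And>x. degree (q x) \<le> K"
    "\<And>x. q x \<noteq> 0" "\<And>x t. poly (q x) t = 0 \<longleftrightarrow> t \<in> h ` fibre x"
    using fibre_polynomial[OF h] by metis
  have nonzero_value: "(\<exists>y\<in>fibre x. h y \<noteq> 0) \<longleftrightarrow> (\<exists>k l. k \<noteq> l \<and> coeff (q x) k \<noteq> 0 \<and> coeff (q x) l \<noteq> 0)" for x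
    using nonzero_root_iff_two_coeffs[OF q(3), of x] q(4) by auto
  then obtain k l where kl: "k \<noteq> l" "coeff (q (\<pi> y\<^sub>0)) k \<noteq> 0" "coeff (q (\<pi> y\<^sub>0)) l \<noteq> 0"
    using in_own_fibre y\<^sub>0 by blast
  show ?thesis
  proof (intro bexI[of _ "\<lambda>x. coeff (q x) k * coeff (q x) l"] conjI allI impI)
    show "(\<lambda>x. coeff (q x) k * coeff (q x) l) \<in> polyfuns {..<2}" by (intro polyfuns_mult q)
    show "\<exists>x. coeff (q x) k * coeff (q x) l \<noteq> 0" using kl by (intro exI[of _ "\<pi> y\<^sub>0"]) simp
    show "\<exists>y\<in>fibre x. h y \<noteq> 0" if "coeff (q x) k * coeff (q x) l \<noteq> 0" for x
      unfolding nonzero_value using that kl(1) by auto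
  qed
qed

definition orthogonal :: "((nat \<Rightarrow> 'a) \<Rightarrow> 'a) set \<Rightarrow> bool" where
  "orthogonal F \<longleftrightarrow> F \<subseteq> polyfuns {..<n} \<and> (\<forall>f\<in>F. \<exists>y\<in>Y. f y \<noteq> 0) \<and>
     (\<forall>f\<in>F. \<forall>g\<in>F. f \<noteq> g \<longrightarrow> (\<forall>y\<in>Y. f y * g y = 0))"

lemma orthogonalD: "orthogonal F \<Longrightarrow> f \<in> F \<Longrightarrow> g \<in> F \<Longrightarrow> f \<noteq> g \<Longrightarrow> y \<in> Y \<Longrightarrow> f y * g y = 0"
  by (simp add: orthogonal_def)

lemma orthogonal_insert:
  assumes F: "orthogonal F" and h: "h \<in> polyfuns {..<n}" "\<exists>y\<in>Y. h y \<noteq> 0"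
    and fh: "\<And>f y. f \<in> F \<Longrightarrow> y \<in> Y \<Longrightarrow> f y * h y = 0"
  shows "orthogonal (insert h F)" "h \<notin> F"
proof -
  show "h \<notin> F" using h(2) fh[of h] by fastforce
  show "orthogonal (insert h F)"
    using F h fh unfolding orthogonal_def by (auto simp: mult.commute)
qed

text \<open>On a general fibre the members of an orthogonal family are nonzero at pairwise distinct points.\<close>

lemma orthogonal_card_le:
  assumes "orthogonal F"
  shows "finite F \<and> card F \<le> c"
proof (rule finite_if_finite_subsets_card_bdd)
  fix G assume G: "G \<subseteq> F" "finite G"
  have "\<forall>f\<in>G. \<exists>a. a \<in> polyfuns {..<2} \<and> (\<exists>x. a x \<noteq> 0) \<and> (\<forall>x. a x \<noteq> 0 \<longrightarrow> (\<exists>y\<in>fibre x. f y \<noteq> 0))"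
  proof
    fix f assume "f \<in> G"
    then obtain y where "f \<in> polyfuns {..<n}" "y \<in> Y" "f y \<noteq> 0"
      using assms G(1) unfolding orthogonal_def by blast
    then show "\<exists>a. a \<in> polyfuns {..<2} \<and> (\<exists>x. a x \<noteq> 0) \<and> (\<forall>x. a x \<noteq> 0 \<longrightarrow> (\<exists>y\<in>fibre x. f y \<noteq> 0))"
      using generic_nonvanishing unfolding Bex_def by simp
  qed
  from bchoice[OF this] obtain a
    where a: "\<forall>f\<in>G. a f \<in> polyfuns {..<2} \<and> (\<exists>x. a f x \<noteq> 0) \<and> (\<forall>x. a f x \<noteq> 0 \<longrightarrow> (\<exists>y\<in>fibre x. f y \<noteq> 0))"
    by blast
  obtain x where "\<forall>f\<in>G. a f x \<noteq> 0"
    using polyfuns_family_nonzero[of "a ` G" "{..<2}"] a G(2) by auto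
  then have "\<forall>f\<in>G. \<exists>y. y \<in> fibre x \<and> f y \<noteq> 0" using a by blast
  from bchoice[OF this] obtain y where y: "\<forall>f\<in>G. y f \<in> fibre x \<and> f (y f) \<noteq> 0" by blast
  have "inj_on y G"
  proof (rule inj_onI, rule ccontr)
    fix f g assume fg: "f \<in> G" "g \<in> G" "y f = y g" "f \<noteq> g"
    then have "y f \<in> Y" "f (y f) \<noteq> 0" "g (y f) \<noteq> 0" using y fibre_subset by auto
    then show False using orthogonalD[OF assms _ _ fg(4), of "y f"] fg(1,2) G(1) by auto
  qed
  then have "card G \<le> card (fibre x)" using y finite_fibre by (intro card_inj_on_le[of y]) auto
  then show "card G \<le> c" using card_fibre_le order.trans by blast
qed

lemma ex_maximal_orthogonal: "\<exists>F. orthogonal F \<and> (\<forall>G. orthogonal G \<longrightarrow> card G \<le> card F)"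
proof (rule ex_has_greatest_nat)
  show "orthogonal {}" by (simp add: orthogonal_def)
  show "\<forall>G. orthogonal G \<longrightarrow> card G < Suc c" using orthogonal_card_le by (auto simp: less_Suc_eq_le)
qed

definition support_closure :: "((nat \<Rightarrow> 'a) \<Rightarrow> 'a) \<Rightarrow> (nat \<Rightarrow> 'a) set" where
  "support_closure f = zclosure n {y \<in> Y. f y \<noteq> 0}"

lemma support_subset_aff: "{y \<in> Y. f y \<noteq> 0} \<subseteq> aff n"
  using zclosed_subset_aff[OF zclosed_Y] by blast

lemma support_closure_subset: "support_closure f \<subseteq> Y"
  unfolding support_closure_def by (rule zclosure_minimal[OF zclosed_Y]) blast

lemma zirred_support_closure:
  assumes F: "orthogonal F" and maximal: "\<And>G. orthogonal G \<Longrightarrow> card G \<le> card F" and f: "f \<in> F"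
  shows "zirred n (support_closure f)"
proof -
  have f_polyfun: "f \<in> polyfuns {..<n}" using F f by (auto simp: orthogonal_def)
  have "zprime n {y \<in> Y. f y \<noteq> 0}"
    unfolding zprime_def
  proof (intro conjI ballI impI)
    show "{y \<in> Y. f y \<noteq> 0} \<noteq> {}" using F f by (auto simp: orthogonal_def)
    fix g h assume g: "g \<in> polyfuns {..<n}" and h: "h \<in> polyfuns {..<n}"
      and gh: "\<forall>y\<in>{y \<in> Y. f y \<noteq> 0}. g y * h y = 0"
    show "(\<forall>y\<in>{y \<in> Y. f y \<noteq> 0}. g y = 0) \<or> (\<forall>y\<in>{y \<in> Y. f y \<noteq> 0}. h y = 0)"
    proof (rule ccontr)
      assume "\<not> ?thesis"
      then have nonzero: "\<exists>y\<in>Y. g y * f y \<noteq> 0" "\<exists>y\<in>Y. h y * f y \<noteq> 0" by auto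
      define gf hf where "gf = (\<lambda>y. g y * f y)" and "hf = (\<lambda>y. h y * f y)"
      have rest: "orthogonal (F - {f})" using F by (auto simp: orthogonal_def)
      have f_rest: "k y = 0 \<or> f y = 0" if "k \<in> F - {f}" "y \<in> Y" for k y
        using F f that by (auto simp: orthogonal_def)
      have insert_gf: "orthogonal (insert gf (F - {f}))" "gf \<notin> F - {f}"
        by (rule orthogonal_insert[OF rest];
            use g f_polyfun nonzero(1) f_rest in \<open>auto simp: gf_def intro: polyfuns_mult\<close>)+
      have insert_hf: "orthogonal (insert hf (insert gf (F - {f})))" "hf \<notin> insert gf (F - {f})"
        by (rule orthogonal_insert[OF insert_gf(1)];
            use h f_polyfun nonzero(2) f_rest gh in \<open>auto simp: gf_def hf_def intro: polyfuns_mult\<close>)+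
      have "finite F" using orthogonal_card_le[OF F] by blast
      then have "card (insert hf (insert gf (F - {f}))) = Suc (card F)"
        using insert_gf(2) insert_hf(2) f card_Suc_Diff1[of F f] by simp
      then show False using maximal[OF insert_hf(1)] by simp
    qed
  qed
  then show ?thesis
    unfolding zirred_iff_zprime support_closure_def
    using zclosed_zclosure zprime_zclosure support_subset_aff by blast
qed

lemma support_closures_cover:
  assumes F: "orthogonal F" and maximal: "\<And>G. orthogonal G \<Longrightarrow> card G \<le> card F"
  shows "Y \<subseteq> \<Union>(support_closure ` F)"
proof
  fix y assume y: "y \<in> Y"
  have F_finite: "finite F" using orthogonal_card_le[OF F] by blast
  show "y \<in> \<Union>(support_closure ` F)"
  proof (rule ccontr)
    assume no: "y \<notin> \<Union>(support_closure ` F)"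
    have "\<forall>f\<in>F. \<exists>g. g \<in> polyfuns {..<n} \<and> (\<forall>x\<in>Y. f x \<noteq> 0 \<longrightarrow> g x = 0) \<and> g y \<noteq> 0"
    proof
      fix f assume "f \<in> F"
      then have "y \<notin> support_closure f" "y \<in> aff n" using no y zclosed_subset_aff[OF zclosed_Y] by auto
      then show "\<exists>g. g \<in> polyfuns {..<n} \<and> (\<forall>x\<in>Y. f x \<noteq> 0 \<longrightarrow> g x = 0) \<and> g y \<noteq> 0"
        unfolding support_closure_def zclosure_def by auto
    qed
    from bchoice[OF this] obtain g
      where g: "\<forall>f\<in>F. g f \<in> polyfuns {..<n} \<and> (\<forall>x\<in>Y. f x \<noteq> 0 \<longrightarrow> g f x = 0) \<and> g f y \<noteq> 0"
      by blast
    define h where "h x = (\<Prod>f\<in>F. g f x)" for x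
    have h: "h \<in> polyfuns {..<n}" unfolding h_def using g by (intro polyfuns_prod) blast
    have h_nonzero: "\<exists>y\<in>Y. h y \<noteq> 0" using y g F_finite by (auto simp: h_def)
    have fh: "f x * h x = 0" if "f \<in> F" "x \<in> Y" for f x
    proof (cases "f x = 0")
      case False
      then have "g f x = 0" using bspec[OF g that(1)] that(2) by simp
      then have "h x = 0" unfolding h_def using that(1) F_finite by (intro prod_zero) auto
      then show ?thesis by simp
    qed simp
    have "orthogonal (insert h F)" by (rule orthogonal_insert[OF F h h_nonzero]) (rule fh)
    moreover have "h \<notin> F" by (rule orthogonal_insert[OF F h h_nonzero]) (rule fh)
    ultimately show False using maximal[of "insert h F"] F_finite by simp
  qed
qed

definition dominant :: "(nat \<Rightarrow> 'a) set \<Rightarrow> bool" where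
  "dominant W \<longleftrightarrow> (\<forall>a\<in>polyfuns {..<2}. (\<forall>w\<in>W. a (\<pi> w) = 0) \<longrightarrow> (\<forall>x. a x = 0))"

lemma dominant_support_closure:
  assumes f: "f \<in> polyfuns {..<n}" "y \<in> Y" "f y \<noteq> 0"
  shows "dominant (support_closure f)"
  unfolding dominant_def
proof (intro ballI impI allI, rule ccontr)
  fix a x assume a: "a \<in> polyfuns {..<2}" "\<forall>w\<in>support_closure f. a (\<pi> w) = 0" "a x \<noteq> 0"
  obtain b where b: "b \<in> polyfuns {..<2}" "\<exists>x. b x \<noteq> 0" "\<forall>x. b x \<noteq> 0 \<longrightarrow> (\<exists>y\<in>fibre x. f y \<noteq> 0)"
    using generic_nonvanishing[OF f] by (elim bexE conjE) (rule that)
  have "\<exists>z. \<forall>f\<in>{a, b}. f z \<noteq> 0"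
    by (rule polyfuns_family_nonzero) (use a b in auto)
  then obtain z where z: "a z \<noteq> 0" "b z \<noteq> 0" by auto
  then obtain y where y: "y \<in> fibre z" "f y \<noteq> 0" using b(3) by blast
  then have "y \<in> support_closure f"
    using zclosure_superset[OF support_subset_aff] fibre_subset by (auto simp: support_closure_def)
  then show False using a projection_eq_on_fibre[OF a(1) y(1)] z(1) by auto
qed

theorem dominant_decomposition:
  obtains \<W> where "finite \<W>" "card \<W> \<le> c" "Y = \<Union>\<W>" "\<And>W. W \<in> \<W> \<Longrightarrow> zirred n W \<and> dominant W"
proof -
  obtain F where F: "orthogonal F" "\<And>G. orthogonal G \<Longrightarrow> card G \<le> card F"
    using ex_maximal_orthogonal by blast
  have card_F: "finite F" "card F \<le> c" using orthogonal_card_le[OF F(1)] by auto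
  show ?thesis
  proof (rule that[of "support_closure ` F"])
    show "finite (support_closure ` F)" using card_F by simp
    show "card (support_closure ` F) \<le> c" using card_image_le[OF card_F(1)] card_F(2) by (rule order.trans)
    show "Y = \<Union>(support_closure ` F)"
      using support_closures_cover[OF F] support_closure_subset by blast
    fix W assume "W \<in> support_closure ` F"
    then obtain f where f: "f \<in> F" "W = support_closure f" by blast
    then have "f \<in> polyfuns {..<n}" "\<exists>y\<in>Y. f y \<noteq> 0" using F(1) by (auto simp: orthogonal_def)
    then show "zirred n W \<and> dominant W"
      using zirred_support_closure[OF F f(1)] dominant_support_closure f(2) by blast
  qed
qed

subsection \<open>Dimension\<close>

lemma base_separation:
  assumes "zclosed n U" "zirred n V" "U \<subset> V" "V \<subseteq> Y"
  shows "\<exists>a\<in>polyfuns {..<2}. (\<forall>u\<in>U. a (\<pi> u) = 0) \<and> (\<exists>v\<in>V. a (\<pi> v) \<noteq> 0)"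
proof -
  obtain w where w: "w \<in> V" "w \<notin> U" using assms(3) by blast
  then have "w \<in> aff n" using assms(4) zclosed_subset_aff[OF zclosed_Y] by blast
  then obtain h where h: "h \<in> polyfuns {..<n}" "\<And>u. u \<in> U \<Longrightarrow> h u = 0" "h w \<noteq> 0"
    using zclosed_separation[OF assms(1)] w(2) by metis
  have "zprime n V" using assms(2) by (simp add: zirred_iff_zprime)
  then have "\<exists>a\<in>(\<lambda>a y. a (\<pi> y)) ` polyfuns {..<2}. (\<forall>u\<in>U. a u = 0) \<and> (\<exists>v\<in>V. a v \<noteq> 0)"
  proof (rule algebraic_separation[where h = h and w = w])
    show "(\<lambda>a y. a (\<pi> y)) ` polyfuns {..<2} \<subseteq> polyfuns {..<n}" using polyfuns_projection by blast
    show "algebraic_on ((\<lambda>a y. a (\<pi> y)) ` polyfuns {..<2}) V h"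
      by (rule algebraic_on_subset[OF algebraic_over_base[OF h(1)] assms(4)])
  qed (use assms(3) h w(1) in auto)
  then show ?thesis by blast
qed

text \<open>On a curve \<open>a = 0\<close> in the plane, irreducible sets are separated by polynomials in a single linear
  form.\<close>

lemma no_chain_of_length_3:
  assumes irred: "zirred n V\<^sub>0" "zirred n V\<^sub>1" "zirred n V\<^sub>2" "zirred n V\<^sub>3"
    and chain: "V\<^sub>0 \<subset> V\<^sub>1" "V\<^sub>1 \<subset> V\<^sub>2" "V\<^sub>2 \<subset> V\<^sub>3" "V\<^sub>3 \<subseteq> Y"
  shows False
proof -
  have closed: "zclosed n V\<^sub>0" "zclosed n V\<^sub>1" "zclosed n V\<^sub>2" using irred by (simp_all add: zirred_def)
  have prime: "zprime n V\<^sub>0" "zprime n V\<^sub>1" "zprime n V\<^sub>2" using irred by (simp_all add: zirred_iff_zprime)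
  obtain a where a: "a \<in> polyfuns {..<2}" "\<forall>v\<in>V\<^sub>2. a (\<pi> v) = 0" "\<exists>v\<in>V\<^sub>3. a (\<pi> v) \<noteq> 0"
    using base_separation[OF closed(3) irred(4)] chain by blast
  then obtain v where v: "\<And>f. f \<in> polyfuns {..<2} \<Longrightarrow>
      algebraic_on (range (\<lambda>p x. poly p (x 0 - v * x 1))) {x. a x = 0} f"
    using plane_curve_algebraic by blast
  define z where "z y = \<pi> y 0 - v * \<pi> y 1" for y
  have z: "z \<in> polyfuns {..<n}"
    unfolding z_def by (rule polyfunsI[where n = 1]) (intro polyfun_diff polyfun_cmult linear_projection; simp)
  have separation: "\<exists>p. (\<forall>u\<in>U. poly p (z u) = 0) \<and> (\<exists>w\<in>V. poly p (z w) \<noteq> 0)"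
    if UV: "zclosed n U" "zirred n V" "U \<subset> V" "V \<subseteq> V\<^sub>2" for U V
  proof -
    obtain f w where f: "f \<in> polyfuns {..<2}" "\<forall>u\<in>U. f (\<pi> u) = 0" "w \<in> V" "f (\<pi> w) \<noteq> 0"
      using base_separation[OF UV(1-3)] UV(4) chain by blast
    have "algebraic_on (range (\<lambda>p y. poly p (z y))) V (\<lambda>y. f (\<pi> y))"
      using algebraic_on_pullback[OF v[OF f(1)], of \<pi> V] a(2) UV(4) by (auto simp: z_def image_image)
    moreover have "range (\<lambda>p y. poly p (z y)) \<subseteq> polyfuns {..<n}"
      using z by (auto intro!: polyfuns_poly polyfuns_const)
    ultimately have "\<exists>b\<in>range (\<lambda>p y. poly p (z y)). (\<forall>u\<in>U. b u = 0) \<and> (\<exists>w\<in>V. b w \<noteq> 0)"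
      using UV(2,3) f polyfuns_projection[OF f(1)]
      by (intro algebraic_separation[where h = "\<lambda>y. f (\<pi> y)" and w = w]) (auto simp: zirred_iff_zprime)
    then show ?thesis by blast
  qed
  obtain p where p: "\<forall>u\<in>V\<^sub>1. poly p (z u) = 0" "\<exists>w\<in>V\<^sub>2. poly p (z w) \<noteq> 0"
    using separation[OF closed(2) irred(3)] chain by blast
  obtain q where q: "\<forall>u\<in>V\<^sub>0. poly q (z u) = 0" "\<exists>w\<in>V\<^sub>1. poly q (z w) \<noteq> 0"
    using separation[OF closed(1) irred(2)] chain by blast
  have "z constant_on V\<^sub>1"
    by (rule zprime_root_constant[OF prime(2) z, of p]) (use p in auto)
  moreover obtain u where "u \<in> V\<^sub>0" using prime(1) by (auto simp: zprime_def)
  ultimately show False using q chain(1) unfolding constant_on_def by (metis psubsetD)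
qed

theorem zdim_le_2: "zdim n Y \<le> 2"
proof -
  have "zdim n Y \<le> enat 2"
  proof (rule zdim_le)
    fix V :: "nat \<Rightarrow> (nat \<Rightarrow> 'a) set"
    assume irred: "\<And>i. i \<le> Suc 2 \<Longrightarrow> zirred n (V i) \<and> V i \<subseteq> Y" and chain: "\<And>i. i \<le> 2 \<Longrightarrow> V i \<subset> V (Suc i)"
    show False
      by (rule no_chain_of_length_3[of "V 0" "V 1" "V 2" "V 3"])
        (use irred[of 0] irred[of 1] irred[of 2] irred[of 3] chain[of 0] chain[of 1] chain[of 2] in
          \<open>simp_all add: numeral_eq_Suc One_nat_def\<close>)
  qed
  then show ?thesis by (simp add: numeral_eq_enat)
qed

end

section \<open>Finite planar sets cut out in bounded degree\<close>

lemma card_Sigma_le: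
  assumes "finite A" "\<And>a. a \<in> A \<Longrightarrow> finite (B a)" "\<And>a. a \<in> A \<Longrightarrow> card (B a) \<le> k"
  shows "card (Sigma A B) \<le> card A * k"
proof -
  have "card (Sigma A B) = (\<Sum>a\<in>A. card (B a))" using assms by (intro card_SigmaI) auto
  also have "\<dots> \<le> card A * k" using sum_bounded_above[of A "\<lambda>a. card (B a)" k] assms(3) by simp
  finally show ?thesis .
qed

lemma exists_combination_nonvanishing:
  fixes f g :: "'b \<Rightarrow> 'a::field_char_0"
  assumes "finite S" "\<And>y. y \<in> S \<Longrightarrow> f y \<noteq> 0 \<or> g y \<noteq> 0"
  shows "\<exists>\<alpha> \<beta>. \<forall>y\<in>S. \<alpha> * f y + \<beta> * g y \<noteq> 0"
proof -
  define V where "V = {\<lambda>y. \<alpha> * f y + \<beta> * g y | \<alpha> \<beta>. True}"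
  have V: "(\<lambda>y. \<alpha> * f y + \<beta> * g y) \<in> V" for \<alpha> \<beta> by (auto simp: V_def)
  have "\<exists>h\<in>V. \<forall>y\<in>S. h y \<noteq> 0"
  proof (rule exists_nonvanishing_on_finite)
    fix u v and k :: 'a assume "u \<in> V" "v \<in> V"
    then obtain a b c d where "u = (\<lambda>y. a * f y + b * g y)" "v = (\<lambda>y. c * f y + d * g y)"
      by (auto simp: V_def)
    then show "(\<lambda>y. u y + k * v y) \<in> V" using V[of "a + k * c" "b + k * d"] by (simp add: algebra_simps)
  next
    fix y assume "y \<in> S"
    then consider "f y \<noteq> 0" | "g y \<noteq> 0" using assms(2) by blast
    then show "\<exists>h\<in>V. h y \<noteq> 0"
      by cases (use V[of 1 0] V[of 0 1] in force)+
  qed (use V assms(1) in auto)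
  then show ?thesis by (auto simp: V_def)
qed

lemma infinite_aff: "0 < n \<Longrightarrow> infinite (aff n :: (nat \<Rightarrow> 'a::field_char_0) set)"
proof
  assume n: "0 < n" and "finite (aff n :: (nat \<Rightarrow> 'a) set)"
  then have "finite ((\<lambda>x. x 0) ` (aff n :: (nat \<Rightarrow> 'a) set))" by blast
  moreover have "(\<lambda>x. x 0) ` (aff n :: (nat \<Rightarrow> 'a) set) = UNIV"
  proof (intro equalityI subset_UNIV subsetI)
    fix t :: 'a
    show "t \<in> (\<lambda>x. x 0) ` aff n"
      using n by (intro image_eqI[of _ _ "(\<lambda>_. 0)(0 := t)"]) (auto simp: aff_def)
  qed
  ultimately show False using infinite_UNIV_char_0[where 'a='a] by simp
qed

definition plane_point :: "'a \<Rightarrow> 'a \<Rightarrow> nat \<Rightarrow> 'a::zero" where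
  "plane_point u t = (\<lambda>_. 0)(0 := u, 1 := t)"

lemma plane_point_in_aff: "plane_point u t \<in> aff 2"
  by (auto simp: plane_point_def aff_def)

lemma plane_point_upd:
  "(plane_point u s)(1 := t) = plane_point u t" "(plane_point u s)(0 := v) = plane_point v s"
  by (auto simp: plane_point_def)

lemma plane_point_eta: "x \<in> aff 2 \<Longrightarrow> x = plane_point (x 0) (x 1)"
  by (auto simp: plane_point_def aff_def fun_eq_iff)

lemma common_zeros_card_le:
  fixes f g :: "(nat \<Rightarrow> 'a::{alg_closed_field,field_gcd}) \<Rightarrow> 'a"
  assumes f: "monic_in {..<2} 1 B f" and g: "polyfun {..<2} B g"
    and coprime: "\<And>t. f (plane_point u t) = 0 \<Longrightarrow> g (plane_point u t) \<noteq> 0"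
  shows "finite {x \<in> aff 2. f x = 0 \<and> g x = 0}" "card {x \<in> aff 2. f x = 0 \<and> g x = 0} \<le> elim_degree B * B"
proof -
  obtain N where N: "polyfun ({..<2} - {1}) (elim_degree B) N" "eliminates 1 f g N"
    using monic_elimination[OF f g] by blast
  have N_point: "N (plane_point v 0) = 0 \<longleftrightarrow> (\<exists>t. f (plane_point v t) = 0 \<and> g (plane_point v t) = 0)" for v
    using N(2) by (simp add: eliminates_def plane_point_upd)
  define Z where "Z = {v. N (plane_point v 0) = 0}"
  define R where "R v = {t. f (plane_point v t) = 0}" for v
  have "N ((plane_point u 0)(0 := u)) \<noteq> 0" using coprime N_point by (auto simp: plane_point_upd)
  from polyfun_roots[OF N(1) this] have Z: "finite Z" "card Z \<le> elim_degree B"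
    unfolding Z_def plane_point_upd .
  have R: "finite (R v)" "card (R v) \<le> B" for v
    using monic_in_roots[OF f, of "plane_point v 0"] unfolding R_def plane_point_upd .
  have subset: "{x \<in> aff 2. f x = 0 \<and> g x = 0} \<subseteq> (\<lambda>(v, t). plane_point v t) ` Sigma Z R"
  proof
    fix x assume x: "x \<in> {x \<in> aff 2. f x = 0 \<and> g x = 0}"
    then have eta: "x = plane_point (x 0) (x 1)" using plane_point_eta by blast
    then have "f (plane_point (x 0) (x 1)) = 0" "g (plane_point (x 0) (x 1)) = 0" using x by auto
    then have "(x 0, x 1) \<in> Sigma Z R" using N_point by (auto simp: Z_def R_def)
    then show "x \<in> (\<lambda>(v, t). plane_point v t) ` Sigma Z R" using eta by force
  qed
  have finite: "finite (Sigma Z R)" using Z R by blast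
  then show "finite {x \<in> aff 2. f x = 0 \<and> g x = 0}" using subset finite_subset by blast
  have "card {x \<in> aff 2. f x = 0 \<and> g x = 0} \<le> card (Sigma Z R)"
    using finite subset by (rule surj_card_le)
  also have "\<dots> \<le> card Z * B" using Z R by (intro card_Sigma_le)
  also have "\<dots> \<le> elim_degree B * B" using Z by simp
  finally show "card {x \<in> aff 2. f x = 0 \<and> g x = 0} \<le> elim_degree B * B" .
qed

definition cut_out_in_degree :: "nat \<Rightarrow> (nat \<Rightarrow> 'a::comm_ring_1) set \<Rightarrow> bool" where
  "cut_out_in_degree B S \<longleftrightarrow> S \<subseteq> aff 2 \<and>
     (\<forall>x\<in>aff 2 - S. \<exists>g. polyfun {..<2} B g \<and> (\<forall>s\<in>S. g s = 0) \<and> g x \<noteq> 0)"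

lemma cut_out_on_monic_curve_card_le:
  fixes S :: "(nat \<Rightarrow> 'a::{alg_closed_field,field_gcd,field_char_0}) set"
  assumes S: "finite S" "cut_out_in_degree B S" and f: "monic_in {..<2} 1 B f" "\<And>s. s \<in> S \<Longrightarrow> f s = 0"
  shows "card S \<le> elim_degree B * B"
proof -
  define V where "V = {g. polyfun {..<2} B g \<and> (\<forall>s\<in>S. g s = 0)}"
  obtain u where u: "u \<notin> (\<lambda>s. s 0) ` S"
    using S(1) ex_new_if_finite[OF infinite_UNIV_char_0] by blast
  have "\<exists>g\<in>V. \<forall>y\<in>plane_point u ` {t. f (plane_point u t) = 0}. g y \<noteq> 0"
  proof (rule exists_nonvanishing_on_finite)
    show "(\<lambda>x. g x + k * h x) \<in> V" if "g \<in> V" "h \<in> V" for g h k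
      using that by (auto simp: V_def intro!: polyfun.add polyfun_cmult)
    have "(\<lambda>_. 0) \<in> V" by (simp add: V_def polyfun.const)
    then show "V \<noteq> {}" by blast
    show "finite (plane_point u ` {t. f (plane_point u t) = 0})"
      using monic_in_roots(1)[OF f(1), of "plane_point u 0"] by (simp add: plane_point_upd)
    fix y assume "y \<in> plane_point u ` {t. f (plane_point u t) = 0}"
    then have "y \<in> aff 2" "y 0 = u" using plane_point_in_aff by (auto simp: plane_point_def)
    then have "y \<in> aff 2 - S" using u by auto
    then show "\<exists>g\<in>V. g y \<noteq> 0" using S(2) by (auto simp: V_def cut_out_in_degree_def)
  qed
  then obtain g where g: "polyfun {..<2} B g" "\<forall>s\<in>S. g s = 0"
    "\<And>t. f (plane_point u t) = 0 \<Longrightarrow> g (plane_point u t) \<noteq> 0"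
    by (auto simp: V_def)
  have "S \<subseteq> {x \<in> aff 2. f x = 0 \<and> g x = 0}" using S(2) f(2) g(2) by (auto simp: cut_out_in_degree_def)
  then have "card S \<le> card {x \<in> aff 2. f x = 0 \<and> g x = 0}"
    using common_zeros_card_le(1)[OF f(1) g(1,3)] by (intro card_mono)
  also have "\<dots> \<le> elim_degree B * B" by (rule common_zeros_card_le(2)[OF f(1) g(1,3)])
  finally show ?thesis .
qed

lemma cut_out_card_le:
  fixes S :: "(nat \<Rightarrow> 'a::{alg_closed_field,field_gcd,field_char_0}) set"
  assumes S: "finite S" "cut_out_in_degree B S"
  shows "card S \<le> elim_degree B * B"
proof -
  obtain x where "x \<in> aff 2 - S"
    using infinite_aff[of 2, where 'a='a] S(1)
    by (metis Diff_eq_empty_iff all_not_in_conv finite_subset zero_less_numeral)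
  then obtain g where g: "polyfun {..<2} B g" "\<forall>s\<in>S. g s = 0" "g x \<noteq> 0"
    using S(2) unfolding cut_out_in_degree_def by blast
  obtain a c f where a: "a 1 = 0" "\<And>j. j \<notin> {..<2} \<Longrightarrow> a j = 0" and c: "c \<noteq> 0"
    and f: "monic_in {..<2} 1 B f" "\<And>x. g (shear 1 a x) = c * f x"
    by (rule polyfun_shear_monic[OF g(1,3), of 1]) auto
  define \<tau> where "\<tau> = shear 1 (\<lambda>j. - a j)"
  have \<tau>: "shear 1 a (\<tau> x) = x" "\<tau> (shear 1 a x) = x" for x
    unfolding \<tau>_def using shear_inverse[of a 1] a(1) by auto
  have aff: "shear 1 a x \<in> aff 2" "\<tau> x \<in> aff 2" if "x \<in> aff 2" for x
    unfolding \<tau>_def using that a(2) by (auto intro!: shear_in_aff)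
  have "cut_out_in_degree B (\<tau> ` S)"
    unfolding cut_out_in_degree_def
  proof (intro conjI ballI)
    show "\<tau> ` S \<subseteq> aff 2" using S(2) aff by (auto simp: cut_out_in_degree_def)
    fix x assume x: "x \<in> aff 2 - \<tau> ` S"
    then have "shear 1 a x \<in> aff 2 - S" using aff(1) \<tau>(2) by (metis Diff_iff image_eqI)
    then obtain h where h: "polyfun {..<2} B h" "\<forall>s\<in>S. h s = 0" "h (shear 1 a x) \<noteq> 0"
      using S(2) unfolding cut_out_in_degree_def by blast
    then show "\<exists>g. polyfun {..<2} B g \<and> (\<forall>s\<in>\<tau> ` S. g s = 0) \<and> g x \<noteq> 0"
      using polyfun_shear[OF h(1), of 1 a] by (intro exI[of _ "\<lambda>x. h (shear 1 a x)"]) (simp add: \<tau>)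
  qed
  moreover have "f s = 0" if "s \<in> \<tau> ` S" for s
    using that f(2)[of s] g(2) c by (auto simp: \<tau>)
  ultimately have "card (\<tau> ` S) \<le> elim_degree B * B"
    using S(1) f(1) by (intro cut_out_on_monic_curve_card_le[of _ B f]) auto
  moreover have "inj \<tau>" by (metis \<tau>(1) injI)
  ultimately show ?thesis by (simp add: card_image inj_on_subset)
qed

section \<open>The degree of a surface finite over the plane\<close>

lemma prime_factor_in_prime_ideal:
  fixes h :: "'r::factorial_semiring"
  assumes h: "h \<noteq> 0" "K h" and K: "\<not> K 1" "\<And>p q. K (p * q) \<Longrightarrow> K p \<or> K q" "\<And>p q. K p \<Longrightarrow> p dvd q \<Longrightarrow> K q"
  obtains p where "prime_elem p" "p dvd h" "K p"
proof -
  obtain A where A: "\<forall>x. x \<in># A \<longrightarrow> prime_elem x" "normalize (\<Prod>\<^sub># A) = normalize h"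
    using prime_factorization_exists[OF h(1)] by blast
  have "\<exists>p. p \<in># A \<and> K p" if "K (\<Prod>\<^sub># A)" for A
    using that K(1,2) by (induction A) auto
  then obtain p where p: "p \<in># A" "K p" using K(3)[OF h(2)] associatedD2[OF A(2)] by blast
  have "p dvd h" using dvd_prod_mset[OF p(1)] associatedD1[OF A(2)] by (rule dvd_trans)
  then show ?thesis using that p A(1) by blast
qed

abbreviation plane_model :: "'a poly poly \<Rightarrow> (nat \<Rightarrow> 'a) \<Rightarrow> 'a::comm_ring_1" where
  "plane_model \<equiv> adjoin 1 (adjoin 0 (\<lambda>c _. c))"

abbreviation space_model :: "'a poly poly poly \<Rightarrow> (nat \<Rightarrow> 'a) \<Rightarrow> 'a::comm_ring_1" where
  "space_model \<equiv> adjoin 2 plane_model"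

lemma polyfun_model_plane: "polyfun_model {..<2} (plane_model :: _ \<Rightarrow> _ \<Rightarrow> 'a::field_char_0)"
proof -
  have "polyfun_model (insert 1 (insert 0 {})) (plane_model :: _ \<Rightarrow> _ \<Rightarrow> 'a)"
    by (intro polyfun_model_adjoin polyfun_model_const) auto
  moreover have "insert 1 (insert 0 {}) = {..<2 :: nat}" by auto
  ultimately show ?thesis by simp
qed

lemma polyfun_model_space: "polyfun_model {..<3} (space_model :: _ \<Rightarrow> _ \<Rightarrow> 'a::field_char_0)"
proof -
  have "polyfun_model (insert 2 {..<2}) (space_model :: _ \<Rightarrow> _ \<Rightarrow> 'a)"
    by (rule polyfun_model_adjoin[OF polyfun_model_plane]) simp
  moreover have "insert 2 {..<2} = {..<3 :: nat}" by auto
  ultimately show ?thesis by simp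
qed

context finite_over_plane
begin

definition image_ideal :: "(nat \<Rightarrow> 'a) set \<Rightarrow> ((nat \<Rightarrow> 'a) \<Rightarrow> 'a) \<Rightarrow> ((nat \<Rightarrow> 'a) \<Rightarrow> 'a) set" where
  "image_ideal W l = {F \<in> polyfuns {..<3}. \<forall>w\<in>W. F ((\<pi> w)(2 := l w)) = 0}"

lemma polyfuns_image_map:
  assumes "F \<in> polyfuns {..<3}" "polyfun {..<n} 1 l"
  shows "(\<lambda>w. F ((\<pi> w)(2 := l w))) \<in> polyfuns {..<n}"
proof (rule polyfuns_subst[OF assms(1)])
  show "polyfun {..<n} 1 (\<lambda>w. ((\<pi> w)(2 := l w)) i)" if "i \<in> {..<3}" for i
    using linear_projection[of i] assms(2) that by (cases "i = 2") simp_all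
qed

lemma image_ideal_prime:
  assumes "zprime n W" "polyfun {..<n} 1 l" "F \<in> polyfuns {..<3}" "G \<in> polyfuns {..<3}"
    and "(\<lambda>x. F x * G x) \<in> image_ideal W l"
  shows "F \<in> image_ideal W l \<or> G \<in> image_ideal W l"
  using zprimeD[OF assms(1) polyfuns_image_map[OF assms(3,2)] polyfuns_image_map[OF assms(4,2)]] assms(3-5)
  by (auto simp: image_ideal_def)

lemma bounded_degree_in_image_ideal:
  assumes "W \<subseteq> Y" "polyfun {..<n} 1 l"
  obtains H where "polyfun {..<3} (\<nu> 1) H" "H \<in> image_ideal W l" "\<exists>x. H x \<noteq> 0"
proof -
  obtain H where H: "polyfun {..<3} (\<nu> 1) H" "\<forall>x. H x = 0 \<longleftrightarrow> x 2 \<in> l ` fibre x"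
    using fibre_values[OF assms(2)] by blast
  have "H ((\<pi> w)(2 := l w)) = 0" if "w \<in> W" for w
    using H(2) in_own_fibre that assms(1) by (auto simp: fibre_upd)
  then have "H \<in> image_ideal W l" using H(1) by (auto simp: image_ideal_def intro: polyfunsI)
  moreover obtain t where "t \<notin> l ` fibre (\<lambda>_. 0)"
    using ex_new_if_finite[OF infinite_UNIV_char_0 finite_imageI[OF finite_fibre]] by blast
  then have "H ((\<lambda>_. 0)(2 := t)) \<noteq> 0" using H(2) by (simp add: fibre_upd)
  ultimately show ?thesis using that H(1) by blast
qed

lemma image_ideal_prime_member:
  assumes W: "zprime n W" "W \<subseteq> Y" and l: "polyfun {..<n} 1 l"
  obtains p where "prime_elem p" "polyfun {..<3} (\<nu> 1) (space_model p)" "space_model p \<in> image_ideal W l"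
proof -
  interpret space: polyfun_model "{..<3}" "space_model :: 'a poly poly poly \<Rightarrow> _" by (rule polyfun_model_space)
  obtain H where H: "polyfun {..<3} (\<nu> 1) H" "H \<in> image_ideal W l" "\<exists>x. H x \<noteq> 0"
    using bounded_degree_in_image_ideal[OF W(2) l] by blast
  obtain h where h: "space_model h = H" using polyfunsI[OF H(1)] by (rule space.obtain_preimage)
  define K where "K p \<longleftrightarrow> space_model p \<in> image_ideal W l" for p
  obtain p where p: "prime_elem p" "p dvd h" "K p"
  proof (rule prime_factor_in_prime_ideal[of h K])
    show "h \<noteq> 0" using H(3) h by auto
    show "K h" using H(2) by (simp add: K_def h)
    show "\<not> K 1" using W(1) by (auto simp: K_def image_ideal_def zprime_def)
    show "K q" if "K p" "p dvd q" for p q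
      using that space.in_polyfuns by (auto simp: K_def image_ideal_def space.eval.hom_mult elim: dvdE)
    show "K p \<or> K q" if "K (p * q)" for p q
      unfolding K_def by (rule image_ideal_prime[OF W(1) l space.in_polyfuns space.in_polyfuns])
        (use that in \<open>simp add: K_def space.eval.hom_mult[abs_def]\<close>)
  qed
  obtain q where q: "h = p * q" using p(2) by (rule dvdE)
  have "H = (\<lambda>x. space_model p x * space_model q x)" by (auto simp: h[symmetric] q space.eval.hom_mult)
  then have pq: "polyfun {..<3} (\<nu> 1) (\<lambda>x. space_model p x * space_model q x)" using H(1) by simp
  obtain i where i: "polyfun {..<3} i (space_model p)" using space.in_polyfuns by (rule polyfunsE)
  obtain j where j: "polyfun {..<3} j (space_model q)" using space.in_polyfuns by (rule polyfunsE)
  obtain y where "space_model q y \<noteq> 0" using H(3) h q by (auto simp: space.eval.hom_mult)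
  then have "polyfun {..<3} (\<nu> 1) (space_model p)" by (rule polyfun_factor_degree[OF pq i j])
  then show ?thesis using that p(1,3) by (simp add: K_def)
qed

text \<open>The image of a dominant component in affine 3-space is a hypersurface: the resultant of a prime
  member \<open>p\<close> of its ideal with a member not divisible by \<open>p\<close> would be a nonzero polynomial function on
  the plane vanishing on the component.\<close>

lemma image_ideal_prime_dvd:
  assumes W: "dominant W" and p: "prime_elem p" "space_model p \<in> image_ideal W l"
    and g: "space_model g \<in> image_ideal W l"
  shows "p dvd g"
proof (rule ccontr)
  assume no: "\<not> p dvd g"
  obtain r where r: "r \<in> polyfuns {..<2}" "\<exists>x. r x \<noteq> 0"
    "\<forall>x. space_model p x = 0 \<longrightarrow> space_model g x = 0 \<longrightarrow> r x = 0"
    using coprime_elimination[OF polyfun_model_plane prime_elem_imp_irreducible[OF p(1)] no, of 2]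
    by (elim bexE conjE) (rule that)
  have "r (\<pi> w) = 0" if "w \<in> W" for w
  proof -
    have "r ((\<pi> w)(2 := l w)) = 0" using r(3) p(2) g that by (auto simp: image_ideal_def)
    moreover have "r ((\<pi> w)(2 := l w)) = r (\<pi> w)" by (rule polyfuns_cong[OF r(1)]) auto
    ultimately show ?thesis by simp
  qed
  then show False using W r(1,2) unfolding dominant_def by blast
qed

lemma image_ideal_principal:
  assumes W: "zprime n W" "W \<subseteq> Y" "dominant W" and l: "polyfun {..<n} 1 l"
  obtains F where "polyfun {..<3} (\<nu> 1) F" "F \<in> image_ideal W l"
    "\<And>G. G \<in> image_ideal W l \<Longrightarrow> \<exists>H. G = (\<lambda>x. F x * H x)"
proof -
  interpret space: polyfun_model "{..<3}" "space_model :: 'a poly poly poly \<Rightarrow> _" by (rule polyfun_model_space)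
  obtain p where p: "prime_elem p" "polyfun {..<3} (\<nu> 1) (space_model p)" "space_model p \<in> image_ideal W l"
    using image_ideal_prime_member[OF W(1,2) l] by blast
  have "\<exists>H. G = (\<lambda>x. space_model p x * H x)" if G: "G \<in> image_ideal W l" for G
  proof -
    obtain g where g: "space_model g = G" using G by (auto simp: image_ideal_def elim: space.obtain_preimage)
    then have "p dvd g" using image_ideal_prime_dvd[OF W(3) p(1,3)] G by blast
    then obtain s where "g = p * s" by (rule dvdE)
    then show ?thesis by (intro exI[of _ "space_model s"]) (auto simp: g[symmetric] space.eval.hom_mult)
  qed
  then show ?thesis using that p by blast
qed

lemma image_ideal_separation:
  assumes W: "zclosed n W" "W \<subseteq> Y" and l: "polyfun {..<n} 1 l" and x: "x 2 \<notin> l ` (W \<inter> fibre x)"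
  shows "\<exists>G\<in>image_ideal W l. G x \<noteq> 0"
proof -
  have "fibre x - W \<subseteq> aff n" using fibre_subset zclosed_subset_aff[OF zclosed_Y] by blast
  then obtain f where f: "f \<in> polyfuns {..<n}" "\<forall>w\<in>W. f w = 0" "\<forall>y\<in>fibre x - W. f y \<noteq> 0"
    using zclosed_separation_finite[OF W(1), of "fibre x - W"] finite_fibre by blast
  have "f y \<noteq> 0 \<or> l y - x 2 \<noteq> 0" if "y \<in> fibre x" for y
  proof (cases "y \<in> W")
    case True
    then have "l y \<in> l ` (W \<inter> fibre x)" using that by blast
    then show ?thesis using x by auto
  qed (use f(3) that in blast)
  then have "\<exists>\<alpha> \<beta>. \<forall>y\<in>fibre x. \<alpha> * f y + \<beta> * (l y - x 2) \<noteq> 0"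
    by (rule exists_combination_nonvanishing[OF finite_fibre])
  then obtain \<alpha> \<beta> where nonzero: "\<forall>y\<in>fibre x. \<alpha> * f y + \<beta> * (l y - x 2) \<noteq> 0" by blast
  define h where "h y = \<alpha> * f y + \<beta> * l y" for y
  have "h \<in> polyfuns {..<n}"
    unfolding h_def by (intro polyfuns_add polyfuns_mult polyfuns_const f(1) polyfunsI[OF l])
  then obtain e where "polyfun {..<n} e h" by (rule polyfunsE)
  then obtain N where N: "polyfun {..<3} (\<nu> e) N" "\<forall>x. N x = 0 \<longleftrightarrow> x 2 \<in> h ` fibre x"
    using fibre_values by blast
  define G where "G x = N (x(2 := \<beta> * x 2))" for x
  have G_zero: "G x = 0 \<longleftrightarrow> \<beta> * x 2 \<in> h ` fibre x" for x using N(2) by (simp add: G_def fibre_upd)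
  have "G \<in> polyfuns {..<3}"
    unfolding G_def
  proof (rule polyfuns_subst[OF polyfunsI[OF N(1)]])
    show "polyfun {..<3} 1 (\<lambda>x. (x(2 := \<beta> * x 2)) i)" if "i \<in> {..<3}" for i
      using that by (cases "i = 2") (auto intro!: polyfun_cmult polyfun_var)
  qed
  moreover have "G ((\<pi> w)(2 := l w)) = 0" if "w \<in> W" for w
    using that W(2) f(2) in_own_fibre by (auto simp: G_zero fibre_upd h_def intro!: image_eqI[of _ _ w])
  ultimately have "G \<in> image_ideal W l" by (simp add: image_ideal_def)
  moreover have "G x \<noteq> 0" using nonzero by (auto simp: G_zero h_def algebra_simps)
  ultimately show ?thesis by blast
qed

lemma component_values:
  assumes W: "zirred n W" "W \<subseteq> Y" "dominant W" and l: "polyfun {..<n} 1 l"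
  shows "\<exists>F. polyfun {..<3} (\<nu> 1) F \<and> (\<forall>x. F x = 0 \<longleftrightarrow> x 2 \<in> l ` (W \<inter> fibre x))"
proof -
  have closed: "zclosed n W" and prime: "zprime n W" using W(1) by (simp_all add: zirred_iff_zprime)
  obtain F where F: "polyfun {..<3} (\<nu> 1) F" "F \<in> image_ideal W l"
    "\<And>G. G \<in> image_ideal W l \<Longrightarrow> \<exists>H. G = (\<lambda>x. F x * H x)"
    using image_ideal_principal[OF prime W(2,3) l] by blast
  have "x 2 \<in> l ` (W \<inter> fibre x)" if "F x = 0" for x
  proof (rule ccontr)
    assume "x 2 \<notin> l ` (W \<inter> fibre x)"
    then obtain G where "G \<in> image_ideal W l" "G x \<noteq> 0"
      using image_ideal_separation[OF closed W(2) l] by blast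
    then show False using F(3)[of G] that by auto
  qed
  moreover have "F x = 0" if "w \<in> W \<inter> fibre x" "x 2 = l w" for x w
  proof -
    have "F x = F ((\<pi> w)(2 := l w))"
      using that by (intro polyfun_cong[OF F(1)]) (auto simp: plane_fibre_def)
    then show ?thesis using F(2) that by (simp add: image_ideal_def)
  qed
  ultimately show ?thesis using F(1) by (intro exI[of _ F]) auto
qed

definition base_point :: "(nat \<Rightarrow> 'a) \<Rightarrow> nat \<Rightarrow> 'a" where
  "base_point w = plane_point (\<pi> w 0) (\<pi> w 1)"

lemma in_fibre_base_point: "w \<in> Y \<Longrightarrow> w \<in> fibre (base_point w)"
  by (auto simp: plane_fibre_def base_point_def plane_point_def less_2_cases_iff One_nat_def)

lemma base_point_eq: "x \<in> aff 2 \<Longrightarrow> w \<in> fibre x \<Longrightarrow> base_point w = x"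
  using plane_point_eta[of x] by (simp add: base_point_def plane_fibre_def)

lemma base_points_of_section_cut_out:
  assumes W: "zirred n W" "W \<subseteq> Y" "dominant W" and m: "polyfun {..<n} 1 m\<^sub>1" "polyfun {..<n} 1 m\<^sub>2"
  shows "cut_out_in_degree (\<nu> 1) (base_point ` {w \<in> W. m\<^sub>1 w = 0 \<and> m\<^sub>2 w = 0})" (is "_ (_ ` ?S)")
  unfolding cut_out_in_degree_def
proof (intro conjI ballI)
  show "base_point ` ?S \<subseteq> aff 2" using plane_point_in_aff by (auto simp: base_point_def)
  fix x assume x: "x \<in> aff 2 - base_point ` ?S"
  have "\<exists>\<alpha> \<beta>. \<forall>w\<in>W \<inter> fibre x. \<alpha> * m\<^sub>1 w + \<beta> * m\<^sub>2 w \<noteq> 0"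
  proof (rule exists_combination_nonvanishing)
    show "finite (W \<inter> fibre x)" using finite_fibre by blast
    show "m\<^sub>1 w \<noteq> 0 \<or> m\<^sub>2 w \<noteq> 0" if "w \<in> W \<inter> fibre x" for w
      using x base_point_eq that by auto
  qed
  then obtain \<alpha> \<beta> where nonzero: "\<forall>w\<in>W \<inter> fibre x. \<alpha> * m\<^sub>1 w + \<beta> * m\<^sub>2 w \<noteq> 0" by blast
  have "polyfun {..<n} 1 (\<lambda>w. \<alpha> * m\<^sub>1 w + \<beta> * m\<^sub>2 w)" by (intro polyfun.add polyfun_cmult m)
  from component_values[OF W this] obtain F where F: "polyfun {..<3} (\<nu> 1) F"
    "\<And>x. F x = 0 \<longleftrightarrow> x 2 \<in> (\<lambda>w. \<alpha> * m\<^sub>1 w + \<beta> * m\<^sub>2 w) ` (W \<inter> fibre x)"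
    by blast
  have "polyfun {..<2} (\<nu> 1) (\<lambda>y. F (y(2 := 0)))"
  proof (rule polyfun_subst_linear[OF F(1)])
    show "polyfun {..<2} 1 (\<lambda>y. (y(2 := 0)) i)" if "i \<in> {..<3}" for i
      using that by (cases "i = 2") (auto intro: polyfun.const polyfun_var)
  qed
  moreover have "F ((base_point s)(2 := 0)) = 0" if "s \<in> ?S" for s
    using that in_fibre_base_point W(2) by (auto simp: F(2) fibre_upd intro!: image_eqI[of _ _ s])
  moreover have "F (x(2 := 0)) \<noteq> 0" using nonzero by (auto simp: F(2) fibre_upd)
  ultimately show "\<exists>g. polyfun {..<2} (\<nu> 1) g \<and> (\<forall>s\<in>base_point ` ?S. g s = 0) \<and> g x \<noteq> 0" by blast
qed

lemma finite_section_card_le: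
  assumes W: "zirred n W" "W \<subseteq> Y" "dominant W"
    and m: "polyfun {..<n} 1 m\<^sub>1" "polyfun {..<n} 1 m\<^sub>2"
    and fin: "finite {w \<in> W. m\<^sub>1 w = 0 \<and> m\<^sub>2 w = 0}"
  shows "card {w \<in> W. m\<^sub>1 w = 0 \<and> m\<^sub>2 w = 0} \<le> elim_degree (\<nu> 1) * \<nu> 1 * c" (is "card ?S \<le> _")
proof -
  have card_image: "card (base_point ` ?S) \<le> elim_degree (\<nu> 1) * \<nu> 1"
    using base_points_of_section_cut_out[OF W m] fin by (intro cut_out_card_le) auto
  have "?S \<subseteq> snd ` Sigma (base_point ` ?S) fibre" using in_fibre_base_point W(2) by force
  then have "card ?S \<le> card (Sigma (base_point ` ?S) fibre)"
    using fin finite_fibre by (intro surj_card_le finite_SigmaI) auto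
  also have "\<dots> \<le> card (base_point ` ?S) * c"
    using fin finite_fibre card_fibre_le by (intro card_Sigma_le) auto
  also have "\<dots> \<le> elim_degree (\<nu> 1) * \<nu> 1 * c" using card_image by (intro mult_right_mono) auto
  finally show ?thesis .
qed

lemma zdeg_irr_le:
  assumes W: "zirred n W" "W \<subseteq> Y" "dominant W"
  shows "zdeg_irr n W \<le> elim_degree (\<nu> 1) * \<nu> 1 * c"
proof -
  define k where "k = the_enat (zdim n W)"
  have "zdim n W \<le> 2" using zdim_mono[OF W(2)] zdim_le_2 by (rule order.trans)
  then have k: "k \<le> 2" unfolding k_def by (cases "zdim n W") (auto simp: numeral_eq_enat)
  have section_card: "card (W \<inter> L) \<le> elim_degree (\<nu> 1) * \<nu> 1 * c"
    if L: "L = {x \<in> aff n. \<forall>j<k. (\<Sum>i<n. a j i * x i) = b j}" "finite (W \<inter> L)" for L a b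
  proof -
    define m where "m j x = (if j < k then (\<Sum>i<n. a j i * x i) - b j else 0)" for j x
    have m: "polyfun {..<n} 1 (m j)" for j
    proof (cases "j < k")
      case True
      have "polyfun {..<n} 1 (\<lambda>x. (\<Sum>i<n. a j i * x i) - b j)"
        by (intro polyfun_diff polyfun_sum polyfun_cmult polyfun_var polyfun.const) auto
      then show ?thesis using True by (simp add: m_def[abs_def])
    qed (simp add: m_def[abs_def] polyfun.const)
    have "(\<forall>j<k. (\<Sum>i<n. a j i * x i) = b j) \<longleftrightarrow> (\<forall>j<2. m j x = 0)" for x
      using k by (auto simp: m_def)
    then have "W \<inter> L = {w \<in> W. m 0 w = 0 \<and> m 1 w = 0}"
      using W(2) zclosed_subset_aff[OF zclosed_Y] unfolding L(1)
      by (auto simp: less_2_cases_iff One_nat_def)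
    then show ?thesis using finite_section_card_le[OF W m m] L(2) by simp
  qed
  define X where "X = {card (W \<inter> L) | L. \<exists>a b.
      L = {x \<in> aff n. \<forall>j<k. (\<Sum>i<n. a j i * x i) = b j} \<and> finite (W \<inter> L)}"
  have "Sup X \<le> elim_degree (\<nu> 1) * \<nu> 1 * c"
  proof (cases "X = {}")
    case False
    then show ?thesis using section_card by (intro cSup_least) (auto simp: X_def)
  qed simp
  then show ?thesis by (simp add: zdeg_irr_def X_def k_def)
qed

theorem zdeg_le: "zdeg n Y \<le> c * (elim_degree (\<nu> 1) * \<nu> 1 * c)"
proof -
  obtain \<W> where \<W>: "finite \<W>" "card \<W> \<le> c" "Y = \<Union>\<W>" "\<And>W. W \<in> \<W> \<Longrightarrow> zirred n W \<and> dominant W"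
    using dominant_decomposition by blast
  have "zcomponents n Y \<subseteq> \<W>"
  proof
    fix V assume V: "V \<in> zcomponents n Y"
    then have "zirred n V" "V \<subseteq> \<Union>\<W>" by (auto simp: zcomponents_def \<W>(3))
    moreover have "zclosed n W" if "W \<in> \<W>" for W using \<W>(4)[OF that] by (simp add: zirred_def)
    ultimately obtain W where W: "W \<in> \<W>" "V \<subseteq> W" using zirred_subset_Union[OF _ _ \<W>(1)] by blast
    then have "W = V" using V \<W>(3,4) unfolding zcomponents_def by blast
    then show "V \<in> \<W>" using W(1) by simp
  qed
  then have "zdeg n Y \<le> (\<Sum>W\<in>\<W>. zdeg_irr n W)"
    unfolding zdeg_def using \<W>(1) by (intro sum_mono2) auto
  also have "\<dots> \<le> card \<W> * (elim_degree (\<nu> 1) * \<nu> 1 * c)"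
    using sum_bounded_above[of \<W> "zdeg_irr n"] zdeg_irr_le \<W>(3,4) by (simp add: Union_upper)
  also have "\<dots> \<le> c * (elim_degree (\<nu> 1) * \<nu> 1 * c)" using \<W>(2) by (intro mult_right_mono) auto
  finally show ?thesis .
qed

end

section \<open>Differential calculus of polynomial functions\<close>

definition mono_pdiff :: "nat \<Rightarrow> (nat \<Rightarrow>\<^sub>0 nat) \<Rightarrow> (nat \<Rightarrow> 'a::comm_semiring_1) \<Rightarrow> 'a" where
  "mono_pdiff i m x = of_nat (Poly_Mapping.lookup m i) * (\<Prod>j\<in>Poly_Mapping.keys m.
     x j ^ (if j = i then Poly_Mapping.lookup m j - 1 else Poly_Mapping.lookup m j))"

lemma peval_pdiff_eq_sum_mono_pdiff:
  "peval_pdiff i p x = (\<Sum>m\<in>Poly_Mapping.keys p. Poly_Mapping.lookup p m * mono_pdiff i m x)"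
  by (simp add: peval_pdiff_def mono_pdiff_def mult.assoc)

lemma mono_pdiff_remove:
  assumes "i \<in> Poly_Mapping.keys m"
  shows "mono_pdiff i m x = of_nat (Poly_Mapping.lookup m i) * x i ^ (Poly_Mapping.lookup m i - 1) *
    (\<Prod>j\<in>Poly_Mapping.keys m - {i}. x j ^ Poly_Mapping.lookup m j)"
proof -
  have "(\<Prod>j\<in>Poly_Mapping.keys m - {i}.
      x j ^ (if j = i then Poly_Mapping.lookup m j - 1 else Poly_Mapping.lookup m j)) =
    (\<Prod>j\<in>Poly_Mapping.keys m - {i}. x j ^ Poly_Mapping.lookup m j)"
    by (rule prod.cong) auto
  then show ?thesis by (simp add: mono_pdiff_def prod.remove[OF finite_keys assms] mult.assoc)
qed

lemma has_field_derivative_mono_eval: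
  fixes \<theta> :: "'a::real_normed_field \<Rightarrow> nat \<Rightarrow> 'a"
  assumes I: "finite I" "Poly_Mapping.keys m \<subseteq> I"
    and \<theta>: "\<And>i. i \<in> I \<Longrightarrow> ((\<lambda>s. \<theta> s i) has_field_derivative \<theta>' i) (at t)"
  shows "((\<lambda>s. mono_eval m (\<theta> s)) has_field_derivative (\<Sum>i\<in>I. mono_pdiff i m (\<theta> t) * \<theta>' i)) (at t)"
proof -
  let ?d = "\<lambda>i. of_nat (Poly_Mapping.lookup m i) * \<theta> t i ^ (Poly_Mapping.lookup m i - 1) * \<theta>' i"
  have "((\<lambda>s. mono_eval m (\<theta> s)) has_field_derivative
      (\<Sum>i\<in>Poly_Mapping.keys m. ?d i * (\<Prod>j\<in>Poly_Mapping.keys m - {i}. \<theta> t j ^ Poly_Mapping.lookup m j))) (at t)"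
    unfolding mono_eval_def
  proof (rule has_field_derivative_prod)
    fix i assume "i \<in> Poly_Mapping.keys m"
    then have "((\<lambda>s. \<theta> s i) has_field_derivative \<theta>' i) (at t)" using I(2) by (intro \<theta>) blast
    then show "((\<lambda>s. \<theta> s i ^ Poly_Mapping.lookup m i) has_field_derivative ?d i) (at t)"
      by (auto intro!: derivative_eq_intros simp: One_nat_def)
  qed
  also have "(\<Sum>i\<in>Poly_Mapping.keys m. ?d i * (\<Prod>j\<in>Poly_Mapping.keys m - {i}. \<theta> t j ^ Poly_Mapping.lookup m j)) =
      (\<Sum>i\<in>Poly_Mapping.keys m. mono_pdiff i m (\<theta> t) * \<theta>' i)"
    by (intro sum.cong) (simp_all add: mono_pdiff_remove mult_ac)
  also have "\<dots> = (\<Sum>i\<in>I. mono_pdiff i m (\<theta> t) * \<theta>' i)"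
    using I by (intro sum.mono_neutral_left) (auto simp: mono_pdiff_def in_keys_iff)
  finally show ?thesis .
qed

lemma has_field_derivative_peval:
  fixes \<theta> :: "'a::real_normed_field \<Rightarrow> nat \<Rightarrow> 'a"
  assumes "finite I" "vars p \<subseteq> I"
    and \<theta>: "\<And>i. i \<in> I \<Longrightarrow> ((\<lambda>s. \<theta> s i) has_field_derivative \<theta>' i) (at t)"
  shows "((\<lambda>s. peval p (\<theta> s)) has_field_derivative (\<Sum>i\<in>I. peval_pdiff i p (\<theta> t) * \<theta>' i)) (at t)"
proof -
  have "((\<lambda>s. \<Sum>m\<in>Poly_Mapping.keys p. Poly_Mapping.lookup p m * mono_eval m (\<theta> s)) has_field_derivative
    (\<Sum>m\<in>Poly_Mapping.keys p. Poly_Mapping.lookup p m * (\<Sum>i\<in>I. mono_pdiff i m (\<theta> t) * \<theta>' i))) (at t)"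
    by (intro DERIV_sum DERIV_cmult has_field_derivative_mono_eval[OF assms(1) _ \<theta>])
      (use assms(2) in \<open>auto simp: vars_def\<close>)
  moreover have "(\<Sum>m\<in>Poly_Mapping.keys p. Poly_Mapping.lookup p m * (\<Sum>i\<in>I. mono_pdiff i m (\<theta> t) * \<theta>' i)) =
    (\<Sum>i\<in>I. peval_pdiff i p (\<theta> t) * \<theta>' i)"
    unfolding peval_pdiff_eq_sum_mono_pdiff sum_distrib_left sum_distrib_right
    by (subst sum.swap) (simp add: mult.assoc)
  ultimately show ?thesis unfolding peval_def mono_eval_def[symmetric] by simp
qed

lemma peval_pdiff_tangent:
  fixes \<theta> :: "'a::real_normed_field \<Rightarrow> nat \<Rightarrow> 'a"
  assumes p: "finite I" "vars p \<subseteq> I"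
    and \<theta>: "\<And>i. i \<in> I \<Longrightarrow> ((\<lambda>s. \<theta> s i) has_field_derivative \<theta>' i) (at t)"
    and zero: "\<forall>\<^sub>F s in nhds t. peval p (\<theta> s) = 0"
  shows "(\<Sum>i\<in>I. peval_pdiff i p (\<theta> t) * \<theta>' i) = 0"
proof (rule DERIV_unique)
  show "((\<lambda>s. peval p (\<theta> s)) has_field_derivative (\<Sum>i\<in>I. peval_pdiff i p (\<theta> t) * \<theta>' i)) (at t)"
    by (rule has_field_derivative_peval[OF p \<theta>])
  show "((\<lambda>s. peval p (\<theta> s)) has_field_derivative 0) (at t)"
    by (subst DERIV_cong_ev[OF refl zero refl]) simp
qed

lemma peval_pdiff_in_polyfuns:
  assumes "vars p \<subseteq> I"
  shows "peval_pdiff i p \<in> polyfuns I"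
proof -
  have "(\<lambda>x. x j) \<in> polyfuns I" if "m \<in> Poly_Mapping.keys p" "j \<in> Poly_Mapping.keys m" for m j
    using assms that by (intro polyfunsI[OF polyfun.var]) (auto simp: vars_def)
  then show ?thesis
    unfolding peval_pdiff_def[abs_def]
    by (intro polyfuns_sum polyfuns_mult polyfuns_const polyfuns_prod polyfuns_power)
qed

subsection \<open>Continuity and difference quotients\<close>

lemma polyfun_continuous_on:
  fixes f :: "(nat \<Rightarrow> 'a::real_normed_field) \<Rightarrow> 'a"
  assumes "polyfun I n f"
  shows "continuous_on S f"
  using assms
  by (induction rule: polyfun.induct)
    (auto intro!: continuous_intros continuous_on_product_then_coordinatewise[OF continuous_on_id])

lemma continuous_on_fun_upd:
  fixes \<theta> :: "'b::topological_space \<Rightarrow> 'i \<Rightarrow> 'a::topological_space"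
  assumes "continuous_on S \<theta>" "continuous_on S a"
  shows "continuous_on S (\<lambda>s. (\<theta> s)(i := a s))"
proof (rule continuous_on_coordinatewise_then_product)
  show "continuous_on S (\<lambda>s. ((\<theta> s)(i := a s)) j)" for j
    using assms continuous_on_product_then_coordinatewise[OF assms(1), of j] by (cases "j = i") auto
qed

definition difference_quotients ::
    "nat set \<Rightarrow> ((nat \<Rightarrow> 'a::real_normed_field) \<Rightarrow> 'a) \<Rightarrow> (nat \<Rightarrow> (nat \<Rightarrow> 'a) \<times> (nat \<Rightarrow> 'a) \<Rightarrow> 'a) \<Rightarrow> bool" where
  "difference_quotients I f g \<longleftrightarrow> (\<forall>i. continuous_on UNIV (g i)) \<and>
     (\<forall>x y. f x - f y = (\<Sum>i\<in>I. g i (x, y) * (x i - y i)))"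

lemma difference_quotients_add:
  assumes "difference_quotients I f f'" "difference_quotients I g g'"
  shows "difference_quotients I (\<lambda>x. f x + g x) (\<lambda>i z. f' i z + g' i z)"
proof -
  have "f x + g x - (f y + g y) = (\<Sum>i\<in>I. (f' i (x, y) + g' i (x, y)) * (x i - y i))" for x y
  proof -
    have "f x + g x - (f y + g y) = (f x - f y) + (g x - g y)" by simp
    also have "\<dots> = (\<Sum>i\<in>I. (f' i (x, y) + g' i (x, y)) * (x i - y i))"
      using assms by (simp add: difference_quotients_def distrib_right sum.distrib)
    finally show ?thesis .
  qed
  then show ?thesis using assms by (simp add: difference_quotients_def continuous_on_add)
qed

lemma difference_quotients_mult:
  assumes f: "difference_quotients I f f'" "continuous_on UNIV f"
    and g: "difference_quotients I g g'" "continuous_on UNIV g"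
  shows "difference_quotients I (\<lambda>x. f x * g x) (\<lambda>i z. f (fst z) * g' i z + f' i z * g (snd z))"
  unfolding difference_quotients_def
proof (intro conjI allI)
  have "continuous_on UNIV (\<lambda>z. f (fst z))" "continuous_on UNIV (\<lambda>z. g (snd z))"
    by (intro continuous_on_compose2[OF f(2)] continuous_on_compose2[OF g(2)]
        continuous_on_fst continuous_on_snd continuous_on_id; simp)+
  then show "continuous_on UNIV (\<lambda>z. f (fst z) * g' i z + f' i z * g (snd z))" for i
    using f(1) g(1) by (auto simp: difference_quotients_def intro!: continuous_on_add continuous_on_mult)
  fix x y
  have differences: "f x - f y = (\<Sum>i\<in>I. f' i (x, y) * (x i - y i))"
    "g x - g y = (\<Sum>i\<in>I. g' i (x, y) * (x i - y i))"
    using f(1) g(1) by (simp_all add: difference_quotients_def)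
  have "f x * g x - f y * g y = f x * (g x - g y) + (f x - f y) * g y" by (simp add: algebra_simps)
  also have "\<dots> = (\<Sum>i\<in>I. (f (fst (x, y)) * g' i (x, y) + f' i (x, y) * g (snd (x, y))) * (x i - y i))"
    unfolding differences sum_distrib_left sum_distrib_right sum.distrib[symmetric]
    by (intro sum.cong) (auto simp: algebra_simps)
  finally show "f x * g x - f y * g y =
    (\<Sum>i\<in>I. (f (fst (x, y)) * g' i (x, y) + f' i (x, y) * g (snd (x, y))) * (x i - y i))" .
qed

lemma polyfun_difference_quotients:
  fixes f :: "(nat \<Rightarrow> 'a::real_normed_field) \<Rightarrow> 'a"
  assumes "polyfun I n f" "finite I"
  shows "\<exists>g. difference_quotients I f g"
  using assms(1)
proof (induction rule: polyfun.induct)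
  case (const n c)
  then show ?case by (intro exI[of _ "\<lambda>_ _. 0"]) (simp add: difference_quotients_def)
next
  case (var j n)
  have "(\<Sum>i\<in>I. (if i = j then 1 else 0) * (x i - y i)) = x j - y j" for x y :: "nat \<Rightarrow> 'a"
    using var assms(2) by (simp add: if_distrib[where f = "\<lambda>a. a * _"] cong: if_cong)
  then show ?case
    by (intro exI[of _ "\<lambda>i _. if i = j then 1 else 0"]) (simp add: difference_quotients_def)
next
  case (add n f g)
  then show ?case using difference_quotients_add by blast
next
  case (mult n f m g)
  then show ?case using difference_quotients_mult polyfun_continuous_on by blast
qed

lemma difference_quotients_diagonal:
  fixes p :: "'a::real_normed_field mpoly"
  assumes g: "difference_quotients I (peval p) g" and I: "finite I" "vars p \<subseteq> I" and i: "i \<in> I"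
  shows "g i (x, x) = peval_pdiff i p x"
proof -
  have diff: "peval p (x(i := s)) - peval p (x(i := x i)) = g i (x(i := s), x) * (s - x i)" for s
  proof -
    have "peval p (x(i := s)) - peval p x = (\<Sum>k\<in>I. g k (x(i := s), x) * ((x(i := s)) k - x k))"
      using g unfolding difference_quotients_def by blast
    also have "\<dots> = (\<Sum>k\<in>{i}. g k (x(i := s), x) * ((x(i := s)) k - x k))"
      using I(1) i by (intro sum.mono_neutral_right) auto
    finally show ?thesis by simp
  qed
  have "continuous_on UNIV (g i)" using g by (simp add: difference_quotients_def)
  moreover have "continuous_on UNIV (\<lambda>s. (x(i := s), x))"
    by (intro continuous_on_Pair continuous_on_fun_upd continuous_on_const continuous_on_id)
  ultimately have "continuous_on UNIV (\<lambda>s. g i (x(i := s), x))"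
    by (rule continuous_on_compose2) simp
  then have "isCont (\<lambda>s. g i (x(i := s), x)) (x i)" by (simp add: continuous_on_eq_continuous_at)
  then have "((\<lambda>s. peval p (x(i := s))) has_field_derivative g i (x, x)) (at (x i))"
    unfolding CARAT_DERIV using diff by (intro exI[of _ "\<lambda>s. g i (x(i := s), x)"]) simp
  moreover have "((\<lambda>s. peval p (x(i := s))) has_field_derivative
      (\<Sum>k\<in>I. peval_pdiff k p (x(i := x i)) * (if k = i then 1 else 0))) (at (x i))"
    by (rule has_field_derivative_peval[OF I]) (auto intro: derivative_eq_intros)
  ultimately have "g i (x, x) = (\<Sum>k\<in>I. peval_pdiff k p (x(i := x i)) * (if k = i then 1 else 0))"
    by (rule DERIV_unique)
  also have "(\<Sum>k\<in>I. peval_pdiff k p (x(i := x i)) * (if k = i then 1 else 0)) = peval_pdiff i p x"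
    using I(1) i by (simp add: if_distrib[where f = "\<lambda>a. _ * a"] cong: if_cong)
  finally show ?thesis .
qed

subsection \<open>Lipschitz continuity on compact sets\<close>

lemma lipschitz_on_compact_mult:
  fixes f g :: "'b::metric_space \<Rightarrow> 'a::real_normed_algebra"
  assumes X: "compact X" and f: "L-lipschitz_on X f" and g: "M-lipschitz_on X g"
  shows "\<exists>K. K-lipschitz_on X (\<lambda>x. f x * g x)"
proof -
  have "bounded (f ` X)" "bounded (g ` X)"
    using X f g by (auto intro!: compact_imp_bounded compact_continuous_image lipschitz_on_continuous_on)
  then obtain F G where F: "F > 0" "\<And>x. x \<in> X \<Longrightarrow> norm (f x) \<le> F" and G: "G > 0" "\<And>x. x \<in> X \<Longrightarrow> norm (g x) \<le> G"
    by (auto simp: bounded_pos)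
  have L: "L \<ge> 0" and M: "M \<ge> 0" using f g by (auto simp: lipschitz_on_def)
  have "(F * M + L * G)-lipschitz_on X (\<lambda>x. f x * g x)"
  proof (rule lipschitz_onI)
    show "0 \<le> F * M + L * G" using F(1) G(1) L M by simp
    fix x y assume xy: "x \<in> X" "y \<in> X"
    have "dist (f x * g x) (f y * g y) = norm (f x * (g x - g y) + (f x - f y) * g y)"
      by (simp add: dist_norm algebra_simps)
    also have "\<dots> \<le> norm (f x) * dist (g x) (g y) + dist (f x) (f y) * norm (g y)"
      unfolding dist_norm by (intro order.trans[OF norm_triangle_ineq] add_mono norm_mult_ineq)
    also have "\<dots> \<le> F * (M * dist x y) + (L * dist x y) * G"
      using xy F G L by (intro add_mono mult_mono lipschitz_onD[OF f] lipschitz_onD[OF g]) auto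
    finally show "dist (f x * g x) (f y * g y) \<le> (F * M + L * G) * dist x y"
      by (simp add: algebra_simps)
  qed
  then show ?thesis by blast
qed

lemma lipschitz_on_compact_inverse:
  fixes f :: "'b::metric_space \<Rightarrow> 'a::real_normed_field"
  assumes X: "compact X" and f: "L-lipschitz_on X f" and nonzero: "\<And>x. x \<in> X \<Longrightarrow> f x \<noteq> 0"
  shows "\<exists>K. K-lipschitz_on X (\<lambda>x. inverse (f x))"
proof -
  have "continuous_on X (\<lambda>x. inverse (f x))"
    using lipschitz_on_continuous_on[OF f] nonzero by (intro continuous_on_inverse) auto
  then have "bounded ((\<lambda>x. inverse (f x)) ` X)"
    using X by (intro compact_imp_bounded compact_continuous_image)
  then obtain B where B: "B > 0" "\<And>x. x \<in> X \<Longrightarrow> norm (inverse (f x)) \<le> B" by (auto simp: bounded_pos)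
  have L: "L \<ge> 0" using f by (simp add: lipschitz_on_def)
  have "(B * L * B)-lipschitz_on X (\<lambda>x. inverse (f x))"
  proof (rule lipschitz_onI)
    show "0 \<le> B * L * B" using B(1) L by simp
    fix x y assume xy: "x \<in> X" "y \<in> X"
    have "inverse (f x) - inverse (f y) = inverse (f x) * (f y - f x) * inverse (f y)"
      using nonzero xy by (simp add: field_simps)
    then have "dist (inverse (f x)) (inverse (f y)) =
        norm (inverse (f x)) * dist (f x) (f y) * norm (inverse (f y))"
      by (simp add: dist_norm norm_mult norm_minus_commute)
    also have "\<dots> \<le> B * (L * dist x y) * B"
      using xy B L by (intro mult_mono lipschitz_onD[OF f]) auto
    finally show "dist (inverse (f x)) (inverse (f y)) \<le> B * L * B * dist x y" by (simp add: mult_ac)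
  qed
  then show ?thesis by blast
qed

lemma lipschitz_on_compact_divide:
  fixes f g :: "'b::metric_space \<Rightarrow> 'a::real_normed_field"
  assumes X: "compact X" and f: "L-lipschitz_on X f" and g: "M-lipschitz_on X g" "\<And>x. x \<in> X \<Longrightarrow> g x \<noteq> 0"
  shows "\<exists>K. K-lipschitz_on X (\<lambda>x. f x / g x)"
proof -
  obtain K where "K-lipschitz_on X (\<lambda>x. inverse (g x))" using lipschitz_on_compact_inverse[OF X g] by blast
  with X f show ?thesis unfolding divide_inverse by (rule lipschitz_on_compact_mult)
qed

lemma lipschitz_on_polyfun:
  fixes f :: "(nat \<Rightarrow> 'a::real_normed_field) \<Rightarrow> 'a" and \<theta> :: "'b::metric_space \<Rightarrow> nat \<Rightarrow> 'a"
  assumes X: "compact X" and f: "polyfun I n f" and \<theta>: "\<And>i. i \<in> I \<Longrightarrow> \<exists>L. L-lipschitz_on X (\<lambda>s. \<theta> s i)"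
  shows "\<exists>L. L-lipschitz_on X (\<lambda>s. f (\<theta> s))"
  using f
proof (induction rule: polyfun.induct)
  case (const n c)
  then show ?case by (blast intro: lipschitz_on_constant)
next
  case (var i n)
  then show ?case by (rule \<theta>)
next
  case (add n f g)
  then obtain L M where "L-lipschitz_on X (\<lambda>s. f (\<theta> s))" "M-lipschitz_on X (\<lambda>s. g (\<theta> s))" by blast
  then have "(L + M)-lipschitz_on X (\<lambda>s. f (\<theta> s) + g (\<theta> s))" by (rule lipschitz_on_add)
  then show ?case by blast
next
  case (mult n f m g)
  then show ?case using lipschitz_on_compact_mult[OF X] by blast
qed

section \<open>Local uniqueness of complex curves\<close>

lemma implicit_function_continuous:
  fixes F :: "'a::euclidean_space \<Rightarrow> 'b::euclidean_space \<Rightarrow> 'b"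
  assumes U: "open U" "(a, b) \<in> U" and F: "continuous_on U (\<lambda>(z, w). F z w)"
    and inj: "\<And>z w w'. (z, w) \<in> U \<Longrightarrow> (z, w') \<in> U \<Longrightarrow> F z w = F z w' \<Longrightarrow> w = w'"
  obtains r u where "r > 0" "u a = b" "continuous_on (ball a r) u"
    "\<And>z. z \<in> ball a r \<Longrightarrow> (z, u z) \<in> U \<and> F z (u z) = F a b"
proof -
  define \<Phi> where "\<Phi> = (\<lambda>(z, w). (z, F z w))"
  have \<Phi>: "continuous_on U \<Phi>"
    unfolding \<Phi>_def case_prod_unfold using F by (intro continuous_intros) (simp add: case_prod_unfold)
  have "inj_on \<Phi> U" using inj by (auto simp: inj_on_def \<Phi>_def)
  with \<Phi> U(1) have "open (\<Phi> ` U)" by (rule invariance_of_domain)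
  obtain G where G: "homeomorphism U (\<Phi> ` U) \<Phi> G"
    using invariance_of_domain_homeomorphism[OF U(1) \<Phi> _ \<open>inj_on \<Phi> U\<close>] by auto
  have "(a, F a b) \<in> \<Phi> ` U" using U(2) by (force simp: \<Phi>_def)
  then obtain r where r: "r > 0" "ball (a, F a b) r \<subseteq> \<Phi> ` U"
    using \<open>open (\<Phi> ` U)\<close> openE by blast
  have in_image: "(z, F a b) \<in> \<Phi> ` U" if "z \<in> ball a r" for z
    using that by (intro subsetD[OF r(2)]) (simp add: dist_Pair_Pair)
  define u where "u z = snd (G (z, F a b))" for z
  have u: "G (z, F a b) = (z, u z)" "(z, u z) \<in> U" "F z (u z) = F a b" if "z \<in> ball a r" for z
  proof -
    have "G (z, F a b) \<in> U" "\<Phi> (G (z, F a b)) = (z, F a b)"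
      using G in_image[OF that] by (auto simp: homeomorphism_def)
    then show "G (z, F a b) = (z, u z)" "(z, u z) \<in> U" "F z (u z) = F a b"
      by (auto simp: u_def \<Phi>_def split: prod.splits)
  qed
  have "continuous_on (\<Phi> ` U) G" using G by (simp add: homeomorphism_def)
  moreover have "continuous_on (ball a r) (\<lambda>z. (z, F a b))" by (intro continuous_intros)
  ultimately have "continuous_on (ball a r) (\<lambda>z. G (z, F a b))"
    by (rule continuous_on_compose2) (use in_image in blast)
  then have "continuous_on (ball a r) u" unfolding u_def by (rule continuous_on_snd)
  moreover have "u a = b"
  proof -
    have a: "a \<in> ball a r" using r(1) by simp
    show ?thesis using inj[OF U(2) u(2)[OF a]] u(3)[OF a] by simp
  qed
  ultimately show ?thesis using r(1) u by (intro that[of r u]) auto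
qed

lemma field_differentiable_of_continuous_slope:
  fixes u :: "'a::real_normed_field \<Rightarrow> 'a"
  assumes S: "open S" "z \<in> S" and s: "continuous_on S s" "\<And>y. y \<in> S \<Longrightarrow> u y - u z = s y * (y - z)"
  shows "u field_differentiable (at z)"
proof -
  have "s \<midarrow>z\<rightarrow> s z" using S s(1) by (simp add: continuous_on_eq_continuous_at isCont_def)
  moreover have "\<forall>\<^sub>F y in at z. s y = (u y - u z) / (y - z)"
    using eventually_at_in_open[OF S] by eventually_elim (simp add: s(2))
  ultimately have "(\<lambda>y. (u y - u z) / (y - z)) \<midarrow>z\<rightarrow> s z" by (rule Lim_transform_eventually)
  then show ?thesis unfolding field_differentiable_def has_field_derivative_iff by blast
qed

lemma continuous_nonzero_on_square:
  fixes h :: "'a::topological_space \<times> 'a \<Rightarrow> 'b::{t2_space,zero}"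
  assumes "continuous_on UNIV h" "h (a, a) \<noteq> 0"
  obtains W where "open W" "a \<in> W" "\<And>x y. x \<in> W \<Longrightarrow> y \<in> W \<Longrightarrow> h (x, y) \<noteq> 0"
proof -
  have "open {x. h x \<noteq> 0}" using assms(1) by (intro open_Collect_neq continuous_intros)
  then obtain U V where UV: "open U" "open V" "a \<in> U \<inter> V" "U \<times> V \<subseteq> {x. h x \<noteq> 0}"
    using assms(2) by (elim open_prod_elim[of _ "(a, a)"]) auto
  show ?thesis by (rule that[of "U \<inter> V"]) (use UV in auto)
qed

lemma implicit_function_of_slopes:
  fixes F :: "complex \<times> complex \<Rightarrow> complex"
  assumes AB: "continuous_on UNIV A" "continuous_on UNIV B"
    and slopes: "\<And>x y. F x - F y = A (x, y) * (fst x - fst y) + B (x, y) * (snd x - snd y)"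
    and nonzero: "B ((a, b), (a, b)) \<noteq> 0"
  obtains r u where "r > 0" "u a = b" "\<And>z. z \<in> ball a r \<Longrightarrow> F (z, u z) = F (a, b)"
    "\<And>z. z \<in> ball a r \<Longrightarrow> u field_differentiable (at z)"
proof -
  have "F = (\<lambda>x. F (a, b) + A (x, (a, b)) * (fst x - a) + B (x, (a, b)) * (snd x - b))"
    using slopes[of _ "(a, b)"] by (auto simp: fun_eq_iff algebra_simps)
  moreover have "continuous_on UNIV (\<lambda>x. F (a, b) + A (x, (a, b)) * (fst x - a) + B (x, (a, b)) * (snd x - b))"
    by (intro continuous_intros continuous_on_compose2[OF AB(1)] continuous_on_compose2[OF AB(2)]) auto
  ultimately have F: "continuous_on UNIV F" by (rule ssubst[where P = "continuous_on UNIV"])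
  obtain W where W: "open W" "(a, b) \<in> W" "\<And>x y. x \<in> W \<Longrightarrow> y \<in> W \<Longrightarrow> B (x, y) \<noteq> 0"
    by (rule continuous_nonzero_on_square[OF AB(2) nonzero]) (rule that)
  obtain r u where r: "r > 0" "u a = b" "continuous_on (ball a r) u"
    and u: "\<And>z. z \<in> ball a r \<Longrightarrow> (z, u z) \<in> W \<and> F (z, u z) = F (a, b)"
  proof (rule implicit_function_continuous[of W a b "\<lambda>z w. F (z, w)"])
    show "continuous_on W (\<lambda>(z, w). F (z, w))" using continuous_on_subset[OF F subset_UNIV] by simp
    show "w = w'" if "(z, w) \<in> W" "(z, w') \<in> W" "F (z, w) = F (z, w')" for z w w'
      using slopes[of "(z, w)" "(z, w')"] W(3)[OF that(1,2)] that(3) by simp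
  qed (use W in auto)
  have "u field_differentiable (at z)" if z: "z \<in> ball a r" for z
  proof (rule field_differentiable_of_continuous_slope[OF open_ball z])
    let ?s = "\<lambda>y. - (A ((y, u y), (z, u z)) / B ((y, u y), (z, u z)))"
    show "continuous_on (ball a r) ?s"
      using u z W(3)
      by (intro continuous_on_minus continuous_on_divide continuous_on_compose2[OF AB(1)]
          continuous_on_compose2[OF AB(2)] continuous_on_Pair continuous_on_const continuous_on_id r(3)) auto
    show "u y - u z = ?s y * (y - z)" if y: "y \<in> ball a r" for y
      using slopes[of "(y, u y)" "(z, u z)"] u[OF y] u[OF z] W(3)[of "(y, u y)" "(z, u z)"]
      by (simp add: field_simps add_eq_0_iff)
  qed
  then show ?thesis using that[of r u] r u by simp
qed

lemma implicit_function_polyfun: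
  fixes q :: "nat \<Rightarrow> complex"
  assumes g: "difference_quotients {i, j} f g" and ij: "i \<noteq> j" and nonzero: "g j (q, q) \<noteq> 0"
  obtains r u where "r > 0" "u (q i) = q j" "\<And>z. z \<in> ball (q i) r \<Longrightarrow> f (q(i := z, j := u z)) = f q"
    "\<And>z. z \<in> ball (q i) r \<Longrightarrow> u field_differentiable (at z)"
proof -
  define P where "P x = q(i := fst x, j := snd x)" for x
  have P_q: "P (q i, q j) = q" by (simp add: P_def)
  have P: "continuous_on UNIV (\<lambda>x. (P (fst x), P (snd x)))"
    unfolding P_def by (intro continuous_on_Pair continuous_on_fun_upd continuous_intros)
  have g_continuous: "continuous_on UNIV (\<lambda>x. g k (P (fst x), P (snd x)))" for k
    using g by (intro continuous_on_compose2[OF _ P, of UNIV "g k"]) (auto simp: difference_quotients_def)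
  obtain r u where "r > 0" "u (q i) = q j" "\<And>z. z \<in> ball (q i) r \<Longrightarrow> f (P (z, u z)) = f (P (q i, q j))"
    "\<And>z. z \<in> ball (q i) r \<Longrightarrow> u field_differentiable (at z)"
  proof (rule implicit_function_of_slopes[OF g_continuous[of i] g_continuous[of j],
        of "\<lambda>x. f (P x)" "q i" "q j"])
    show "f (P x) - f (P y) = g i (P (fst (x, y)), P (snd (x, y))) * (fst x - fst y) +
        g j (P (fst (x, y)), P (snd (x, y))) * (snd x - snd y)" for x y
      using g ij by (simp add: difference_quotients_def P_def)
  qed (use nonzero in \<open>simp_all add: P_q\<close>)
  then show ?thesis using that[of r u] by (simp add: P_q) (simp add: P_def)
qed

text \<open>A maximum of \<open>\<bar>w\<bar>\<close> over a disc of radius \<open>\<rho> \<le> 1 / (2 C)\<close> is bounded by half of itself.\<close>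

lemma holomorphic_eq_0_of_derivative_bound:
  fixes w :: "complex \<Rightarrow> complex"
  assumes "r > 0" "w q = 0" "C \<ge> 0"
    and der: "\<And>z. z \<in> ball q r \<Longrightarrow> (w has_field_derivative w' z) (at z)"
    and bound: "\<And>z. z \<in> ball q r \<Longrightarrow> norm (w' z) \<le> C * norm (w z)"
  obtains \<rho> where "\<rho> > 0" "\<rho> < r" "\<And>z. z \<in> ball q \<rho> \<Longrightarrow> w z = 0"
proof -
  define \<rho> where "\<rho> = min (r / 2) (1 / (2 * (C + 1)))"
  have \<rho>: "\<rho> > 0" "\<rho> < r" "cball q \<rho> \<subseteq> ball q r" using assms by (auto simp: \<rho>_def)
  have "C * \<rho> \<le> C * (1 / (2 * (C + 1)))" using assms by (intro mult_left_mono) (auto simp: \<rho>_def)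
  also have "\<dots> \<le> 1 / 2" using assms by (simp add: field_simps)
  finally have C\<rho>: "C * \<rho> \<le> 1 / 2" .
  have "continuous_on (cball q \<rho>) (\<lambda>z. norm (w z))"
    by (intro continuous_on_norm continuous_at_imp_continuous_on ballI, rule DERIV_isCont, rule der)
      (use \<rho>(3) in blast)
  then obtain z\<^sub>0 where z\<^sub>0: "z\<^sub>0 \<in> cball q \<rho>" "\<forall>z\<in>cball q \<rho>. norm (w z) \<le> norm (w z\<^sub>0)"
    using continuous_attains_sup[OF compact_cball, of q \<rho> "\<lambda>z. norm (w z)"] \<rho>(1) by auto
  have "norm (w z\<^sub>0 - w q) \<le> (C * norm (w z\<^sub>0)) * norm (z\<^sub>0 - q)"
  proof (rule field_differentiable_bound[of "cball q \<rho>"])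
    show "(w has_field_derivative w' z) (at z within cball q \<rho>)" if "z \<in> cball q \<rho>" for z
      by (rule has_field_derivative_at_within, rule der) (use \<rho>(3) that in blast)
    show "norm (w' z) \<le> C * norm (w z\<^sub>0)" if "z \<in> cball q \<rho>" for z
    proof -
      have "norm (w' z) \<le> C * norm (w z)" using bound \<rho>(3) that by blast
      also have "\<dots> \<le> C * norm (w z\<^sub>0)" using z\<^sub>0 that assms by (intro mult_left_mono) auto
      finally show ?thesis .
    qed
  qed (use z\<^sub>0 \<rho> in auto)
  also have "\<dots> \<le> (C * norm (w z\<^sub>0)) * \<rho>"
    using z\<^sub>0 assms by (intro mult_left_mono) (auto simp: dist_norm norm_minus_commute)
  also have "\<dots> = (C * \<rho>) * norm (w z\<^sub>0)" by simp
  also have "\<dots> \<le> 1 / 2 * norm (w z\<^sub>0)" using C\<rho> by (intro mult_right_mono) auto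
  finally have "norm (w z\<^sub>0) = 0" using assms(2) by simp
  then have "w z = 0" if "z \<in> ball q \<rho>" for z using z\<^sub>0(2)[rule_format, of z] that by simp
  then show ?thesis using that \<rho>(1,2) by blast
qed

lemma continuous_on_UNIV_if_lipschitz_on_compact:
  fixes f :: "'a::heine_borel \<Rightarrow> 'b::metric_space"
  assumes "\<And>X. compact X \<Longrightarrow> \<exists>L. L-lipschitz_on X f"
  shows "continuous_on UNIV f"
proof (rule continuous_at_imp_continuous_on, rule ballI)
  fix x
  obtain L where "L-lipschitz_on (cball x 1) f" using assms compact_cball by blast
  then have "continuous_on (ball x 1) f"
    using lipschitz_on_continuous_on continuous_on_subset ball_subset_cball by blast
  then show "isCont f x" by (simp add: continuous_on_eq_continuous_at)
qed

lemma continuous_on_nonzero_on_cball: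
  fixes f :: "'a::metric_space \<Rightarrow> 'b::{t2_space,zero}"
  assumes f: "continuous_on (ball a r) f" "f a \<noteq> 0" and r: "r > 0"
  shows "\<exists>s. 0 < s \<and> s < r \<and> (\<forall>z\<in>cball a s. f z \<noteq> 0)"
proof -
  have "isCont f a" using f(1) r by (simp add: continuous_on_eq_continuous_at)
  then obtain d where "d > 0" "\<And>z. dist a z < d \<Longrightarrow> f z \<noteq> 0"
    using continuous_at_avoid[of a f 0] f(2) by auto
  then show ?thesis using r by (intro exI[of _ "min (d / 2) (r / 2)"]) auto
qed

lemma holomorphic_ode_unique_explicit:
  fixes S :: "complex \<times> complex \<Rightarrow> complex"
  assumes S: "L-lipschitz_on X S" and r: "r > 0" and initial: "u a = v a"
    and graphs: "\<And>z. z \<in> ball a r \<Longrightarrow> (z, u z) \<in> X \<and> (z, v z) \<in> X"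
    and u: "\<And>z. z \<in> ball a r \<Longrightarrow> (u has_field_derivative S (z, u z)) (at z)"
    and v: "\<And>z. z \<in> ball a r \<Longrightarrow> (v has_field_derivative S (z, v z)) (at z)"
  obtains \<rho> where "\<rho> > 0" "\<rho> < r" "\<And>z. z \<in> ball a \<rho> \<Longrightarrow> u z = v z"
proof -
  obtain \<rho> where "\<rho> > 0" "\<rho> < r" "\<And>z. z \<in> ball a \<rho> \<Longrightarrow> u z - v z = 0"
  proof (rule holomorphic_eq_0_of_derivative_bound[OF r])
    show "L \<ge> 0" using S by (simp add: lipschitz_on_def)
    fix z assume z: "z \<in> ball a r"
    then show "((\<lambda>z. u z - v z) has_field_derivative S (z, u z) - S (z, v z)) (at z)"
      by (intro DERIV_diff u v)
    have "dist (S (z, u z)) (S (z, v z)) \<le> L * dist (z, u z) (z, v z)"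
      using graphs[OF z] by (intro lipschitz_onD[OF S]) auto
    then show "norm (S (z, u z) - S (z, v z)) \<le> L * norm (u z - v z)"
      by (simp add: dist_Pair_Pair dist_norm)
  qed (use initial in auto)
  then show ?thesis using that by simp
qed

lemma holomorphic_ode_unique:
  fixes A B :: "complex \<times> complex \<Rightarrow> complex" and u :: "'i \<Rightarrow> complex \<Rightarrow> complex"
  assumes A: "\<And>X. compact X \<Longrightarrow> \<exists>L. L-lipschitz_on X A" and B: "\<And>X. compact X \<Longrightarrow> \<exists>L. L-lipschitz_on X B"
    and nonzero: "B (a, b) \<noteq> 0" and r: "r > 0" and initial: "\<And>k. u k a = b"
    and der: "\<And>k z. z \<in> ball a r \<Longrightarrow> (u k has_field_derivative u' k z) (at z)"
    and ode: "\<And>k z. z \<in> ball a r \<Longrightarrow> A (z, u k z) + B (z, u k z) * u' k z = 0"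
  obtains \<rho> where "\<rho> > 0" "\<rho> < r" "\<And>z. z \<in> ball a \<rho> \<Longrightarrow> u k z = u l z"
proof -
  have graph_continuous: "continuous_on (ball a r) (\<lambda>z. (z, u k z))" for k
    using der by (intro continuous_on_Pair continuous_on_id continuous_at_imp_continuous_on ballI DERIV_isCont)
  have "continuous_on (ball a r) (\<lambda>z. B (z, u k z))" for k
    using continuous_on_UNIV_if_lipschitz_on_compact[OF B]
    by (intro continuous_on_compose2[OF _ graph_continuous]) auto
  then have "\<exists>s. 0 < s \<and> s < r \<and> (\<forall>z\<in>cball a s. B (z, u k z) \<noteq> 0)" for k
    using nonzero initial r by (intro continuous_on_nonzero_on_cball) simp_all
  then obtain s where s: "\<And>k. 0 < s k" "\<And>k. s k < r" "\<And>k z. z \<in> cball a (s k) \<Longrightarrow> B (z, u k z) \<noteq> 0"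
    by metis
  define t where "t = min (s k) (s l)"
  have t: "0 < t" "t < r" "cball a t \<subseteq> cball a (s k)" "cball a t \<subseteq> cball a (s l)"
    using s(1)[of k] s(1)[of l] s(2)[of k] by (auto simp: t_def)
  define X where "X = (\<lambda>z. (z, u k z)) ` cball a t \<union> (\<lambda>z. (z, u l z)) ` cball a t"
  have X: "compact X" "\<And>x. x \<in> X \<Longrightarrow> B x \<noteq> 0"
  proof -
    have "cball a t \<subseteq> ball a r" using t(2) by auto
    then show "compact X"
      unfolding X_def
      by (intro compact_Un compact_continuous_image continuous_on_subset[OF graph_continuous]) auto
    show "B x \<noteq> 0" if "x \<in> X" for x using that s(3) t(3,4) by (auto simp: X_def)
  qed
  obtain L where "L-lipschitz_on X (\<lambda>x. A x / B x)"
    using lipschitz_on_compact_divide[OF X(1)] A[OF X(1)] B[OF X(1)] X(2) by metis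
  then have L: "L-lipschitz_on X (\<lambda>x. - (A x / B x))" by simp
  have slope: "(u m has_field_derivative - (A (z, u m z) / B (z, u m z))) (at z)"
    if "z \<in> ball a t" "m = k \<or> m = l" for m z
  proof -
    have z: "B (z, u m z) \<noteq> 0" "z \<in> ball a r" using that t(2) by (auto intro!: X(2) simp: X_def)
    then have "u' m z = - (A (z, u m z) / B (z, u m z))"
      using ode[of z m] by (simp add: field_simps add_eq_0_iff)
    then show ?thesis using der[OF z(2), of m] by simp
  qed
  obtain \<rho> where "\<rho> > 0" "\<rho> < t" "\<And>z. z \<in> ball a \<rho> \<Longrightarrow> u k z = u l z"
    by (rule holomorphic_ode_unique_explicit[OF L t(1), of "u k" a "u l"])
      (use initial slope in \<open>auto simp: X_def\<close>)
  then show ?thesis using that t(2) by (meson less_trans)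
qed

text \<open>Up to the factor 2, the Wirtinger derivative of \<open>P \<circ> iota\<close> with respect to the \<open>k\<close>-th coordinate.\<close>

definition complex_gradient :: "real mpoly \<Rightarrow> nat \<Rightarrow> (nat \<Rightarrow> complex) \<Rightarrow> complex" where
  "complex_gradient P k x = Complex (peval_pdiff (2 * k) P (iota x)) (- peval_pdiff (2 * k + 1) P (iota x))"

lemma iota_real_derivative:
  assumes "\<And>k. k < 2 \<Longrightarrow> ((\<lambda>s. \<psi> s k) has_vector_derivative v k) (at t)"
  shows "((\<lambda>s. iota (\<psi> s) i) has_real_derivative iota v i) (at t)"
  using has_field_derivative_Re[OF assms] has_field_derivative_Im[OF assms]
  by (auto simp: iota_def)

lemma iota_derivative_along_complex_line:
  assumes \<theta>: "\<And>k. k < 2 \<Longrightarrow> ((\<lambda>s. \<theta> s k) has_field_derivative \<theta>' k) (at z)"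
  shows "((\<lambda>s. iota (\<theta> (z + of_real s * h)) i) has_real_derivative iota (\<lambda>k. \<theta>' k * h) i) (at 0)"
proof (rule iota_real_derivative)
  have line: "((\<lambda>s. z + of_real s * h) has_vector_derivative h) (at 0)"
    by (auto intro!: derivative_eq_intros has_vector_derivative_real_field
        simp: has_vector_derivative_def scaleR_conv_of_real)
  show "((\<lambda>s. \<theta> (z + of_real s * h) k) has_vector_derivative \<theta>' k * h) (at 0)" if "k < 2" for k
    using field_vector_diff_chain_at[OF line, of "\<lambda>s. \<theta> s k" "\<theta>' k"] \<theta>[OF that]
    by (simp add: o_def mult.commute)
qed

lemma complex_gradient_tangent:
  assumes P: "vars P \<subseteq> {..<4}"
    and \<theta>: "\<And>k. k < 2 \<Longrightarrow> ((\<lambda>s. \<theta> s k) has_field_derivative \<theta>' k) (at z)"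
    and zero: "\<forall>\<^sub>F s in nhds z. peval P (iota (\<theta> s)) = 0"
  shows "(\<Sum>k<2. complex_gradient P k (\<theta> z) * \<theta>' k) = 0"
proof -
  have directional: "(\<Sum>i<4. peval_pdiff i P (iota (\<theta> z)) * iota (\<lambda>k. \<theta>' k * h) i) = 0" for h
  proof -
    have "isCont (\<lambda>s. z + of_real s * h) (0::real)" by (intro continuous_intros)
    then have "((\<lambda>s::real. z + of_real s * h) \<longlongrightarrow> z) (nhds 0)" by (simp add: tendsto_nhds_iff isCont_def)
    with zero have "\<forall>\<^sub>F s in nhds (0::real). peval P (iota (\<theta> (z + of_real s * h))) = 0"
      by (rule eventually_compose_filterlim)
    from peval_pdiff_tangent[OF finite_lessThan P iota_derivative_along_complex_line[OF \<theta>] this]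
    show ?thesis by simp
  qed
  have "{..<4} = {0, 1, 2, 3 :: nat}" "{..<2} = {0, 1 :: nat}" by auto
  then show ?thesis
    using directional[of 1] directional[of \<i>]
    by (simp add: complex_gradient_def iota_def complex_eq_iff algebra_simps)
qed

lemma lipschitz_on_complex_gradient:
  assumes P: "vars P \<subseteq> {..<4}" and X: "compact X"
    and \<psi>: "\<And>k. \<exists>L. L-lipschitz_on X (\<lambda>s. \<psi> s k)"
  shows "\<exists>L. L-lipschitz_on X (\<lambda>s. complex_gradient P k (\<psi> s))"
proof -
  have part: "1-lipschitz_on U Re" "1-lipschitz_on U Im" for U
    by (auto intro!: lipschitz_onI simp: dist_norm abs_Re_le_cmod abs_Im_le_cmod simp flip: minus_complex.sel)
  have part_\<psi>: "\<exists>L. L-lipschitz_on X (\<lambda>s. Re (\<psi> s k))" "\<exists>L. L-lipschitz_on X (\<lambda>s. Im (\<psi> s k))" for k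
    using \<psi>[of k] lipschitz_on_compose2[OF _ part(1)] lipschitz_on_compose2[OF _ part(2)] by blast+
  then have iota: "\<exists>L. L-lipschitz_on X (\<lambda>s. iota (\<psi> s) i)" for i
  proof (cases "i < 4")
    case True
    then have "i \<in> {0, 1, 2, 3}" by auto
    then show ?thesis using part_\<psi> by (auto simp: iota_def)
  next
    case False
    then show ?thesis using lipschitz_on_constant by (auto simp: iota_def)
  qed
  have "\<exists>L. L-lipschitz_on X (\<lambda>s. peval_pdiff i P (iota (\<psi> s)))" for i
    using peval_pdiff_in_polyfuns[OF P, of i] by (elim polyfunsE) (rule lipschitz_on_polyfun[OF X _ iota])
  then obtain L M where LM: "L-lipschitz_on X (\<lambda>s. peval_pdiff (2 * k) P (iota (\<psi> s)))"
    "M-lipschitz_on X (\<lambda>s. peval_pdiff (2 * k + 1) P (iota (\<psi> s)))"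
    by blast
  have "(L + M)-lipschitz_on X (\<lambda>s. complex_gradient P k (\<psi> s))"
  proof (rule lipschitz_onI)
    show "0 \<le> L + M" using LM by (auto simp: lipschitz_on_def)
    fix s t assume st: "s \<in> X" "t \<in> X"
    have "dist (complex_gradient P k (\<psi> s)) (complex_gradient P k (\<psi> t)) \<le>
      dist (peval_pdiff (2 * k) P (iota (\<psi> s))) (peval_pdiff (2 * k) P (iota (\<psi> t))) +
      dist (peval_pdiff (2 * k + 1) P (iota (\<psi> s))) (peval_pdiff (2 * k + 1) P (iota (\<psi> t)))"
      using cmod_le[of "complex_gradient P k (\<psi> s) - complex_gradient P k (\<psi> t)"]
      by (simp add: complex_gradient_def dist_norm)
    also have "\<dots> \<le> L * dist s t + M * dist s t"
      by (intro add_mono lipschitz_onD[OF LM(1)] lipschitz_onD[OF LM(2)] st)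
    finally show "dist (complex_gradient P k (\<psi> s)) (complex_gradient P k (\<psi> t)) \<le> (L + M) * dist s t"
      by (simp add: distrib_right)
  qed
  then show ?thesis by blast
qed

lemma regular_zero_set_is_graph:
  fixes f :: "complex mpoly"
  assumes f: "vars f \<subseteq> {i, j}" "peval f q = 0" and ij: "i \<noteq> j" and regular: "peval_pdiff j f q \<noteq> 0"
  obtains r u u' where "r > 0" "u (q i) = q j" "peval_pdiff i f q + peval_pdiff j f q * u' (q i) = 0"
    "\<And>z. z \<in> ball (q i) r \<Longrightarrow> peval f (q(i := z, j := u z)) = 0"
    "\<And>z. z \<in> ball (q i) r \<Longrightarrow> (u has_field_derivative u' z) (at z)"
proof -
  obtain g where g: "difference_quotients {i, j} (peval f) g"
    using polyfun_difference_quotients[OF polyfun_peval[OF order.refl f(1)]] by blast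
  have "g j (q, q) \<noteq> 0" using difference_quotients_diagonal[OF g _ f(1)] regular by simp
  then obtain r u where r: "r > 0" "u (q i) = q j"
    and zero: "\<And>z. z \<in> ball (q i) r \<Longrightarrow> peval f (q(i := z, j := u z)) = peval f q"
    and diff: "\<And>z. z \<in> ball (q i) r \<Longrightarrow> u field_differentiable (at z)"
    by (rule implicit_function_polyfun[OF g ij]) (rule that)
  define \<theta> where "\<theta> z = q(i := z, j := u z)" for z
  have \<theta>_q: "\<theta> (q i) = q" by (simp add: \<theta>_def r(2))
  have center: "q i \<in> ball (q i) r" using r(1) by simp
  have "((\<lambda>s. \<theta> s k) has_field_derivative
      (if k = i then 1 else if k = j then deriv u (q i) else 0)) (at (q i))" for k
    using field_differentiable_derivI[OF diff[OF center]] ij by (auto simp: \<theta>_def)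
  moreover have "\<forall>\<^sub>F z in nhds (q i). peval f (\<theta> z) = 0"
    using eventually_nhds_in_open[OF open_ball center] by eventually_elim (simp add: zero f(2) \<theta>_def)
  ultimately have "(\<Sum>k\<in>{i, j}. peval_pdiff k f (\<theta> (q i)) *
      (if k = i then 1 else if k = j then deriv u (q i) else 0)) = 0"
    by (intro peval_pdiff_tangent[OF _ f(1)]) simp_all
  then have "peval_pdiff i f q + peval_pdiff j f q * deriv u (q i) = 0" using ij by (simp add: \<theta>_q)
  then show ?thesis
    using r zero f(2) field_differentiable_derivI[OF diff] by (intro that[of r u "deriv u"]) simp_all
qed

lemma complex_gradient_along_graph:
  assumes P: "vars P \<subseteq> {..<4}" "iota ` zeros 2 {f} \<subseteq> realZ P" and q: "q \<in> aff 2" and ij: "{i, j} = {..<2}"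
    and graph: "\<And>z. z \<in> ball a r \<Longrightarrow> peval f (q(i := z, j := u z)) = 0"
    and der: "\<And>z. z \<in> ball a r \<Longrightarrow> (u has_field_derivative u' z) (at z)" and z: "z \<in> ball a r"
  shows "complex_gradient P i (q(i := z, j := u z)) + complex_gradient P j (q(i := z, j := u z)) * u' z = 0"
proof -
  have i_neq_j: "i \<noteq> j" using arg_cong[OF ij, of card] by auto
  define \<theta> where "\<theta> z = q(i := z, j := u z)" for z
  have \<theta>: "((\<lambda>s. \<theta> s k) has_field_derivative (if k = i then 1 else if k = j then u' z else 0)) (at z)" for k
    using der[OF z] i_neq_j by (auto simp: \<theta>_def)
  have "peval P (iota (\<theta> s)) = 0" if "s \<in> ball a r" for s
  proof -
    have "\<theta> s \<in> zeros 2 {f}"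
      using q ij graph[OF that] by (auto simp: zeros_def aff_def \<theta>_def set_eq_iff)
    then show ?thesis using P(2) by (auto simp: realZ_def zeros_def)
  qed
  then have "\<forall>\<^sub>F s in nhds z. peval P (iota (\<theta> s)) = 0"
    using eventually_nhds_in_open[OF open_ball z] by (auto elim: eventually_mono)
  then have "(\<Sum>k\<in>{i, j}. complex_gradient P k (\<theta> z) * (if k = i then 1 else if k = j then u' z else 0)) = 0"
    unfolding ij by (intro complex_gradient_tangent[OF P(1) \<theta>])
  then show ?thesis using i_neq_j by (simp add: \<theta>_def)
qed

lemma complex_gradient_imp_pdiff_nonzero:
  fixes f :: "complex mpoly"
  assumes P: "vars P \<subseteq> {..<4}" "iota ` zeros 2 {f} \<subseteq> realZ P" and f: "vars f \<subseteq> {..<2}"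
    and q: "q \<in> zeros 2 {f}" and ij: "{i, j} = {..<2}"
    and regular: "peval_pdiff i f q \<noteq> 0 \<or> peval_pdiff j f q \<noteq> 0" and gradient: "complex_gradient P j q \<noteq> 0"
  shows "peval_pdiff j f q \<noteq> 0"
proof
  assume vertical: "peval_pdiff j f q = 0"
  then have nonzero: "peval_pdiff i f q \<noteq> 0" using regular by simp
  have ji: "{j, i} = {..<2}" using ij by (simp add: insert_commute)
  have j_neq_i: "j \<noteq> i" using arg_cong[OF ij, of card] by auto
  have q_zero: "q \<in> aff 2" "peval f q = 0" using q by (auto simp: zeros_def)
  obtain r v v' where v: "r > 0" "v (q j) = q i" "peval_pdiff j f q + peval_pdiff i f q * v' (q j) = 0"
    and graph: "\<And>z. z \<in> ball (q j) r \<Longrightarrow> peval f (q(j := z, i := v z)) = 0"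
      "\<And>z. z \<in> ball (q j) r \<Longrightarrow> (v has_field_derivative v' z) (at z)"
    using regular_zero_set_is_graph[OF f[folded ji] q_zero(2) j_neq_i nonzero] by metis
  have center: "q j \<in> ball (q j) r" using v(1) by simp
  have "complex_gradient P j (q(j := q j, i := v (q j))) +
      complex_gradient P i (q(j := q j, i := v (q j))) * v' (q j) = 0"
    by (rule complex_gradient_along_graph[OF P q_zero(1) ji graph center])
  moreover have "v' (q j) = 0" using v(3) vertical nonzero by simp
  ultimately show False using gradient by (simp add: v(2))
qed

lemma polyfun_model_irreducible_dvd:
  fixes e :: "'r::{factorial_ring_gcd,semiring_gcd_mult_normalize} \<Rightarrow> (nat \<Rightarrow> 'a::{field_char_0,field_gcd}) \<Rightarrow> 'a"
  assumes e: "polyfun_model {j} e" and p: "irreducible p"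
    and zeros: "infinite ((\<lambda>x. x j) ` {x. adjoin i e p x = 0 \<and> adjoin i e q x = 0})"
  shows "p dvd q"
proof (rule ccontr)
  assume no: "\<not> p dvd q"
  obtain r where r: "r \<in> polyfuns {j}" "\<exists>x. r x \<noteq> 0" "\<forall>x. adjoin i e p x = 0 \<longrightarrow> adjoin i e q x = 0 \<longrightarrow> r x = 0"
    using coprime_elimination[OF e p no, of i] by (elim bexE conjE) (rule that)
  obtain n where "polyfun {j} n r" using r(1) by (rule polyfunsE)
  then obtain s where s: "\<forall>x. r x = poly s (x j)" using polyfun_single_var by blast
  then have "s \<noteq> 0" using r(2) by auto
  then have "finite {t. poly s t = 0}" by (rule poly_roots_finite)
  moreover have "(\<lambda>x. x j) ` {x. adjoin i e p x = 0 \<and> adjoin i e q x = 0} \<subseteq> {t. poly s t = 0}"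
    using r(3) s by auto
  ultimately show False using zeros finite_subset by blast
qed

lemma irreducible_zeros_eq:
  fixes f\<^sub>1 f\<^sub>2 :: "'a::{field_char_0,field_gcd} mpoly"
  assumes f: "irreducible f\<^sub>1" "irreducible f\<^sub>2" "vars f\<^sub>1 \<subseteq> {i, j}" "vars f\<^sub>2 \<subseteq> {i, j}" and ij: "i \<noteq> j"
    and zeros: "infinite ((\<lambda>x. x j) ` {x. peval f\<^sub>1 x = 0 \<and> peval f\<^sub>2 x = 0})"
  shows "peval f\<^sub>1 y = 0 \<longleftrightarrow> peval f\<^sub>2 y = 0"
proof -
  let ?e = "adjoin j (\<lambda>c (_ :: nat \<Rightarrow> 'a). c)"
  have e: "polyfun_model {j} ?e" by (rule polyfun_model_adjoin[OF polyfun_model_const]) simp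
  have E: "polyfun_model {i, j} (adjoin i ?e)" by (rule polyfun_model_adjoin[OF e]) (use ij in simp)
  interpret E: polyfun_model "{i, j}" "adjoin i ?e" by (rule E)
  have preimage: "\<exists>p. adjoin i ?e p = peval f \<and> irreducible p" if "irreducible f" "vars f \<subseteq> {i, j}" for f
  proof -
    have irred: "irreducible_polyfun {i, j} (peval f)" by (rule irreducible_polyfun_peval[OF that])
    then obtain p where "adjoin i ?e p = peval f"
      using E.obtain_preimage unfolding irreducible_polyfun_def by metis
    then show ?thesis using polyfun_model_irreducible[OF E, of p] irred by auto
  qed
  obtain p\<^sub>1 where p\<^sub>1: "adjoin i ?e p\<^sub>1 = peval f\<^sub>1" "irreducible p\<^sub>1" using preimage[OF f(1,3)] by blast
  obtain p\<^sub>2 where p\<^sub>2: "adjoin i ?e p\<^sub>2 = peval f\<^sub>2" "irreducible p\<^sub>2" using preimage[OF f(2,4)] by blast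
  have "p\<^sub>1 dvd p\<^sub>2"
    by (rule polyfun_model_irreducible_dvd[where i = i, OF e p\<^sub>1(2)]) (use zeros p\<^sub>1(1) p\<^sub>2(1) in simp)
  moreover have "p\<^sub>2 dvd p\<^sub>1"
    by (rule polyfun_model_irreducible_dvd[where i = i, OF e p\<^sub>2(2)])
      (use zeros p\<^sub>1(1) p\<^sub>2(1) in \<open>simp add: conj_commute\<close>)
  moreover have "adjoin i ?e q y = 0" if "p dvd q" "adjoin i ?e p y = 0" for p q
    using that by (auto simp: E.eval.hom_mult elim!: dvdE)
  ultimately show ?thesis using p\<^sub>1(1) p\<^sub>2(1) by metis
qed

lemma iota_inj:
  assumes "q \<in> aff 2" "q' \<in> aff 2" "iota q = iota q'"
  shows "q = q'"
proof
  fix i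
  have "iota q k = iota q' k" if "k < 4" for k using assms(3) by simp
  from this[of 0] this[of 1] this[of 2] this[of 3] have "q 0 = q' 0" "q 1 = q' 1"
    by (auto simp: iota_def complex_eq_iff)
  then show "q i = q' i" using assms(1,2) by (cases "i < 2") (auto simp: aff_def less_2_cases_iff One_nat_def)
qed

lemma lipschitz_on_complex_gradient_slice:
  assumes "vars P \<subseteq> {..<4}" "compact X"
  shows "\<exists>L. L-lipschitz_on X (\<lambda>w. complex_gradient P m (q(i := fst w, j := snd w)))"
proof (rule lipschitz_on_complex_gradient[OF assms])
  have "1-lipschitz_on X fst" "1-lipschitz_on X snd"
    by (simp_all add: lipschitz_on_def dist_fst_le dist_snd_le del: split_paired_All)
  then show "\<exists>L. L-lipschitz_on X (\<lambda>w. (q(i := fst w, j := snd w)) k)" for k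
    using lipschitz_on_constant by (cases "k = j"; cases "k = i") (auto intro: exI[of _ 1])
qed

lemma infinite_coordinates_of_graph:
  fixes q :: "'i \<Rightarrow> complex"
  assumes "i \<noteq> j" "\<rho> > 0" "\<And>z. z \<in> ball (q i) \<rho> \<Longrightarrow> q(i := z, j := u z) \<in> S"
  shows "infinite ((\<lambda>x. x i) ` S)"
proof (rule infinite_super)
  show "ball (q i) \<rho> \<subseteq> (\<lambda>x. x i) ` S"
  proof
    fix z assume "z \<in> ball (q i) \<rho>"
    then show "z \<in> (\<lambda>x. x i) ` S"
      using assms(1) by (intro image_eqI[OF _ assms(3)]) simp_all
  qed
  show "infinite (ball (q i) \<rho>)" using assms(2) uncountable_ball countable_finite by metis
qed

lemma tangent_curves_common_zeros:
  fixes f :: "'k::finite \<Rightarrow> complex mpoly"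
  assumes P: "vars P \<subseteq> {..<4}" and f: "\<And>k. iota ` zeros 2 {f k} \<subseteq> realZ P" "\<And>k. vars (f k) \<subseteq> {..<2}"
    and q: "\<And>k. q \<in> zeros 2 {f k}" and ij: "{i, j} = {..<2}"
    and regular: "\<And>k. peval_pdiff i (f k) q \<noteq> 0 \<or> peval_pdiff j (f k) q \<noteq> 0"
    and gradient: "complex_gradient P j q \<noteq> 0"
  shows "infinite ((\<lambda>x. x i) ` {x. peval (f k) x = 0 \<and> peval (f l) x = 0})"
proof -
  have i_neq_j: "i \<noteq> j" using arg_cong[OF ij, of card] by auto
  have q_aff: "q \<in> aff 2" using q by (auto simp: zeros_def)
  have "\<exists>r u u'. r > 0 \<and> u (q i) = q j \<and> (\<forall>z\<in>ball (q i) r. peval (f k) (q(i := z, j := u z)) = 0 \<and>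
      (u has_field_derivative u' z) (at z))" for k
  proof -
    have "peval_pdiff j (f k) q \<noteq> 0"
      by (rule complex_gradient_imp_pdiff_nonzero[OF P f q ij regular gradient])
    moreover have "vars (f k) \<subseteq> {i, j}" "peval (f k) q = 0" using f(2) q[of k] ij by (auto simp: zeros_def)
    ultimately obtain r u u' where "r > 0" "u (q i) = q j"
      "\<And>z. z \<in> ball (q i) r \<Longrightarrow> peval (f k) (q(i := z, j := u z)) = 0"
      "\<And>z. z \<in> ball (q i) r \<Longrightarrow> (u has_field_derivative u' z) (at z)"
      using i_neq_j by (metis regular_zero_set_is_graph)
    then show ?thesis by (intro exI[of _ r] exI[of _ u] exI[of _ u']) simp
  qed
  then obtain r u u' where u: "\<And>k. r k > 0" "\<And>k. u k (q i) = q j"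
    "\<And>k z. z \<in> ball (q i) (r k) \<Longrightarrow> peval (f k) (q(i := z, j := u k z)) = 0"
    "\<And>k z. z \<in> ball (q i) (r k) \<Longrightarrow> (u k has_field_derivative u' k z) (at z)"
    by metis
  define G where "G m w = complex_gradient P m (q(i := fst w, j := snd w))" for m and w :: "complex \<times> complex"
  have ode: "G i (z, u k z) + G j (z, u k z) * u' k z = 0" if "z \<in> ball (q i) (r k)" for k z
    using complex_gradient_along_graph[OF P f(1) q_aff ij u(3) u(4) that] by (simp add: G_def)
  define R where "R = Min (range r)"
  have R: "R > 0" "R \<le> r k" for k using u(1) by (auto simp: R_def)
  have lipschitz: "\<exists>L. L-lipschitz_on X (G m)" if "compact X" for X m
    unfolding G_def by (rule lipschitz_on_complex_gradient_slice[OF P that])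
  have nonzero: "G j (q i, q j) \<noteq> 0" using gradient by (simp add: G_def)
  have in_balls: "z \<in> ball (q i) (r k)" if "z \<in> ball (q i) R" for z k using that R(2)[of k] by auto
  obtain \<rho> where \<rho>: "\<rho> > 0" "\<rho> < R" "\<And>z. z \<in> ball (q i) \<rho> \<Longrightarrow> u k z = u l z"
    by (rule holomorphic_ode_unique[where A = "G i" and B = "G j" and a = "q i" and b = "q j" and r = R
          and u = u and u' = u' and k = k and l = l])
      (assumption | rule lipschitz nonzero R(1) u(2,4) ode in_balls that)+
  show ?thesis
  proof (rule infinite_coordinates_of_graph[OF i_neq_j \<rho>(1)])
    fix z assume z: "z \<in> ball (q i) \<rho>"
    then have "z \<in> ball (q i) (r k)" "z \<in> ball (q i) (r l)" using \<rho>(2) R(2)[of k] R(2)[of l] by auto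
    then show "q(i := z, j := u k z) \<in> {x. peval (f k) x = 0 \<and> peval (f l) x = 0}"
      using u(3)[of z k] u(3)[of z l] \<rho>(3)[OF z] by simp
  qed
qed

definition singular_zeros :: "real mpoly \<Rightarrow> (nat \<Rightarrow> real) set" where
  "singular_zeros P = {p \<in> realZ P. \<forall>i<4. peval_pdiff i P p = 0}"

lemma regular_curve_unique:
  assumes P: "vars P \<subseteq> {..<4}" and p: "p \<in> realZ P - singular_zeros P"
    and \<gamma>\<^sub>1: "p \<in> iota ` curve_reg \<gamma>\<^sub>1" "iota ` \<gamma>\<^sub>1 \<subseteq> realZ P"
    and \<gamma>\<^sub>2: "p \<in> iota ` curve_reg \<gamma>\<^sub>2" "iota ` \<gamma>\<^sub>2 \<subseteq> realZ P"
  shows "\<gamma>\<^sub>1 = \<gamma>\<^sub>2"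
proof -
  have regular: "\<exists>q f. p = iota q \<and> q \<in> zeros 2 {f} \<and> vars f \<subseteq> {..<2} \<and> irreducible f \<and> zeros 2 {f} = \<gamma> \<and>
      (peval_pdiff 0 f q \<noteq> 0 \<or> peval_pdiff 1 f q \<noteq> 0)" if "p \<in> iota ` curve_reg \<gamma>" for \<gamma>
    using that unfolding curve_reg_def by blast
  obtain q f\<^sub>1 where q: "p = iota q" "q \<in> zeros 2 {f\<^sub>1}" and f\<^sub>1: "vars f\<^sub>1 \<subseteq> {..<2}" "irreducible f\<^sub>1"
    "zeros 2 {f\<^sub>1} = \<gamma>\<^sub>1" "peval_pdiff 0 f\<^sub>1 q \<noteq> 0 \<or> peval_pdiff 1 f\<^sub>1 q \<noteq> 0"
    using regular[OF \<gamma>\<^sub>1(1)] by blast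
  obtain q' f\<^sub>2 where q': "p = iota q'" "q' \<in> zeros 2 {f\<^sub>2}" and f\<^sub>2: "vars f\<^sub>2 \<subseteq> {..<2}" "irreducible f\<^sub>2"
    "zeros 2 {f\<^sub>2} = \<gamma>\<^sub>2" "peval_pdiff 0 f\<^sub>2 q' \<noteq> 0 \<or> peval_pdiff 1 f\<^sub>2 q' \<noteq> 0"
    using regular[OF \<gamma>\<^sub>2(1)] by blast
  have q'_eq: "q' = q" using iota_inj[of q' q] q q' by (simp add: zeros_def)
  obtain i where i: "i < 4" "peval_pdiff i P p \<noteq> 0" using p unfolding singular_zeros_def by blast
  then have "i = 0 \<or> i = 1 \<or> i = 2 \<or> i = 3" by linarith
  with i(2) have "complex_gradient P 0 q \<noteq> 0 \<or> complex_gradient P 1 q \<noteq> 0"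
    by (auto simp: q(1) complex_gradient_def complex_eq_iff)
  moreover have "{..<2} = {0, 1 :: nat}" by auto
  ultimately obtain i j where ij: "{i, j} = {..<2 :: nat}" and gradient: "complex_gradient P j q \<noteq> 0"
    by (metis insert_commute)
  define f where "f k = (if k then f\<^sub>1 else f\<^sub>2)" for k
  have "infinite ((\<lambda>x. x i) ` {x. peval (f True) x = 0 \<and> peval (f False) x = 0})"
  proof (rule tangent_curves_common_zeros[OF P _ _ _ ij _ gradient])
    have "peval_pdiff i g q \<noteq> 0 \<or> peval_pdiff j g q \<noteq> 0"
      if "peval_pdiff 0 g q \<noteq> 0 \<or> peval_pdiff 1 g q \<noteq> 0" for g :: "complex mpoly"
      using that ij \<open>{..<2} = {0, 1}\<close> by (metis insert_iff singleton_iff)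
    then show "peval_pdiff i (f k) q \<noteq> 0 \<or> peval_pdiff j (f k) q \<noteq> 0" for k
      using f\<^sub>1(4) f\<^sub>2(4) q'_eq by (simp add: f_def)
  qed (use f\<^sub>1(1,3) f\<^sub>2(1,3) \<gamma>\<^sub>1(2) \<gamma>\<^sub>2(2) q(2) q'(2) q'_eq in \<open>auto simp: f_def\<close>)
  moreover have "j \<noteq> i" using arg_cong[OF ij, of card] by auto
  ultimately have "peval f\<^sub>1 y = 0 \<longleftrightarrow> peval f\<^sub>2 y = 0" for y
    using irreducible_zeros_eq[OF f\<^sub>1(2) f\<^sub>2(2), of j i y] f\<^sub>1(1) f\<^sub>2(1) ij by (simp add: f_def insert_commute)
  then show ?thesis using f\<^sub>1(3) f\<^sub>2(3) unfolding zeros_def by auto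
qed

section \<open>Enclosing the singular locus\<close>

definition linear_iso :: "nat \<Rightarrow> ((nat \<Rightarrow> 'a::comm_ring_1) \<Rightarrow> nat \<Rightarrow> 'a) \<Rightarrow> ((nat \<Rightarrow> 'a) \<Rightarrow> nat \<Rightarrow> 'a) \<Rightarrow> bool" where
  "linear_iso n \<kappa> \<kappa>' \<longleftrightarrow> (\<forall>x. \<kappa> (\<kappa>' x) = x \<and> \<kappa>' (\<kappa> x) = x) \<and> \<kappa> ` aff n \<subseteq> aff n \<and> \<kappa>' ` aff n \<subseteq> aff n \<and>
     (\<forall>i<n. polyfun {..<n} 1 (\<lambda>x. \<kappa> x i) \<and> polyfun {..<n} 1 (\<lambda>x. \<kappa>' x i))"

lemma linear_iso_shear:
  assumes a: "a i = 0" "\<And>j. j \<ge> n \<Longrightarrow> a j = 0" and i: "i < n"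
  shows "linear_iso n (shear i a) (shear i (\<lambda>j. - a j))"
  unfolding linear_iso_def
  using shear_inverse[of a i] shear_in_aff[where n = n and a = a] i a
    shear_in_aff[where n = n and a = "\<lambda>j. - a j"]
  by (auto intro!: polyfun_shear[where f = "\<lambda>x. x _"] polyfun_var)

lemma linear_iso_comp:
  assumes "linear_iso n \<kappa> \<kappa>'" "linear_iso n \<mu> \<mu>'"
  shows "linear_iso n (\<kappa> \<circ> \<mu>) (\<mu>' \<circ> \<kappa>')"
proof -
  have "polyfun {..<n} 1 (\<lambda>x. \<kappa> (\<mu> x) i)" "polyfun {..<n} 1 (\<lambda>x. \<mu>' (\<kappa>' x) i)" if "i < n" for i
    using assms that unfolding linear_iso_def
    by (auto intro: polyfun_subst_linear[of _ _ "\<lambda>x. \<kappa> x i"] polyfun_subst_linear[of _ _ "\<lambda>x. \<mu>' x i"])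
  then show ?thesis using assms unfolding linear_iso_def image_subset_iff by auto
qed

lemma zclosed_linear_iso_image:
  fixes Y :: "(nat \<Rightarrow> 'a::comm_ring_1) set"
  assumes \<kappa>: "linear_iso n \<kappa> \<kappa>'" and Y: "zclosed n Y"
  shows "zclosed n (\<kappa> ` Y)"
  unfolding zclosed_iff
proof (intro conjI ballI)
  show "\<kappa> ` Y \<subseteq> aff n" using zclosed_subset_aff[OF Y] \<kappa> by (auto simp: linear_iso_def)
  fix x assume "x \<in> aff n - \<kappa> ` Y"
  then have "\<kappa>' x \<in> aff n - Y" using \<kappa> by (auto simp: linear_iso_def image_iff)
  then obtain g where g: "g \<in> polyfuns {..<n}" "\<forall>v\<in>Y. g v = 0" "g (\<kappa>' x) \<noteq> 0"
    using Y unfolding zclosed_iff by blast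
  have "(\<lambda>x. g (\<kappa>' x)) \<in> polyfuns {..<n}"
    by (rule polyfuns_subst[OF g(1)]) (use \<kappa> in \<open>auto simp: linear_iso_def\<close>)
  then show "\<exists>g\<in>polyfuns {..<n}. (\<forall>v\<in>\<kappa> ` Y. g v = 0) \<and> g x \<noteq> 0"
    using g(2,3) \<kappa> by (intro bexI[of _ "\<lambda>x. g (\<kappa>' x)"]) (auto simp: linear_iso_def)
qed

lemma finite_over_plane_linear_iso_image:
  assumes Y: "finite_over_plane n Y \<pi> c \<nu>" and \<kappa>: "linear_iso n \<kappa> \<kappa>'"
  shows "finite_over_plane n (\<kappa> ` Y) (\<pi> \<circ> \<kappa>') c \<nu>"
proof -
  interpret finite_over_plane n Y \<pi> c \<nu> by (rule Y)
  have fibre: "plane_fibre (\<pi> \<circ> \<kappa>') (\<kappa> ` Y) x = \<kappa> ` plane_fibre \<pi> Y x" for x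
    using \<kappa> by (auto simp: plane_fibre_def linear_iso_def)
  have linear: "polyfun {..<n} e (\<lambda>x. f (\<kappa> x))" "polyfun {..<n} e (\<lambda>x. f (\<kappa>' x))"
    if "polyfun {..<n} e f" for e f
    using \<kappa> by (auto intro!: polyfun_subst_linear[OF that] simp: linear_iso_def)
  show ?thesis
  proof
    show "zclosed n (\<kappa> ` Y)" using \<kappa> zclosed_Y by (rule zclosed_linear_iso_image)
    show "polyfun {..<n} 1 (\<lambda>y. (\<pi> \<circ> \<kappa>') y i)" if "i < 2" for i
      using linear(2)[OF linear_projection[OF that]] by simp
    show "finite (plane_fibre (\<pi> \<circ> \<kappa>') (\<kappa> ` Y) x)" for x
      unfolding fibre using finite_fibre by (rule finite_imageI)
    show "card (plane_fibre (\<pi> \<circ> \<kappa>') (\<kappa> ` Y) x) \<le> c" for x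
      unfolding fibre using card_image_le[OF finite_fibre] card_fibre_le by (rule order.trans)
    show "\<exists>N. polyfun {..<3} (\<nu> e) N \<and> (\<forall>x. N x = 0 \<longleftrightarrow> x 2 \<in> h ` plane_fibre (\<pi> \<circ> \<kappa>') (\<kappa> ` Y) x)"
      if "polyfun {..<n} e h" for e h
      using fibre_values[OF linear(1)[OF that]] unfolding fibre image_image .
  qed
qed

subsection \<open>Triangular systems\<close>

definition triangular_set :: "((nat \<Rightarrow> 'a::comm_ring_1) \<Rightarrow> 'a) \<Rightarrow> ((nat \<Rightarrow> 'a) \<Rightarrow> 'a) \<Rightarrow> (nat \<Rightarrow> 'a) set" where
  "triangular_set F G = {y \<in> aff 4. F y = 0 \<and> G y = 0}"

lemma triangular_set_fibre:
  assumes F: "F \<in> polyfuns {..<4}" and G: "G \<in> polyfuns {..<3}"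
  shows "plane_fibre (\<lambda>y. y) (triangular_set F G) x =
    (\<lambda>(s, t). (plane_point (x 0) (x 1))(2 := s, 3 := t)) `
      Sigma {s. G (x(2 := s)) = 0} (\<lambda>s. {t. F (x(2 := s, 3 := t)) = 0})" (is "?fibre = ?point ` ?S")
proof (intro equalityI subsetI)
  have upto: "{..<4} = insert 3 (insert 2 {..<2 :: nat})" "{..<3} = insert 2 {..<2 :: nat}" by auto
  have F_eq: "F (x(2 := y 2, 3 := y 3)) = F y" and G_eq: "G (x(2 := y 2)) = G y" if "\<forall>i<2. y i = x i" for y
    using that by (auto intro!: polyfuns_cong[OF F[unfolded upto]] polyfuns_cong[OF G[unfolded upto]])
  {
    fix y assume y: "y \<in> ?fibre"
    then have xy: "\<forall>i<2. y i = x i" and aff: "y \<in> aff 4" by (auto simp: plane_fibre_def triangular_set_def)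
    have "y = ?point (y 2, y 3)"
      using aff xy by (auto simp: fun_eq_iff plane_point_def aff_def)
    moreover have "(y 2, y 3) \<in> ?S"
      using y F_eq[OF xy] G_eq[OF xy] by (simp add: plane_fibre_def triangular_set_def)
    ultimately show "y \<in> ?point ` ?S" by (rule image_eqI)
  next
    fix y assume "y \<in> ?point ` ?S"
    then obtain s t where st: "G (x(2 := s)) = 0" "F (x(2 := s, 3 := t)) = 0" and
      y: "y = (plane_point (x 0) (x 1))(2 := s, 3 := t)" by auto
    have "\<forall>i<2. y i = x i" "y 2 = s" "y 3 = t" "y \<in> aff 4"
      by (auto simp: y plane_point_def aff_def less_2_cases_iff One_nat_def)
    then show "y \<in> ?fibre"
      using st F_eq[of y] G_eq[of y] by (auto simp: plane_fibre_def triangular_set_def)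
  }
qed

lemma triangular_set_values:
  fixes F G h :: "(nat \<Rightarrow> 'a::{alg_closed_field,field_gcd,field_char_0}) \<Rightarrow> 'a"
  assumes F: "monic_in {..<4} 3 b F" and G: "monic_in {..<3} 2 b G" and h: "polyfun {..<4} e h"
  shows "\<exists>N. polyfun {..<3} (elim_degree (elim_degree (e + b + 1))) N \<and>
    (\<forall>x. N x = 0 \<longleftrightarrow> x 2 \<in> h ` plane_fibre (\<lambda>y. y) (triangular_set F G) x)"
proof -
  let ?E = "elim_degree (e + b + 1)"
  have FG: "F \<in> polyfuns {..<4}" "G \<in> polyfuns {..<3}"
    using monic_in_polyfuns[OF F] monic_in_polyfuns[OF G] by auto
  have "polyfun {..<5} (e + b + 1) (\<lambda>x. x 4 - h x)"
    by (intro polyfun_diff polyfun_var polyfun_mono[OF h]) auto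
  moreover have "monic_in {..<5} 3 (e + b + 1) F" by (rule monic_in_mono[OF F]) auto
  ultimately obtain N\<^sub>1 where N\<^sub>1: "polyfun ({..<5} - {3}) ?E N\<^sub>1" "eliminates 3 F (\<lambda>x. x 4 - h x) N\<^sub>1"
    using monic_elimination by blast
  have "monic_in ({..<5} - {3}) 2 ?E G"
    by (rule monic_in_mono[OF G]) (use elim_degree_ge[of "e + b + 1"] in auto)
  then obtain N\<^sub>2 where N\<^sub>2: "polyfun ({..<5} - {3} - {2}) (elim_degree ?E) N\<^sub>2" "eliminates 2 G N\<^sub>1 N\<^sub>2"
    using monic_elimination N\<^sub>1(1) by blast
  have "polyfun {..<3} (elim_degree ?E) (\<lambda>x. N\<^sub>2 (x(4 := x 2)))"
  proof (rule polyfun_subst_linear[OF N\<^sub>2(1)])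
    show "polyfun {..<3} 1 (\<lambda>x. (x(4 := x 2)) i)" if "i \<in> {..<5} - {3} - {2}" for i
      using that by (cases "i = 4") (auto intro: polyfun_var)
  qed
  moreover have "N\<^sub>2 (x(4 := x 2)) = 0 \<longleftrightarrow> x 2 \<in> h ` plane_fibre (\<lambda>y. y) (triangular_set F G) x" for x
  proof -
    have upto: "{..<4} = {0, 1, 2, 3 :: nat}" by auto
    have cong: "h (x(4 := u, 2 := s, 3 := t)) = h ((plane_point (x 0) (x 1))(2 := s, 3 := t))"
      "F (x(4 := u, 2 := s, 3 := t)) = F (x(2 := s, 3 := t))" "G (x(4 := u, 2 := s)) = G (x(2 := s))" for u s t
      by (auto intro!: polyfun_cong[OF h[unfolded upto]] polyfuns_cong[OF FG(1)] polyfuns_cong[OF FG(2)]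
          simp: plane_point_def)
    have "N\<^sub>2 (x(4 := x 2)) = 0 \<longleftrightarrow>
        (\<exists>s t. G (x(2 := s)) = 0 \<and> F (x(2 := s, 3 := t)) = 0 \<and>
          x 2 = h ((plane_point (x 0) (x 1))(2 := s, 3 := t)))"
      using N\<^sub>1(2) N\<^sub>2(2) by (simp add: eliminates_def cong)
    also have "\<dots> \<longleftrightarrow> x 2 \<in> h ` plane_fibre (\<lambda>y. y) (triangular_set F G) x"
      unfolding triangular_set_fibre[OF FG] image_image by force
    finally show ?thesis .
  qed
  ultimately show ?thesis by blast
qed

lemma triangular_set_finite_over_plane:
  fixes F G :: "(nat \<Rightarrow> 'a::{alg_closed_field,field_gcd,field_char_0}) \<Rightarrow> 'a"
  assumes F: "monic_in {..<4} 3 b F" and G: "monic_in {..<3} 2 b G"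
  shows "finite_over_plane 4 (triangular_set F G) (\<lambda>y. y) (b * b) (\<lambda>e. elim_degree (elim_degree (e + b + 1)))"
proof
  have FG: "F \<in> polyfuns {..<4}" "G \<in> polyfuns {..<3}"
    using monic_in_polyfuns[OF F] monic_in_polyfuns[OF G] by auto
  then have "zclosed 4 {y \<in> {y \<in> aff 4. F y = 0}. G y = 0}"
    using polyfuns_mono[of "{..<3}" "{..<4}"] by (intro zclosed_Int_zeros) (auto simp: zclosed_iff)
  then show "zclosed 4 (triangular_set F G)" by (simp add: triangular_set_def)
  show "polyfun {..<4} 1 (\<lambda>y. y i)" if "i < 2" for i using that by (auto intro: polyfun_var)
  let ?S = "\<lambda>x. Sigma {s. G (x(2 := s)) = 0} (\<lambda>s. {t. F (x(2 := s, 3 := t)) = 0})"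
  have S: "finite (?S x)" "card (?S x) \<le> b * b" for x
  proof -
    show "finite (?S x)" using monic_in_roots(1)[OF F] monic_in_roots(1)[OF G] by blast
    have "card (?S x) \<le> card {s. G (x(2 := s)) = 0} * b"
      using monic_in_roots[OF F] monic_in_roots(1)[OF G] by (intro card_Sigma_le)
    also have "\<dots> \<le> b * b" using monic_in_roots(2)[OF G] by (rule mult_le_mono1)
    finally show "card (?S x) \<le> b * b" .
  qed
  show "finite (plane_fibre (\<lambda>y. y) (triangular_set F G) x)" for x
    unfolding triangular_set_fibre[OF FG] using S(1) by (rule finite_imageI)
  show "card (plane_fibre (\<lambda>y. y) (triangular_set F G) x) \<le> b * b" for x
    unfolding triangular_set_fibre[OF FG] using card_image_le[OF S(1)] S(2) by (rule order.trans)
qed (rule triangular_set_values[OF F G])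

subsection \<open>The singular zeros of a real polynomial\<close>

lemma polyfun_complexify:
  fixes f :: "(nat \<Rightarrow> real) \<Rightarrow> real"
  assumes "polyfun I n f"
  shows "\<exists>F. polyfun I n F \<and> (\<forall>x. F (\<lambda>i. complex_of_real (x i)) = complex_of_real (f x))"
  using assms
proof (induction rule: polyfun.induct)
  case (const n c)
  show ?case by (intro exI[of _ "\<lambda>_. of_real c"]) (simp add: polyfun.const)
next
  case (var i n)
  then show ?case by (intro exI[of _ "\<lambda>x. x i"]) (simp add: polyfun.var)
next
  case (add n f g)
  then obtain F G where "polyfun I n F" "polyfun I n G"
    "\<forall>x. F (\<lambda>i. complex_of_real (x i)) = complex_of_real (f x)"
    "\<forall>x. G (\<lambda>i. complex_of_real (x i)) = complex_of_real (g x)" by blast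
  then show ?case by (intro exI[of _ "\<lambda>x. F x + G x"]) (simp add: polyfun.add)
next
  case (mult n f m g)
  then obtain F G where "polyfun I n F" "polyfun I m G"
    "\<forall>x. F (\<lambda>i. complex_of_real (x i)) = complex_of_real (f x)"
    "\<forall>x. G (\<lambda>i. complex_of_real (x i)) = complex_of_real (g x)" by blast
  then show ?case by (intro exI[of _ "\<lambda>x. F x * G x"]) (simp add: polyfun.mult)
qed

lemma monic_in_complexify:
  fixes f :: "(nat \<Rightarrow> real) \<Rightarrow> real"
  assumes "monic_in I i e f"
  shows "\<exists>F. monic_in I i e F \<and> (\<forall>x. F (\<lambda>i. complex_of_real (x i)) = complex_of_real (f x))"
proof -
  obtain q d where q: "d \<le> e" "\<And>k. polyfun (I - {i}) e (\<lambda>x. coeff (q x) k)"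
    "\<And>x. degree (q x) = d" "\<And>x. lead_coeff (q x) = 1" "\<And>x t. f (x(i := t)) = poly (q x) t"
    by (rule monic_inE[OF assms]) (rule that)
  have "\<forall>k. \<exists>C. polyfun (I - {i}) e C \<and> (\<forall>x. C (\<lambda>i. complex_of_real (x i)) = complex_of_real (coeff (q x) k))"
    using polyfun_complexify[OF q(2)] by blast
  from choice[OF this] obtain C where C: "\<And>k. polyfun (I - {i}) e (C k)"
    "\<And>k x. C k (\<lambda>i. complex_of_real (x i)) = complex_of_real (coeff (q x) k)" by blast
  define Q where "Q x = monom 1 d + (\<Sum>k<d. monom (C k x) k)" for x
  have coeff_Q: "coeff (Q x) k = (if k = d then 1 else if k < d then C k x else 0)" for x k
    by (auto simp: Q_def coeff_sum when_def)
  have degree_Q: "degree (Q x) = d" for x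
    by (intro antisym degree_le le_degree) (auto simp: coeff_Q)
  define F where "F x = poly (Q x) (x i)" for x
  have "Q (x(i := t)) = Q x" for x t
    by (intro poly_eqI) (auto simp: coeff_Q intro!: polyfun_cong[OF C(1)] split: if_splits)
  moreover have "polyfun (I - {i}) e (\<lambda>x. coeff (Q x) k)" for k
    using C(1)[of k] by (cases "k < d"; cases "k = d") (auto simp: coeff_Q polyfun.const)
  ultimately have "monic_in I i e F"
    unfolding monic_in_def F_def
    by (intro exI[of _ Q] exI[of _ d]) (auto simp: degree_Q coeff_Q q(1))
  moreover have "coeff (Q (\<lambda>i. complex_of_real (x i))) k = complex_of_real (coeff (q x) k)" for x k
    using q(3)[of x] q(4)[of x] by (simp add: coeff_Q C(2) coeff_eq_0)
  then have "F (\<lambda>i. complex_of_real (x i)) = complex_of_real (f x)" for x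
    using q(5)[of x "x i"] by (simp add: F_def poly_altdef degree_Q q(3))
  ultimately show ?thesis by blast
qed

lemma has_field_derivative_along_shear:
  fixes p :: "'a::real_normed_field mpoly"
  assumes "vars p \<subseteq> {..<n}" and singular: "\<And>j. j < n \<Longrightarrow> peval_pdiff j p (shear i a x) = 0"
  shows "((\<lambda>t. peval p (shear i a (x(i := t)))) has_field_derivative 0) (at (x i))"
proof -
  have "((\<lambda>t. shear i a (x(i := t)) j) has_field_derivative (if j = i then 1 else 0) + a j) (at (x i))" for j
    by (auto simp: shear_def intro!: derivative_eq_intros)
  from has_field_derivative_peval[OF finite_lessThan assms(1), of "\<lambda>t. shear i a (x(i := t))", OF this]
  show ?thesis
    using singular by (simp add: fun_upd_triv)
qed

lemma singular_zeros_real_discriminant: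
  fixes P :: "real mpoly"
  assumes P: "vars P \<subseteq> {..<4}" "irreducible P" "tdeg P \<le> D"
  obtains a f R where "a 3 = 0" "\<forall>j\<ge>4. a j = 0" "monic_in {..<4} 3 D f"
    "polyfun {..<3} (2 * D * D) R" "\<exists>x. R x \<noteq> 0"
    "\<forall>x. shear 3 a x \<in> singular_zeros P \<longrightarrow> f x = 0 \<and> R x = 0"
proof -
  have irred: "irreducible_polyfun {..<4} (peval P)" by (rule irreducible_polyfun_peval[OF P(2,1)])
  then obtain x\<^sub>0 where x\<^sub>0: "peval P x\<^sub>0 \<noteq> 0"
    unfolding irreducible_polyfun_def constant_on_def by blast
  obtain a c f where a: "a 3 = 0" "\<And>j. j \<notin> {..<4} \<Longrightarrow> a j = 0" and c: "c \<noteq> 0"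
    and f: "monic_in {..<4} 3 D f" "\<And>x. peval P (shear 3 a x) = c * f x"
    by (rule polyfun_shear_monic[OF polyfun_peval[OF P(3,1)] x\<^sub>0, of 3]) (simp, rule that)
  have f_irred: "irreducible_polyfun {..<4} f"
    by (rule irreducible_polyfun_shear[OF irred _ a(1) c f(2)]) simp
  have insert: "insert 3 {..<3} = {..<4 :: nat}" by auto
  obtain R where R: "polyfun {..<3} (2 * D * D) R" "\<exists>x. R x \<noteq> 0"
    "\<And>x. f x = 0 \<Longrightarrow> ((\<lambda>t. f (x(3 := t))) has_field_derivative 0) (at (x 3)) \<Longrightarrow> R x = 0"
    by (rule monic_discriminant[OF polyfun_model_space, of 3 f D]) (simp_all add: insert f(1) f_irred that)
  have "f x = 0 \<and> R x = 0" if "shear 3 a x \<in> singular_zeros P" for x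
  proof -
    have zero: "peval P (shear 3 a x) = 0" and singular: "\<And>i. i < 4 \<Longrightarrow> peval_pdiff i P (shear 3 a x) = 0"
      using that by (auto simp: singular_zeros_def realZ_def zeros_def)
    have "((\<lambda>t. inverse c * peval P (shear 3 a (x(3 := t)))) has_field_derivative inverse c * 0) (at (x 3))"
      by (intro DERIV_cmult has_field_derivative_along_shear[OF P(1) singular])
    then have derivative: "((\<lambda>t. f (x(3 := t))) has_field_derivative 0) (at (x 3))"
      using c by (simp add: f(2) flip: mult.assoc)
    have "f x = 0" using zero c by (simp add: f(2))
    with R(3)[OF this derivative] show ?thesis by simp
  qed
  then show ?thesis using a R(1,2) f(1) by (intro that[of a f R]) auto
qed

lemma singular_zeros_real_triangular:
  fixes P :: "real mpoly"
  assumes P: "vars P \<subseteq> {..<4}" "irreducible P" "tdeg P \<le> D"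
  obtains a b F G where "a 3 = 0" "\<forall>j\<ge>4. a j = 0" "b 2 = 0" "\<forall>j\<ge>3. b j = 0"
    "monic_in {..<4} 3 D F" "monic_in {..<3} 2 (2 * D * D) G"
    "\<forall>x. shear 3 a (shear 2 b x) \<in> singular_zeros P \<longrightarrow> F x = 0 \<and> G x = 0"
proof -
  obtain a f R where a: "a 3 = 0" "\<forall>j\<ge>4. a j = 0" and f: "monic_in {..<4} 3 D f"
    and R: "polyfun {..<3} (2 * D * D) R" "\<exists>x. R x \<noteq> 0"
    and fR: "\<forall>x. shear 3 a x \<in> singular_zeros P \<longrightarrow> f x = 0 \<and> R x = 0"
    by (rule singular_zeros_real_discriminant[OF P]) (rule that)
  from R(2) obtain x\<^sub>1 where x\<^sub>1: "R x\<^sub>1 \<noteq> 0" ..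
  obtain b c G where b: "b 2 = 0" "\<And>j. j \<notin> {..<3} \<Longrightarrow> b j = 0" and c: "c \<noteq> 0"
    and G: "monic_in {..<3} 2 (2 * D * D) G" "\<And>x. R (shear 2 b x) = c * G x"
    by (rule polyfun_shear_monic[OF R(1) x\<^sub>1, of 2]) (simp, rule that)
  have "monic_in {..<4} 3 D (\<lambda>x. f (shear 2 b x))"
  proof (rule monic_in_subst[OF f])
    show "polyfun ({..<4} - {3}) 1 (\<lambda>x. shear 2 b x j)" if "j \<in> {..<4} - {3}" for j
      by (rule polyfun_shear[where f = "\<lambda>x. x j", OF polyfun_var[OF that]]) auto
    show "shear 2 b (x(3 := t)) = (shear 2 b x)(3 := t)" for x t
      using b(2)[of 3] by (auto simp: shear_def)
  qed
  moreover have "f (shear 2 b x) = 0 \<and> G x = 0" if "shear 3 a (shear 2 b x) \<in> singular_zeros P" for x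
    using fR that G(2)[of x] c by auto
  ultimately show ?thesis using a b G(1) by (intro that[of a b "\<lambda>x. f (shear 2 b x)" G]) auto
qed

lemma singular_zeros_complex_triangular:
  fixes P :: "real mpoly"
  assumes P: "vars P \<subseteq> {..<4}" "irreducible P" "tdeg P \<le> D"
  obtains \<kappa> \<kappa>' F G where "linear_iso 4 \<kappa> \<kappa>'" "monic_in {..<4} 3 D F" "monic_in {..<3} 2 (2 * D * D) G"
    "singular_zeros P \<subseteq> real_points (\<kappa> ` triangular_set F G)"
proof -
  obtain a b f g where a: "a 3 = 0" "\<forall>j\<ge>4. a j = 0" and b: "b 2 = 0" "\<forall>j\<ge>3. b j = 0"
    and fg: "monic_in {..<4} 3 D f" "monic_in {..<3} 2 (2 * D * D) g"
    and fg_zero: "\<forall>x. shear 3 a (shear 2 b x) \<in> singular_zeros P \<longrightarrow> f x = 0 \<and> g x = 0"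
    by (rule singular_zeros_real_triangular[OF P]) (rule that)
  obtain F where F: "monic_in {..<4} 3 D F" "\<And>x. F (\<lambda>i. complex_of_real (x i)) = complex_of_real (f x)"
    using monic_in_complexify[OF fg(1)] by blast
  obtain G where G: "monic_in {..<3} 2 (2 * D * D) G"
    "\<And>x. G (\<lambda>i. complex_of_real (x i)) = complex_of_real (g x)"
    using monic_in_complexify[OF fg(2)] by blast
  define \<kappa> where "\<kappa> = shear 3 (\<lambda>j. complex_of_real (a j)) \<circ> shear 2 (\<lambda>j. complex_of_real (b j))"
  have "linear_iso 4 \<kappa> (shear 2 (\<lambda>j. - complex_of_real (b j)) \<circ> shear 3 (\<lambda>j. - complex_of_real (a j)))"
    unfolding \<kappa>_def using a b by (intro linear_iso_comp linear_iso_shear) auto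
  moreover have "p \<in> real_points (\<kappa> ` triangular_set F G)" if p: "p \<in> singular_zeros P" for p
  proof -
    define x where "x = shear 2 (\<lambda>j. - b j) (shear 3 (\<lambda>j. - a j) p)"
    have p_eq: "p = shear 3 a (shear 2 b x)" by (simp add: x_def shear_inverse a(1) b(1))
    have p_aff: "p \<in> aff 4" using p by (auto simp: singular_zeros_def realZ_def zeros_def)
    have "f x = 0 \<and> g x = 0" using fg_zero p p_eq by blast
    moreover have "x \<in> aff 4" unfolding x_def using p_aff a b by (intro shear_in_aff) auto
    ultimately have "(\<lambda>i. complex_of_real (x i)) \<in> triangular_set F G"
      by (auto simp: triangular_set_def aff_def F(2) G(2))
    moreover have "(\<lambda>i. complex_of_real (p i)) = \<kappa> (\<lambda>i. complex_of_real (x i))"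
      unfolding \<kappa>_def p_eq by (auto simp: shear_def)
    ultimately show ?thesis using p_aff by (auto simp: real_points_def)
  qed
  ultimately show ?thesis using F(1) G(1) by (intro that[of \<kappa> _ F G]) auto
qed

lemma singular_locus_enclosed:
  "\<exists>C. \<forall>P :: real mpoly. vars P \<subseteq> {..<4} \<and> irreducible P \<and> tdeg P \<le> D \<longrightarrow>
    (\<exists>Y :: (nat \<Rightarrow> complex) set. zclosed 4 Y \<and> zdim 4 Y \<le> 2 \<and> zdeg 4 Y \<le> C \<and>
      singular_zeros P \<subseteq> real_points Y)"
proof -
  define d where "d = D + 2 * D * D"
  define \<nu> where "\<nu> e = elim_degree (elim_degree (e + d + 1))" for e
  have "\<exists>Y :: (nat \<Rightarrow> complex) set. zclosed 4 Y \<and> zdim 4 Y \<le> 2 \<and>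
      zdeg 4 Y \<le> d * d * (elim_degree (\<nu> 1) * \<nu> 1 * (d * d)) \<and> singular_zeros P \<subseteq> real_points Y"
    if P: "vars P \<subseteq> {..<4}" "irreducible P" "tdeg P \<le> D" for P
  proof -
    obtain \<kappa> \<kappa>' F G where \<kappa>: "linear_iso 4 \<kappa> \<kappa>'"
      and FG: "monic_in {..<4} 3 D F" "monic_in {..<3} 2 (2 * D * D) G"
      and singular: "singular_zeros P \<subseteq> real_points (\<kappa> ` triangular_set F G)"
      by (rule singular_zeros_complex_triangular[OF P]) (rule that)
    have "monic_in {..<4} 3 d F" "monic_in {..<3} 2 d G"
      using FG by (auto simp: d_def intro: monic_in_mono)
    then have "finite_over_plane 4 (triangular_set F G) (\<lambda>y. y) (d * d) \<nu>"
      unfolding \<nu>_def by (rule triangular_set_finite_over_plane)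
    then interpret finite_over_plane 4 "\<kappa> ` triangular_set F G" "(\<lambda>y. y) \<circ> \<kappa>'" "d * d" \<nu>
      using \<kappa> by (rule finite_over_plane_linear_iso_image)
    show ?thesis using zclosed_Y zdim_le_2 zdeg_le singular by blast
  qed
  then show ?thesis by blast
qed

theorem theorem3p3:
  fixes D :: nat
  shows "\<exists>C :: nat. \<forall>P :: real mpoly.
    vars P \<subseteq> {..<4} \<and> irreducible P \<and> tdeg P \<le> D \<longrightarrow>
    (\<exists>Y :: (nat \<Rightarrow> complex) set. zclosed 4 Y \<and> zdim 4 Y \<le> 2 \<and> zdeg 4 Y \<le> C \<and>
       (\<forall>p \<in> realZ P - real_points Y. \<forall>\<gamma>1 \<gamma>2.
          plane_curve \<gamma>1 \<and> p \<in> iota ` curve_reg \<gamma>1 \<and> iota ` \<gamma>1 \<subseteq> realZ P \<and>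
          plane_curve \<gamma>2 \<and> p \<in> iota ` curve_reg \<gamma>2 \<and> iota ` \<gamma>2 \<subseteq> realZ P
          \<longrightarrow> \<gamma>1 = \<gamma>2))" (is "\<exists>C. \<forall>P. ?hypersurface P \<longrightarrow> (\<exists>Y. ?encloses C P Y)")
proof -
  obtain C where C: "\<forall>P :: real mpoly. ?hypersurface P \<longrightarrow>
      (\<exists>Y :: (nat \<Rightarrow> complex) set. zclosed 4 Y \<and> zdim 4 Y \<le> 2 \<and> zdeg 4 Y \<le> C \<and>
        singular_zeros P \<subseteq> real_points Y)"
    using singular_locus_enclosed[of D] ..
  have "\<exists>Y. ?encloses C P Y" if P: "?hypersurface P" for P
  proof -
    obtain Y :: "(nat \<Rightarrow> complex) set" where Y: "zclosed 4 Y" "zdim 4 Y \<le> 2" "zdeg 4 Y \<le> C"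
      and singular: "singular_zeros P \<subseteq> real_points Y"
      using C P by blast
    have "\<gamma>\<^sub>1 = \<gamma>\<^sub>2" if "p \<in> realZ P - real_points Y" "p \<in> iota ` curve_reg \<gamma>\<^sub>1" "iota ` \<gamma>\<^sub>1 \<subseteq> realZ P"
      "p \<in> iota ` curve_reg \<gamma>\<^sub>2" "iota ` \<gamma>\<^sub>2 \<subseteq> realZ P" for p \<gamma>\<^sub>1 \<gamma>\<^sub>2
      using that singular P by (intro regular_curve_unique[of P p]) auto
    with Y show ?thesis by blast
  qed
  then show ?thesis by blast
qed

end
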